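(* For each $\hat\rho_e\ge1$ there is an ETIS state $\mu_e^{(\hat\rho_e)}$ of the SSM on $\widehat X^*_e$, of density $\hat\rho_e$, which is a grand-canonical Gibbs state for the statistical-mechanical system with state space $\widehat X^*_e$ and one-body potential $V(n):=2\ln 2\,\delta_{n0}$. For $\hat\rho_e=1$, $\mu_e^{(\hat\rho_e)}=\hat\mu^{(2)}$, and hence it is ergodic but not weakly mixing (under translations). For $\hat\rho_e>1$, $\mu_e^{(\hat\rho_e)}$ is mixing (under translations).
   Context: SSM (symmetric stack model): the discrete-time Markov process on $\widehat X=\mathbb Z_+^{\mathbb Z}$, $\mathbb Z_+=\{0,1,2,\dots\}$. A stack $\mathbf n(i)$ is short if $\mathbf n(i)\le1$ and tall otherwise. In passing from $\mathbf n_t$ to $\mathbf n_{t+1}$, simultaneously for each bond $\langle k,k+1\rangle$: if both stacks are short no particle crosses the bond; if one is short and one tall, one particle moves from the tall to the short stack; if both are tall, one particle moves across the bond in a direction chosen with probability $1/2$ each (independently for different bonds). $\widehat X^*_e\subset\widehat X$ is the set of configurations such that every $\mathbf n(i)$ is even and no two adjacent sites both have height $0$; it is invariant under the dynamics, so the SSM restricts to a process on $\widehat X^*_e$. States are Borel probability measures; TIS = translation invariant and stationary; ETIS = extremal among TIS states. A state has density $\hat\rho$ if almost every $\mathbf n$ satisfies $\lim_{N}\frac1N\sum_{i=1}^N\mathbf n(i)=\lim_{N}\frac1N\sum_{i=-N}^{-1}\mathbf n(i)=\hat\rho$. $\hat\mu^{(2)}$ is the state giving probability $1/2$ to each of the two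 configurations in which stacks of height $0$ and $2$ alternate. Grand-canonical Gibbs state with fugacity $\zeta\in[0,1)$: the weak limit (convergence of probabilities of events depending on finitely many sites) as $L\to\infty$ of the measures $\mu^{(\zeta,L)}$ on a ring of $2L+1$ sites indexed by $\{-L,\dots,L\}$, where $\mu^{(\zeta,L)}$ is supported on those $\mathbf n\in\mathbb Z_+^{\{-L,\dots,L\}}$ with all $\mathbf n(i)$ even and no two (cyclically) adjacent zeros, with $\mu^{(\zeta,L)}(\mathbf n)$ proportional to $\zeta^{\sum_i\mathbf n(i)-2L-2}e^{-\sum_iV(\mathbf n(i))}$ (convention $0^0=1$). *)

theory Defs
  imports "HOL-Probability.Probability"
begin

section \<open>The symmetric stack model\<close>

type_synonym config = "int \<Rightarrow> nat"

definition short :: "nat \<Rightarrow> bool"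
  where "short h \<longleftrightarrow> h \<le> 1"

text \<open>The net number of particles crossing the bond between \<open>k\<close> and \<open>k + 1\<close> from left to right.
  The coin \<open>\<omega> k\<close> belongs to that bond and is used only if both stacks are tall.\<close>

definition flux :: "config \<Rightarrow> (int \<Rightarrow> bool) \<Rightarrow> int \<Rightarrow> int"
  where "flux n \<omega> k =
    (if short (n k) \<and> short (n (k + 1)) then 0
     else if short (n (k + 1)) then 1
     else if short (n k) then - 1
     else if \<omega> k then 1 else - 1)"

definition ssm_step :: "config \<Rightarrow> (int \<Rightarrow> bool) \<Rightarrow> config"
  where "ssm_step n \<omega> i = nat (int (n i) + flux n \<omega> (i - 1) - flux n \<omega> i)"

text \<open>The truncation by \<^const>\<open>nat\<close> is harmless: a stack that loses particles is tall.\<close>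

lemma int_ssm_step: "int (ssm_step n \<omega> i) = int (n i) + flux n \<omega> (i - 1) - flux n \<omega> i"
  by (auto simp: ssm_step_def flux_def short_def)

definition fair_coins :: "(int \<Rightarrow> bool) measure"
  where "fair_coins = PiM UNIV (\<lambda>_. measure_pmf (bernoulli_pmf (1/2)))"

definition ssm_kernel :: "config \<Rightarrow> config measure"
  where "ssm_kernel n = distr fair_coins borel (ssm_step n)"

definition Xe :: "config set"
  where "Xe = {n. (\<forall>i. even (n i)) \<and> (\<forall>i. \<not> (n i = 0 \<and> n (i + 1) = 0))}"

lemma ssm_step_Xe:
  assumes "n \<in> Xe"
  shows "ssm_step n \<omega> \<in> Xe"
proof -
  have ev: "even (n i)" and nz: "\<not> (n i = 0 \<and> n (i + 1) = 0)" for i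
    using assms by (auto simp: Xe_def)
  have short0: "short (n i) \<longleftrightarrow> n i = 0" for i
    using ev[of i] by (auto simp: short_def le_Suc_eq)
  have s0: "short 0"
    by (simp add: short_def)
  have "odd (flux n \<omega> k)" for k
    using nz[of k] by (auto simp: flux_def short0)
  then have "even (int (ssm_step n \<omega> i))" for i
    using ev[of i] by (auto simp: int_ssm_step)
  moreover have "\<not> (ssm_step n \<omega> i = 0 \<and> ssm_step n \<omega> (i + 1) = 0)" for i
  proof
    assume "ssm_step n \<omega> i = 0 \<and> ssm_step n \<omega> (i + 1) = 0"
    then have a: "int (n i) + flux n \<omega> (i - 1) - flux n \<omega> i = 0"
      and b: "int (n (i + 1)) + flux n \<omega> i - flux n \<omega> (i + 1) = 0"
      using int_ssm_step[of n \<omega> i] int_ssm_step[of n \<omega> "i + 1"] by auto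
    have l: "n j = 0 \<or> n j \<ge> 2" for j
      using ev[of j] by (cases "n j = 0"; cases "n j = 1") auto
    have fl: "flux n \<omega> k \<in> {-1, 1}" for k
      using nz[of k] by (auto simp: flux_def short0)
    have f0: "n i = 0 \<Longrightarrow> flux n \<omega> i = -1 \<and> flux n \<omega> (i - 1) = 1"
      using nz[of i] nz[of "i - 1"] by (auto simp: flux_def short0 s0)
    have f1: "n (i + 1) = 0 \<Longrightarrow> flux n \<omega> i = 1 \<and> flux n \<omega> (i + 1) = -1"
      using nz[of i] nz[of "i + 1"] by (auto simp: flux_def short0 s0)
    show False
      using a b l[of i] l[of "i + 1"] fl[of i] fl[of "i - 1"] fl[of "i + 1"] f0 f1 by auto
  qed
  ultimately show ?thesis
    by (auto simp: Xe_def)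
qed

lemma sets_borel_config: "sets (borel :: config measure) = sets (PiM UNIV (\<lambda>_. count_space UNIV))"
proof -
  have "sets (PiM UNIV (\<lambda>_::int. count_space (UNIV :: nat set))) = sets (PiM UNIV (\<lambda>_::int. (borel :: nat measure)))"
    by (intro sets_PiM_cong) (auto simp: sets_borel_eq_count_space)
  then show ?thesis
    by (simp add: sets_PiM_equal_borel)
qed

lemma measurable_ssm_step:
  "(\<lambda>(n, \<omega>). ssm_step n \<omega>) \<in> borel \<Otimes>\<^sub>M fair_coins \<rightarrow>\<^sub>M borel"
proof -
  let ?M = "PiM UNIV (\<lambda>_::int. count_space (UNIV :: nat set)) \<Otimes>\<^sub>M
    PiM UNIV (\<lambda>_::int. count_space (UNIV :: bool set))"
  have sc: "sets fair_coins = sets (PiM UNIV (\<lambda>_. count_space UNIV))"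
    unfolding fair_coins_def by (intro sets_PiM_cong) auto
  have M: "sets ((borel :: config measure) \<Otimes>\<^sub>M fair_coins) = sets ?M"
    by (intro sets_pair_measure_cong sets_borel_config sc)
  have co: "(\<lambda>x. fst x k) \<in> measurable ?M (count_space UNIV)"
    "(\<lambda>x. snd x k) \<in> measurable ?M (count_space UNIV)" for k :: int
    by measurable
  have "(\<lambda>x. ssm_step (fst x) (snd x) i) \<in> measurable ?M (count_space UNIV)" for i
    unfolding ssm_step_def flux_def
    using co(1)[of i] co(1)[of "i - 1"] co(1)[of "i - 1 + 1"] co(1)[of "i + 1"] co(2)[of i] co(2)[of "i - 1"]
    by measurable
  then have "(\<lambda>x. ssm_step (fst x) (snd x)) \<in> measurable ?M (PiM UNIV (\<lambda>_. count_space UNIV))"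
    by (intro measurable_PiM_single') (auto simp: space_PiM)
  then show ?thesis
    by (simp add: measurable_cong_sets[OF M sets_borel_config] split_beta')
qed

lemma measurable_ssm_kernel: "ssm_kernel \<in> borel \<rightarrow>\<^sub>M prob_algebra borel"
proof -
  have "prob_space fair_coins"
    unfolding fair_coins_def by (intro prob_space_PiM prob_space_measure_pmf)
  then have "(\<lambda>_. fair_coins) \<in> (borel :: config measure) \<rightarrow>\<^sub>M prob_algebra fair_coins"
    by (simp add: space_prob_algebra)
  from measurable_distr_prob_space2[OF this measurable_ssm_step]
  show ?thesis
    by (simp add: ssm_kernel_def[abs_def])
qed

section \<open>States\<close>

definition shift :: "config \<Rightarrow> config"
  where "shift n = (\<lambda>i. n (i + 1))"

text \<open>Borel probability measures on a Borel set \<open>S\<close> of configurations are represented as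
  Borel probability measures on the space of all configurations that are carried by \<open>S\<close>.\<close>

definition state_on :: "config set \<Rightarrow> config measure \<Rightarrow> bool"
  where "state_on S \<mu> \<longleftrightarrow> prob_space \<mu> \<and> sets \<mu> = sets borel \<and> (AE n in \<mu>. n \<in> S)"

definition translation_invariant :: "config measure \<Rightarrow> bool"
  where "translation_invariant \<mu> \<longleftrightarrow> distr \<mu> borel shift = \<mu>"

definition stationary :: "config measure \<Rightarrow> bool"
  where "stationary \<mu> \<longleftrightarrow> \<mu> \<bind> ssm_kernel = \<mu>"

definition TIS :: "config set \<Rightarrow> config measure \<Rightarrow> bool"
  where "TIS S \<mu> \<longleftrightarrow> state_on S \<mu> \<and> translation_invariant \<mu> \<and> stationary \<mu>"

definition ETIS :: "config set \<Rightarrow> config measure \<Rightarrow> bool"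
  where "ETIS S \<mu> \<longleftrightarrow> TIS S \<mu> \<and>
    (\<forall>\<nu>\<^sub>1 \<nu>\<^sub>2 t. TIS S \<nu>\<^sub>1 \<longrightarrow> TIS S \<nu>\<^sub>2 \<longrightarrow> 0 < t \<longrightarrow> t < 1 \<longrightarrow>
      (\<forall>A\<in>sets borel. measure \<mu> A = t * measure \<nu>\<^sub>1 A + (1 - t) * measure \<nu>\<^sub>2 A) \<longrightarrow>
      \<nu>\<^sub>1 = \<mu> \<and> \<nu>\<^sub>2 = \<mu>)"

definition has_density :: "config measure \<Rightarrow> real \<Rightarrow> bool"
  where "has_density \<mu> \<rho> \<longleftrightarrow> (AE n in \<mu>.
    (\<lambda>N. (\<Sum>i = 1..int N. real (n i)) / real N) \<longlonglongrightarrow> \<rho> \<and>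
    (\<lambda>N. (\<Sum>i = - int N..-1. real (n i)) / real N) \<longlonglongrightarrow> \<rho>)"

definition mu_hat2 :: "config measure"
  where "mu_hat2 = distr (measure_pmf (pmf_of_set
    {\<lambda>i. if even i then 0 else 2, \<lambda>i. if even i then 2 else 0})) borel (\<lambda>n. n)"

text \<open>The next three notions are meant for translation invariant states.\<close>

definition ergodic :: "config measure \<Rightarrow> bool"
  where "ergodic \<mu> \<longleftrightarrow> (\<forall>A\<in>sets borel. shift -` A = A \<longrightarrow> measure \<mu> A = 0 \<or> measure \<mu> A = 1)"

definition weakly_mixing :: "config measure \<Rightarrow> bool"
  where "weakly_mixing \<mu> \<longleftrightarrow> (\<forall>A\<in>sets borel. \<forall>B\<in>sets borel.
    (\<lambda>N. (\<Sum>k<N. \<bar>measure \<mu> ((shift ^^ k) -` A \<inter> B) - measure \<mu> A * measure \<mu> B\<bar>) / real N)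
      \<longlonglongrightarrow> 0)"

definition mixing :: "config measure \<Rightarrow> bool"
  where "mixing \<mu> \<longleftrightarrow> (\<forall>A\<in>sets borel. \<forall>B\<in>sets borel.
    (\<lambda>k. measure \<mu> ((shift ^^ k) -` A \<inter> B)) \<longlonglongrightarrow> measure \<mu> A * measure \<mu> B)"

section \<open>Grand-canonical Gibbs states\<close>

abbreviation ring_sites :: "nat \<Rightarrow> int set"
  where "ring_sites L \<equiv> {- int L..int L}"

definition ring_next :: "nat \<Rightarrow> int \<Rightarrow> int"
  where "ring_next L i = (if i = int L then - int L else i + 1)"

definition ring_configs :: "nat \<Rightarrow> config set"
  where "ring_configs L = {n \<in> ring_sites L \<rightarrow>\<^sub>E UNIV. \<forall>i\<in>ring_sites L.
    even (n i) \<and> \<not> (n i = 0 \<and> n (ring_next L i) = 0)}"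

text \<open>A configuration on the ring has at most \<open>L\<close> zeros, hence at least \<open>2 L + 2\<close> particles, so that
  the subtraction of natural numbers below is never truncated on \<^const>\<open>ring_configs\<close>.\<close>

definition gibbs_weight :: "(nat \<Rightarrow> real) \<Rightarrow> real \<Rightarrow> nat \<Rightarrow> config \<Rightarrow> real"
  where "gibbs_weight V \<zeta> L n =
    \<zeta> ^ ((\<Sum>i\<in>ring_sites L. n i) - (2 * L + 2)) * exp (- (\<Sum>i\<in>ring_sites L. V (n i)))"

definition partition_function :: "(nat \<Rightarrow> real) \<Rightarrow> real \<Rightarrow> nat \<Rightarrow> real"
  where "partition_function V \<zeta> L = (\<Sum>\<^sub>\<infinity>n\<in>ring_configs L. gibbs_weight V \<zeta> L n)"

definition ring_gibbs :: "(nat \<Rightarrow> real) \<Rightarrow> real \<Rightarrow> nat \<Rightarrow> config measure"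
  where "ring_gibbs V \<zeta> L = point_measure (ring_configs L)
    (\<lambda>n. ennreal (gibbs_weight V \<zeta> L n / partition_function V \<zeta> L))"

definition depends_on :: "int set \<Rightarrow> config set \<Rightarrow> bool"
  where "depends_on W A \<longleftrightarrow> (\<forall>n n'. (\<forall>i\<in>W. n i = n' i) \<longrightarrow> (n \<in> A \<longleftrightarrow> n' \<in> A))"

text \<open>An event \<open>A\<close> depending on a finite set \<open>W\<close> of sites is automatically Borel. It makes sense on
  the ring as soon as \<open>W\<close> is contained in \<^const>\<open>ring_sites\<close>; the values for smaller \<open>L\<close> do not
  affect the limit.\<close>

definition gibbs_state :: "(nat \<Rightarrow> real) \<Rightarrow> real \<Rightarrow> config measure \<Rightarrow> bool"
  where "gibbs_state V \<zeta> \<mu> \<longleftrightarrow> state_on Xe \<mu> \<and>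
    (\<forall>W A. finite W \<longrightarrow> depends_on W A \<longrightarrow>
      (\<lambda>L. measure (ring_gibbs V \<zeta> L) (A \<inter> ring_configs L)) \<longlonglongrightarrow> measure \<mu> A)"

end

theory Submission imports Defs begin

text \<open>On \<^const>\<open>Xe\<close> exactly one particle crosses every bond at every step, so the fluxes form a
  configuration of spins \<open>f\<close>. Take for \<open>f\<close> the stationary symmetric two-state chain whose flips are
  i.i.d. with probability \<open>1 / (1 + \<zeta>)\<close>, take i.i.d. geometric variables \<open>g i\<close> of ratio \<open>\<zeta>\<^sup>2\<close>, and
  let the stack at \<open>i\<close> have height \<open>2 (g i + 1)\<close>, lowered by \<open>2\<close> if both adjacent spins point towards it.
  Moving particles along the spins has the same effect as reversing all spins, which preserves the law.
  The joint weight of stacks and spins telescopes to a function of the stacks alone times the indicator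
  of compatibility; hence given the stacks the spins are the fluxes of the model, which gives
  stationarity, and summing out the spins on a ring gives the weights \<open>4\<close> to the minus number of zeros,
  that is, the potential of the theorem. The density is \<open>1 / (1 - \<zeta>)\<close>, by the strong law of large
  numbers for the flips and the \<open>g i\<close>, because the spin contribution to the height is a flip up to a
  telescoping term. Distant windows interact only through the parity of the number of flips between
  them, which gives mixing for \<open>\<zeta> > 0\<close>; and a mixing state is extremal, since by the
  Radon-Nikodym theorem it is the only translation invariant state that is absolutely continuous
  with respect to it.\<close>

subsection \<open>Cylinder events and mixing\<close>

text \<open>The stacks alone are awkward to build, because two neighbours must not both be empty.
  With spins on the bonds this condition is automatic: an empty stack needs both adjacent spins to
  point inwards, so two adjacent empty stacks would ask opposite things of the bond between them.
  The constants are what makes the weight telescope. Since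
  \<open>(1 - z\<^sup>2) / (1 + z) = 1 - z\<close>, in each of the four spin cases around a site the
  height \<open>n\<close> has probability \<open>(1 - z) * z ^ n / z\<close> times
  \<open>u c / u c'\<close>, where \<open>c\<close> and \<open>c'\<close> are the spins left and
  right of the site and \<open>u\<close> is \<open>z\<close> for a right-pointing spin and 1
  otherwise. Inside a window all spins therefore cancel, and on a ring also those at the ends. Zero
  fugacity resists this method: weights are divided by \<open>z\<close>, and every site flips, so
  the parity of the flips between two windows stays deterministic. Density one is therefore treated
  by hand: two-point support replaces mixing in the proof of extremality, and the Gibbs limit
  becomes a count of minimal ring configurations.\<close>

lemma measurable_coord [measurable]: "(\<lambda>n. n i) \<in> (borel :: config measure) \<rightarrow>\<^sub>M count_space UNIV"
  by (simp add: measurable_cong_sets[OF sets_borel_config refl])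

lemma measurable_into_config:
  assumes "\<And>i. (\<lambda>x. f x i) \<in> M \<rightarrow>\<^sub>M count_space UNIV"
  shows "f \<in> M \<rightarrow>\<^sub>M (borel :: config measure)"
  unfolding measurable_cong_sets[OF refl sets_borel_config]
  by (rule measurable_PiM_single') (use assms in \<open>auto simp: space_PiM\<close>)

text \<open>Only countably many patterns on \<open>J\<close> exist and each is a measurable event,
  so any function of the pattern is measurable, however it is defined. Cylinder events, spins,
  parities and fluxes are all covered by this.\<close>

lemma measurable_finitely_determined:
  fixes f :: "('i \<Rightarrow> 'a::countable) \<Rightarrow> 'b"
  assumes J: "finite J" and f: "\<And>x y. (\<And>i. i \<in> J \<Longrightarrow> x i = y i) \<Longrightarrow> f x = f y"
  shows "f \<in> PiM UNIV (\<lambda>_. count_space UNIV) \<rightarrow>\<^sub>M count_space UNIV"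
proof -
  have cnt: "countable (J \<rightarrow>\<^sub>E (UNIV :: 'a set))"
    using J by (intro countable_PiE) auto
  have "(\<lambda>x. restrict x J) -` {a} \<inter> space (PiM UNIV (\<lambda>_. count_space UNIV)) \<in> sets (PiM UNIV (\<lambda>_. count_space UNIV))"
    if "a \<in> J \<rightarrow>\<^sub>E (UNIV :: 'a set)" for a
  proof -
    have "(\<lambda>x. restrict x J) -` {a} = {x. \<forall>i\<in>J. x i = a i}"
      using that by (fastforce simp: fun_eq_iff PiE_iff extensional_def)
    moreover have "{x \<in> space (PiM UNIV (\<lambda>_. count_space UNIV)). \<forall>i\<in>J. x i = a i} \<in> sets (PiM UNIV (\<lambda>_. count_space UNIV))"
      using J by measurable
    ultimately show ?thesis
      by (simp add: space_PiM)
  qed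
  then have "(\<lambda>x. restrict x J) \<in> PiM UNIV (\<lambda>_. count_space UNIV) \<rightarrow>\<^sub>M count_space (J \<rightarrow>\<^sub>E (UNIV :: 'a set))"
    by (subst measurable_count_space_eq_countable[OF cnt]) auto
  from measurable_compose[OF this, of f "count_space UNIV"]
  have "(\<lambda>x. f (restrict x J)) \<in> PiM UNIV (\<lambda>_. count_space UNIV) \<rightarrow>\<^sub>M count_space UNIV"
    by simp
  moreover have "f (restrict x J) = f x" for x
    by (rule f) simp
  ultimately show ?thesis by simp
qed

lemma sets_depends_on:
  assumes "finite W" "depends_on W A"
  shows "A \<in> sets borel"
proof -
  have "(\<lambda>n. n \<in> A) \<in> PiM UNIV (\<lambda>_. count_space UNIV) \<rightarrow>\<^sub>M count_space UNIV"
    using assms unfolding depends_on_def by (intro measurable_finitely_determined[of W]) auto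
  then have "(\<lambda>n. n \<in> A) \<in> borel \<rightarrow>\<^sub>M count_space UNIV"
    by (simp add: measurable_cong_sets[OF sets_borel_config refl])
  from measurable_sets[OF this, of "{True}"] show ?thesis
    by (simp add: vimage_def)
qed

lemma depends_on_mono: "depends_on W A \<Longrightarrow> W \<subseteq> W' \<Longrightarrow> depends_on W' A"
  unfolding depends_on_def by blast

lemma finite_subset_symmetric_interval:
  assumes "finite (W :: int set)"
  obtains M :: nat where "W \<subseteq> {- int M..int M}"
proof -
  obtain N :: nat where "\<forall>x\<in>(\<lambda>i. nat \<bar>i\<bar>) ` W. x \<le> N"
    using assms by (meson finite_imageI finite_nat_set_iff_bounded_le)
  then show ?thesis
    by (intro that[of N]) force
qed

text \<open>Windows centred at the origin are nested, so two cylinder events always share a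
  window.\<close>

definition cylinders :: "config set set"
  where "cylinders = {A. \<exists>M::nat. depends_on {- int M..int M} A}"

lemma cylinders_sets: "A \<in> cylinders \<Longrightarrow> A \<in> sets borel"
  by (auto simp: cylinders_def intro: sets_depends_on)

lemma Int_stable_cylinders: "Int_stable cylinders"
proof (rule Int_stableI)
  fix A B assume "A \<in> cylinders" "B \<in> cylinders"
  then obtain M N where "depends_on {- int M..int M} A" "depends_on {- int N..int N} B"
    by (auto simp: cylinders_def)
  then have "depends_on {- int (max M N)..int (max M N)} A" "depends_on {- int (max M N)..int (max M N)} B"
    by (auto elim!: depends_on_mono)
  then have "depends_on {- int (max M N)..int (max M N)} (A \<inter> B)"
    unfolding depends_on_def by blast
  then show "A \<inter> B \<in> cylinders"
    by (auto simp: cylinders_def)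
qed

lemma sigma_sets_cylinders: "sigma_sets UNIV cylinders = sets borel"
proof
  show "sigma_sets UNIV cylinders \<subseteq> sets borel"
    using cylinders_sets by (intro sets.sigma_sets_subset') auto
  have "{f \<in> \<Pi>\<^sub>E i\<in>UNIV. space (count_space UNIV). f i \<in> A} \<in> cylinders" for i :: int and A :: "nat set"
  proof -
    have "depends_on {- int (nat \<bar>i\<bar>)..int (nat \<bar>i\<bar>)} {f. f i \<in> A}"
      unfolding depends_on_def by (intro allI impI, drule bspec[of _ _ i]) auto
    then have "{f. f i \<in> A} \<in> cylinders"
      unfolding cylinders_def by blast
    then show ?thesis
      by simp
  qed
  then show "sets borel \<subseteq> sigma_sets UNIV cylinders"
    unfolding sets_borel_config sets_PiM_single
    by (auto simp: PiE_UNIV_domain intro!: sigma_sets_mono')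
qed

lemma config_measure_eqI:
  fixes M N :: "config measure"
  assumes "prob_space M" "prob_space N" and sets: "sets M = sets borel" "sets N = sets borel"
    and eq: "\<And>A. A \<in> cylinders \<Longrightarrow> measure M A = measure N A"
  shows "M = N"
proof (rule measure_eqI_generator_eq[where E = cylinders and \<Omega> = UNIV and A = "\<lambda>_. UNIV"])
  interpret M: prob_space M by fact
  interpret N: prob_space N by fact
  show "emeasure M X = emeasure N X" if "X \<in> cylinders" for X
    using eq[OF that] by (simp add: M.emeasure_eq_measure N.emeasure_eq_measure)
  show "emeasure M UNIV \<noteq> \<infinity>"
    by simp
qed (use Int_stable_cylinders sigma_sets_cylinders sets in \<open>auto simp: cylinders_def depends_on_def\<close>)

lemma shift_power: "(shift ^^ k) n = (\<lambda>i. n (i + int k))"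
  by (induction k) (auto simp: shift_def algebra_simps)

lemma measurable_shift_power [measurable]: "shift ^^ k \<in> borel \<rightarrow>\<^sub>M borel"
  by (rule measurable_into_config) (simp add: shift_power)

lemma measurable_shift [measurable]: "shift \<in> borel \<rightarrow>\<^sub>M borel"
  using measurable_shift_power[of 1] by simp

lemma measure_shift_power:
  assumes ti: "translation_invariant \<mu>" and sets: "sets \<mu> = sets borel" and A: "A \<in> sets borel"
  shows "measure \<mu> ((shift ^^ k) -` A) = measure \<mu> A"
proof (induction k)
  case (Suc k)
  have m: "shift \<in> measurable \<mu> borel"
    using sets by (simp cong: measurable_cong_sets)
  have [measurable]: "(shift ^^ k) -` A \<in> sets borel"
    using measurable_sets[OF measurable_shift_power A] by simp
  have "measure \<mu> ((shift ^^ Suc k) -` A) = measure \<mu> (shift -` ((shift ^^ k) -` A) \<inter> space \<mu>)"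
    using sets_eq_imp_space_eq[OF sets] by (simp only: funpow_Suc_right vimage_comp) simp
  also have "\<dots> = measure (distr \<mu> borel shift) ((shift ^^ k) -` A)"
    by (rule measure_distr[OF m, symmetric]) simp
  also have "\<dots> = measure \<mu> A"
    using Suc ti by (simp add: translation_invariant_def)
  finally show ?case .
qed simp

text \<open>An exchange of limits: the error \<open>e j\<close> is uniform in \<open>k\<close>. It
  is used for countable disjoint unions and for approximation in mean.\<close>

lemma tendsto_uniform_approx:
  fixes a :: "nat \<Rightarrow> real"
  assumes b: "\<And>j. (\<lambda>k. b j k) \<longlonglongrightarrow> l j" and close: "\<And>j k. \<bar>a k - b j k\<bar> \<le> e j"
    and e: "e \<longlonglongrightarrow> 0" and l: "l \<longlonglongrightarrow> L"
  shows "a \<longlonglongrightarrow> L"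
proof (rule LIMSEQ_I)
  fix r :: real assume r: "0 < r"
  have "\<forall>\<^sub>F j in sequentially. e j < r / 3 \<and> \<bar>l j - L\<bar> < r / 3"
    using eventually_conj[OF order_tendstoD(2)[OF e, of "r / 3"] tendstoD[OF l, of "r / 3"]] r
    by (simp add: dist_real_def)
  then obtain j where j: "e j < r / 3" "\<bar>l j - L\<bar> < r / 3"
    unfolding eventually_sequentially by blast
  obtain K where K: "\<And>k. k \<ge> K \<Longrightarrow> \<bar>b j k - l j\<bar> < r / 3"
    using LIMSEQ_D[OF b[of j], of "r / 3"] r by auto
  show "\<exists>no. \<forall>n\<ge>no. norm (a n - L) < r"
  proof (intro exI allI impI)
    fix k assume "k \<ge> K"
    then show "norm (a k - L) < r"
      using K[of k] j close[of k j] unfolding real_norm_def by linarith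
  qed
qed

text \<open>Since \<open>h k\<close> preserves probabilities, the tail of the union costs at most
  its own probability, uniformly in \<open>k\<close>, and finite unions suffice. Both
  \<open>h\<close> and \<open>C\<close> may vary with \<open>k\<close>, so that the union can sit in
  the moving event or in the fixed one.\<close>

lemma (in prob_space) tendsto_prob_vimage_UN:
  fixes A :: "nat \<Rightarrow> 'a set" and h :: "nat \<Rightarrow> 'a \<Rightarrow> 'a"
  assumes A: "disjoint_family A" "range A \<subseteq> events"
    and lim: "\<And>i. (\<lambda>k. prob (h k -` A i \<inter> C k)) \<longlonglongrightarrow> prob (A i) * c"
    and h: "\<And>k X. X \<in> events \<Longrightarrow> h k -` X \<in> events \<and> prob (h k -` X) = prob X"
    and C: "\<And>k. C k \<in> events"
  shows "(\<lambda>k. prob (h k -` (\<Union>i. A i) \<inter> C k)) \<longlonglongrightarrow> prob (\<Union>i. A i) * c"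
proof (rule tendsto_uniform_approx)
  have A': "A i \<in> events" for i using A by auto
  let ?U = "\<lambda>j. \<Union>i<j. A i"
  show "(\<lambda>k. \<Sum>i<j. prob (h k -` (A i) \<inter> C k)) \<longlonglongrightarrow> (\<Sum>i<j. prob (A i) * c)" for j
    by (intro tendsto_sum lim)
  have fin: "(\<Sum>i<j. prob (h k -` (A i) \<inter> C k)) = prob (h k -` (?U j) \<inter> C k)" for j k
  proof -
    have "prob (\<Union>i<j. h k -` (A i) \<inter> C k) = (\<Sum>i<j. prob (h k -` (A i) \<inter> C k))"
    proof (rule finite_measure_finite_Union)
      show "disjoint_family_on (\<lambda>i. h k -` (A i) \<inter> C k) {..<j}"
      proof (clarsimp simp: disjoint_family_on_def)
        fix m n :: nat assume "m \<noteq> n"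
        then have "h k -` (A m) \<inter> h k -` (A n) = {}"
          using A(1) by (auto simp: disjoint_family_on_def)
        then show "h k -` (A m) \<inter> C k \<inter> (h k -` (A n) \<inter> C k) = {}" by auto
      qed
    qed (use A' h C in auto)
    then show ?thesis by (simp add: vimage_UN)
  qed
  have Usets: "?U j \<in> events" "(\<Union>i. A i) \<in> events" for j
    using A' by auto
  show "\<bar>prob (h k -` (\<Union>i. A i) \<inter> C k) - (\<Sum>i<j. prob (h k -` (A i) \<inter> C k))\<bar> \<le> prob (\<Union>i. A i) - prob (?U j)" for j k
  proof -
    have sub: "h k -` (?U j) \<subseteq> h k -` (\<Union>i. A i)"
      by auto
    have "prob (h k -` (\<Union>i. A i) \<inter> C k) - prob (h k -` (?U j) \<inter> C k) = prob ((h k -` (\<Union>i. A i) \<inter> C k) - (h k -` (?U j) \<inter> C k))"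
      using sub h[OF Usets(1)[of j], of k] h[OF Usets(2), of k] C by (intro finite_measure_Diff[symmetric]) auto
    also have "\<dots> \<le> prob (h k -` (\<Union>i. A i) - h k -` (?U j))"
      using h[OF Usets(1)[of j], of k] h[OF Usets(2), of k] by (intro finite_measure_mono) auto
    also have "\<dots> = prob (\<Union>i. A i) - prob (?U j)"
      using sub h[OF Usets(1)[of j], of k] h[OF Usets(2), of k] by (subst finite_measure_Diff) auto
    finally have "prob (h k -` (\<Union>i. A i) \<inter> C k) - prob (h k -` (?U j) \<inter> C k) \<le> prob (\<Union>i. A i) - prob (?U j)" .
    moreover have "prob (h k -` (?U j) \<inter> C k) \<le> prob (h k -` (\<Union>i. A i) \<inter> C k)"
      using sub h[OF Usets(2), of k] C by (intro finite_measure_mono) auto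
    ultimately show ?thesis by (simp add: fin)
  qed
  have sums: "(\<lambda>i. prob (A i)) sums prob (\<Union>i. A i)"
    using A by (intro finite_measure_UNION) auto
  have U: "prob (?U j) = (\<Sum>i<j. prob (A i))" for j
    using A by (intro finite_measure_finite_Union) (auto simp: disjoint_family_on_def)
  show "(\<lambda>j. prob (\<Union>i. A i) - prob (?U j)) \<longlonglongrightarrow> 0"
    using tendsto_diff[OF tendsto_const[of "prob (\<Union>i. A i)"] sums[unfolded sums_def]] by (simp add: U)
  show "(\<lambda>j. \<Sum>i<j. prob (A i) * c) \<longlonglongrightarrow> prob (\<Union>i. A i) * c"
    using tendsto_mult_right[OF sums[unfolded sums_def], of c] by (simp add: sum_distrib_right)
qed

text \<open>Fixing one of the two events, those other events for which the correlation decays form a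
  Dynkin system.\<close>

lemma mixing_if_cylinders:
  fixes \<mu> :: "config measure"
  assumes "prob_space \<mu>" and sets: "sets \<mu> = sets borel" and ti: "translation_invariant \<mu>"
    and cyl: "\<And>A B. A \<in> cylinders \<Longrightarrow> B \<in> cylinders \<Longrightarrow>
      (\<lambda>k. measure \<mu> ((shift ^^ k) -` A \<inter> B)) \<longlonglongrightarrow> measure \<mu> A * measure \<mu> B"
  shows "mixing \<mu>"
proof -
  interpret prob_space \<mu> by fact
  have sp: "space \<mu> = UNIV"
    using sets_eq_imp_space_eq[OF sets] by simp
  have [measurable_cong, simp]: "sets \<mu> = sets borel" by fact
  have pre: "(shift ^^ k) -` A \<in> sets borel" if "A \<in> sets borel" for A k
    using measurable_sets[OF measurable_shift_power that] by simp
  note inv = measure_shift_power[OF ti sets]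
  \<comment> \<open>First \<open>A\<close> passes from cylinders to Borel sets while
    \<open>B\<close> stays a cylinder; afterwards \<open>B\<close> is extended for an arbitrary
    Borel set \<open>A\<close>.\<close>
  have step1: "(\<lambda>k. prob ((shift ^^ k) -` A \<inter> B)) \<longlonglongrightarrow> prob A * prob B"
    if B: "B \<in> cylinders" and A: "A \<in> sets borel" for A B
    using Int_stable_cylinders subset_UNIV[of cylinders, folded Pow_UNIV] A[folded sigma_sets_cylinders]
  proof (induction rule: sigma_sets_induct_disjoint)
    case (compl A)
    then have A: "A \<in> sets borel" by (simp add: sigma_sets_cylinders)
    have "prob ((shift ^^ k) -` (UNIV - A) \<inter> B) = prob B - prob ((shift ^^ k) -` A \<inter> B)" for k
    proof -
      have "(shift ^^ k) -` (UNIV - A) \<inter> B = B - ((shift ^^ k) -` A \<inter> B)" by auto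
      then show ?thesis
        using pre[OF A, of k] cylinders_sets[OF B] by (simp add: finite_measure_Diff)
    qed
    moreover have "prob (UNIV - A) = 1 - prob A"
      using prob_compl[of A] A by (simp add: sp)
    ultimately show ?case
      using tendsto_diff[OF tendsto_const[of "prob B"] compl(2)] by (simp add: left_diff_distrib)
  next
    case (union A)
    show ?case
      by (rule tendsto_prob_vimage_UN[where h = "\<lambda>k. shift ^^ k" and C = "\<lambda>_. B"])
        (use union cylinders_sets[OF B] inv pre in \<open>auto simp: sigma_sets_cylinders\<close>)
  qed (use cyl B in auto)
  have "(\<lambda>k. prob ((shift ^^ k) -` A \<inter> B)) \<longlonglongrightarrow> prob A * prob B"
    if A: "A \<in> sets borel" and B: "B \<in> sets borel" for A B
    using Int_stable_cylinders subset_UNIV[of cylinders, folded Pow_UNIV] B[folded sigma_sets_cylinders]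
  proof (induction rule: sigma_sets_induct_disjoint)
    case (compl B)
    then have B: "B \<in> sets borel" by (simp add: sigma_sets_cylinders)
    have "prob ((shift ^^ k) -` A \<inter> (UNIV - B)) = prob A - prob ((shift ^^ k) -` A \<inter> B)" for k
    proof -
      have "(shift ^^ k) -` A \<inter> (UNIV - B) = (shift ^^ k) -` A - ((shift ^^ k) -` A \<inter> B)" by auto
      then show ?thesis
        using pre[OF A, of k] B inv[OF A] by (simp add: finite_measure_Diff)
    qed
    moreover have "prob (UNIV - B) = 1 - prob B"
      using prob_compl[of B] B by (simp add: sp)
    ultimately show ?case
      using tendsto_diff[OF tendsto_const[of "prob A"] compl(2)] by (simp add: right_diff_distrib)
  next
    case (union B)
    \<comment> \<open>The union now sits in the fixed event, so the map is \<open>id\<close> and the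
      translate of \<open>A\<close> plays the part of \<open>C k\<close>.\<close>
    have "(\<lambda>k. prob (vimage id (\<Union>i. B i) \<inter> (shift ^^ k) -` A)) \<longlonglongrightarrow> prob (\<Union>i. B i) * prob A"
      by (rule tendsto_prob_vimage_UN[where h = "\<lambda>_. id" and C = "\<lambda>k. (shift ^^ k) -` A"])
        (use union pre A in \<open>auto simp: sigma_sets_cylinders Int_commute mult.commute\<close>)
    then show ?case
      by (simp add: Int_commute mult.commute)
  qed (use step1 A in auto)
  then show ?thesis
    unfolding mixing_def by blast
qed

section \<open>Extremality of mixing states\<close>

lemma mixing_integrable:
  fixes f :: "config \<Rightarrow> real"
  assumes "prob_space \<mu>" and sets: "sets \<mu> = sets borel" and mix: "mixing \<mu>"
    and A: "A \<in> sets borel" and f: "integrable \<mu> f"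
  shows "(\<lambda>k. \<integral>x. f x * indicator ((shift ^^ k) -` A) x \<partial>\<mu>) \<longlonglongrightarrow> measure \<mu> A * (\<integral>x. f x \<partial>\<mu>)"
proof -
  let ?I = "\<lambda>g k. \<integral>x. g x * indicator ((shift ^^ k) -` A) x \<partial>\<mu>"
  interpret prob_space \<mu> by fact
  have [measurable_cong, simp]: "sets \<mu> = sets borel" by fact
  have sp: "space \<mu> = UNIV"
    using sets_eq_imp_space_eq[OF sets] by simp
  have pre [measurable]: "(shift ^^ k) -` A \<in> sets borel" for k
    using measurable_sets[OF measurable_shift_power A] by simp
  have int: "integrable \<mu> (\<lambda>x. g x * indicator ((shift ^^ k) -` A) x)" if "integrable \<mu> g" for g :: "config \<Rightarrow> real" and k
    using that pre[of k] by (intro integrable_real_mult_indicator) auto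
  show ?thesis
    using f
  \<comment> \<open>For indicators the claim is mixing itself. Sums and dominated limits extend it
    to all integrable functions, in particular to Radon-Nikodym densities, which need not be
    bounded.\<close>
  proof (induction rule: integrable_induct)
    case (base B c)
    have "(\<integral>x. indicator B x *\<^sub>R c * indicator ((shift ^^ k) -` A) x \<partial>\<mu>) = measure \<mu> ((shift ^^ k) -` A \<inter> B) * c" for k
    proof -
      have "(\<integral>x. indicator B x *\<^sub>R c * indicator ((shift ^^ k) -` A) x \<partial>\<mu>) = (\<integral>x. indicator ((shift ^^ k) -` A \<inter> B) x * c \<partial>\<mu>)"
        by (intro Bochner_Integration.integral_cong) (auto simp: indicator_def)
      then show ?thesis using sp by simp
    qed
    moreover have "(\<lambda>k. measure \<mu> ((shift ^^ k) -` A \<inter> B) * c) \<longlonglongrightarrow> measure \<mu> A * measure \<mu> B * c"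
      using mix A base by (intro tendsto_mult_right) (auto simp: mixing_def)
    moreover have "(\<integral>x. indicator B x *\<^sub>R c \<partial>\<mu>) = measure \<mu> B * c"
      using sp by simp
    ultimately show ?case
      by (simp only: mult.assoc)
  next
    case (add f g)
    have "(\<integral>x. (f x + g x) * indicator ((shift ^^ k) -` A) x \<partial>\<mu>) =
        ?I f k + ?I g k" for k
      unfolding distrib_right by (rule Bochner_Integration.integral_add[OF int[OF add(1)] int[OF add(2)]])
    then show ?case
      using tendsto_add[OF add(3) add(4)]
      by (simp add: distrib_left Bochner_Integration.integral_add[OF add(1,2)])
  next
    case (lim f s)
    \<comment> \<open>The approximants satisfy |s j x| \<le> 2 |f x|, hence the dominating function
      3 |f x|. The integral of |f - s j| bounds the error for all \<open>k\<close> at once.\<close>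
    have d: "(\<lambda>j. \<integral>x. \<bar>f x - s j x\<bar> \<partial>\<mu>) \<longlonglongrightarrow> (\<integral>x. 0 \<partial>\<mu>)"
    proof (rule integral_dominated_convergence[where w = "\<lambda>x. 3 * \<bar>f x\<bar>"])
      show "AE x in \<mu>. (\<lambda>j. \<bar>f x - s j x\<bar>) \<longlonglongrightarrow> 0"
      proof (rule AE_I2)
        fix x assume "x \<in> space \<mu>"
        from tendsto_rabs[OF tendsto_diff[OF tendsto_const[of "f x"] lim(2)[OF this]]]
        show "(\<lambda>j. \<bar>f x - s j x\<bar>) \<longlonglongrightarrow> 0" by simp
      qed
      show "AE x in \<mu>. norm \<bar>f x - s j x\<bar> \<le> 3 * \<bar>f x\<bar>" for j
      proof (rule AE_I2)
        fix x assume "x \<in> space \<mu>"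
        from lim(3)[OF this, of j] show "norm \<bar>f x - s j x\<bar> \<le> 3 * \<bar>f x\<bar>" by auto
      qed
    qed (use lim(1,4) in auto)
    show ?case
    proof (rule tendsto_uniform_approx[where e = "\<lambda>j. \<integral>x. \<bar>f x - s j x\<bar> \<partial>\<mu>"
          and b = "\<lambda>j k. \<integral>x. s j x * indicator ((shift ^^ k) -` A) x \<partial>\<mu>"
          and l = "\<lambda>j. measure \<mu> A * (\<integral>x. s j x \<partial>\<mu>)"])
      show "(\<lambda>k. \<integral>x. s j x * indicator ((shift ^^ k) -` A) x \<partial>\<mu>) \<longlonglongrightarrow> measure \<mu> A * (\<integral>x. s j x \<partial>\<mu>)" for j
        by (rule lim(5))
      show "\<bar>?I f k - ?I (s j) k\<bar>
          \<le> (\<integral>x. \<bar>f x - s j x\<bar> \<partial>\<mu>)" for j k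
      proof -
        have "\<bar>?I f k - ?I (s j) k\<bar>
          = \<bar>(\<integral>x. f x * indicator ((shift ^^ k) -` A) x - s j x * indicator ((shift ^^ k) -` A) x \<partial>\<mu>)\<bar>"
          by (simp only: Bochner_Integration.integral_diff[OF int[OF lim(4)] int[OF lim(1)]])
        also have "\<dots> \<le> (\<integral>x. \<bar>f x * indicator ((shift ^^ k) -` A) x - s j x * indicator ((shift ^^ k) -` A) x\<bar> \<partial>\<mu>)"
          by (rule integral_abs_bound)
        also have "\<dots> \<le> (\<integral>x. \<bar>f x - s j x\<bar> \<partial>\<mu>)"
          by (rule integral_mono)
            (use int[OF lim(4), of k] int[OF lim(1), of j k] lim(1)[of j] lim(4) in \<open>auto split: split_indicator\<close>)
        finally show ?thesis .
      qed
      have "(\<lambda>j. \<integral>x. s j x \<partial>\<mu>) \<longlonglongrightarrow> (\<integral>x. f x \<partial>\<mu>)"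
        by (rule integral_dominated_convergence[where w = "\<lambda>x. 2 * \<bar>f x\<bar>"]) (use lim(1-4) in auto)
      then show "(\<lambda>j. measure \<mu> A * (\<integral>x. s j x \<partial>\<mu>)) \<longlonglongrightarrow> measure \<mu> A * (\<integral>x. f x \<partial>\<mu>)"
        by (intro tendsto_mult_left)
      show "(\<lambda>j. \<integral>x. \<bar>f x - s j x\<bar> \<partial>\<mu>) \<longlonglongrightarrow> 0"
        using d by simp
    qed
  qed
qed

text \<open>By invariance, \<open>\<nu>\<close> gives \<open>A\<close> the same mass as its preimage
  under any power of the shift, which is the integral of the density over that preimage. Mixing
  makes this integral tend to \<open>measure \<mu> A\<close> times the integral of the density,
  which is 1.\<close>

lemma mixing_absolutely_continuous_eq:
  assumes "prob_space \<mu>" and sets: "sets \<mu> = sets borel" and mix: "mixing \<mu>"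
    and "prob_space \<nu>" and sets': "sets \<nu> = sets borel" and ti: "translation_invariant \<nu>"
    and ac: "absolutely_continuous \<mu> \<nu>"
  shows "\<nu> = \<mu>"
proof -
  interpret M: prob_space \<mu> by fact
  interpret N: prob_space \<nu> by fact
  have [measurable_cong, simp]: "sets \<mu> = sets borel" by fact
  have sp: "space \<mu> = UNIV"
    using sets_eq_imp_space_eq[OF sets] by simp
  obtain D where D: "D \<in> borel_measurable \<mu>" "AE x in \<mu>. RN_deriv \<mu> \<nu> x = ennreal (D x)" "\<And>x. 0 \<le> D x"
    using M.real_RN_deriv[of \<nu>] ac sets sets' N.finite_measure_axioms by metis
  have dens: "density \<mu> (\<lambda>x. ennreal (D x)) = \<nu>"
    using M.density_RN_deriv[OF ac] density_cong[OF borel_measurable_RN_deriv _ D(2)] D(1) sets sets' by simp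
  have em: "emeasure \<nu> B = (\<integral>\<^sup>+x. ennreal (D x * indicator B x) \<partial>\<mu>)" if "B \<in> sets borel" for B
    using that D(1) sets by (subst dens[symmetric], subst emeasure_density)
      (auto intro!: nn_integral_cong simp: ennreal_mult D(3) split: split_indicator)
  have int: "integrable \<mu> D"
    using em[of UNIV] N.emeasure_space_1 sets_eq_imp_space_eq[OF sets'] D
    by (intro integrableI_nonneg) auto
  have val: "measure \<nu> B = (\<integral>x. D x * indicator B x \<partial>\<mu>)" if B: "B \<in> sets borel" for B
  proof -
    have "integrable \<mu> (\<lambda>x. D x * indicator B x)"
      using int B by (intro integrable_real_mult_indicator) auto
    then show ?thesis
      using em[OF B] D(3) by (simp add: measure_def nn_integral_eq_integral)
  qed
  have "measure \<nu> A = measure \<mu> A" if A: "A \<in> sets borel" for A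
  proof -
    have "(\<lambda>k. measure \<nu> ((shift ^^ k) -` A)) \<longlonglongrightarrow> measure \<mu> A * (\<integral>x. D x \<partial>\<mu>)"
      using mixing_integrable[OF assms(1) sets mix A int] measurable_sets[OF measurable_shift_power A]
      by (simp add: val)
    moreover have "(\<integral>x. D x \<partial>\<mu>) = 1"
      using val[of UNIV] N.prob_space sets_eq_imp_space_eq[OF sets'] by simp
    ultimately show ?thesis
      by (simp add: measure_shift_power[OF ti sets' A] LIMSEQ_const_iff)
  qed
  then show ?thesis
    using sets sets' by (intro measure_eqI) (auto simp: M.emeasure_eq_measure N.emeasure_eq_measure)
qed

lemma mixture_absolutely_continuous:
  assumes "prob_space \<mu>" "prob_space \<nu>\<^sub>1" and sets: "sets \<mu> = sets borel" "sets \<nu>\<^sub>1 = sets borel"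
    and t: "0 < t" "t < 1"
    and mx: "\<forall>A\<in>sets borel. measure \<mu> A = t * measure \<nu>\<^sub>1 A + (1 - t) * measure \<nu>\<^sub>2 A"
  shows "absolutely_continuous \<mu> \<nu>\<^sub>1"
  unfolding absolutely_continuous_def
proof
  interpret M: prob_space \<mu> by fact
  interpret N: prob_space \<nu>\<^sub>1 by fact
  fix A assume "A \<in> null_sets \<mu>"
  then have A: "A \<in> sets borel" "measure \<mu> A = 0"
    using sets by (auto simp: measure_def null_sets_def)
  then have "t * measure \<nu>\<^sub>1 A + (1 - t) * measure \<nu>\<^sub>2 A = 0"
    using mx by simp
  moreover have "0 \<le> t * measure \<nu>\<^sub>1 A" "0 \<le> (1 - t) * measure \<nu>\<^sub>2 A"
    using t by auto
  ultimately have "t * measure \<nu>\<^sub>1 A = 0" by linarith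
  then show "A \<in> null_sets \<nu>\<^sub>1"
    using A t sets by (auto simp: N.emeasure_eq_measure)
qed

text \<open>A component that enters a convex combination with positive coefficient is dominated by
  the mixture, so extremality need only be tested on one dominated state at a time.\<close>

lemma ETISI:
  assumes tis: "TIS S \<mu>"
    and ext: "\<And>\<nu>. TIS S \<nu> \<Longrightarrow> absolutely_continuous \<mu> \<nu> \<Longrightarrow> \<nu> = \<mu>"
  shows "ETIS S \<mu>"
  unfolding ETIS_def
proof (intro conjI allI impI)
  fix \<nu>\<^sub>1 \<nu>\<^sub>2 and t :: real
  assume T: "TIS S \<nu>\<^sub>1" "TIS S \<nu>\<^sub>2" and t: "0 < t" "t < 1"
    and mx: "\<forall>A\<in>sets borel. measure \<mu> A = t * measure \<nu>\<^sub>1 A + (1 - t) * measure \<nu>\<^sub>2 A"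
  have mx': "\<forall>A\<in>sets borel. measure \<mu> A = (1 - t) * measure \<nu>\<^sub>2 A + (1 - (1 - t)) * measure \<nu>\<^sub>1 A"
    using mx by auto
  show "\<nu>\<^sub>1 = \<mu>" "\<nu>\<^sub>2 = \<mu>"
    using mixture_absolutely_continuous[OF _ _ _ _ t mx] mixture_absolutely_continuous[OF _ _ _ _ _ _ mx']
      ext T tis t unfolding TIS_def state_on_def by auto
qed (rule tis)

subsection \<open>A strong law of large numbers\<close>

text \<open>This rests on |y|^k \<le> 1 + |y|^4, the constant being integrable for a finite
  measure.\<close>

lemma integrable_power_le:
  fixes X :: "'a \<Rightarrow> real"
  assumes "finite_measure M" and X: "X \<in> borel_measurable M" and int: "integrable M (\<lambda>x. X x ^ 4)" and k: "k \<le> 4"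
  shows "integrable M (\<lambda>x. X x ^ k)"
proof (rule Bochner_Integration.integrable_bound)
  interpret finite_measure M by fact
  show "integrable M (\<lambda>x. 1 + X x ^ 4)"
    using int by simp
  have "\<bar>y\<bar> ^ k \<le> 1 + \<bar>y\<bar> ^ 4" for y :: real
  proof (cases "\<bar>y\<bar> \<le> 1")
    case True
    then have "\<bar>y\<bar> ^ k \<le> 1" by (intro power_le_one) auto
    then show ?thesis by (smt (verit) zero_le_power abs_ge_zero)
  next
    case False
    then have "\<bar>y\<bar> ^ k \<le> \<bar>y\<bar> ^ 4" using k by (intro power_increasing) auto
    then show ?thesis by linarith
  qed
  then have "\<bar>X x ^ k\<bar> \<le> \<bar>1 + X x ^ 4\<bar>" for x
    using power_abs[of "X x" k] power_even_abs_numeral[of "num.Bit0 (num.Bit0 num.One)" "X x"]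
    by (smt (verit) even_numeral)
  then show "AE x in M. norm (X x ^ k) \<le> norm (1 + X x ^ 4)"
    by simp
qed (use X in simp)

text \<open>Adding one independent centred variable kills every mixed term with an odd exponent on
  the new variable or on the sum that is of order one or pairs with order one. What remains grows by
  at most \<open>6 * (c * n) * c + c\<close>, which is below
  \<open>(6 * c\<^sup>2 + c) * (2 * n + 1)\<close>, the increment of the claimed bound.\<close>

lemma (in prob_space) fourth_moment_sum:
  fixes X :: "nat \<Rightarrow> 'a \<Rightarrow> real"
  assumes ind: "indep_vars (\<lambda>_. borel) X UNIV"
    and int: "\<And>i. integrable M (\<lambda>x. X i x ^ 4)"
    and mean: "\<And>i. expectation (X i) = 0"
    and c2: "\<And>i. expectation (\<lambda>x. X i x ^ 2) \<le> c" and c4: "\<And>i. expectation (\<lambda>x. X i x ^ 4) \<le> c"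
  shows "integrable M (\<lambda>x. (\<Sum>i<n. X i x) ^ 4)"
    and "expectation (\<lambda>x. (\<Sum>i<n. X i x) ^ 4) \<le> (6 * c\<^sup>2 + c) * real n ^ 2"
proof -
  have X [measurable]: "X i \<in> borel_measurable M" for i
    using ind by (simp add: indep_vars_def)
  have Xk: "integrable M (\<lambda>x. X i x ^ k)" if "k \<le> 4" for i k
    by (rule integrable_power_le[OF finite_measure_axioms X int that])
  have c0: "0 \<le> c"
    using c2[of 0] by (smt (verit) integral_nonneg zero_le_power2 Bochner_Integration.integral_nonneg)
  define S where "S n x = (\<Sum>i<n. X i x)" for n x
  have S [measurable]: "S n \<in> borel_measurable M" for n
    unfolding S_def by measurable
  have SX: "integrable M (\<lambda>x. S n x ^ j * X n x ^ k)"
    "expectation (\<lambda>x. S n x ^ j * X n x ^ k) = expectation (\<lambda>x. S n x ^ j) * expectation (\<lambda>x. X n x ^ k)"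
    if "integrable M (\<lambda>x. S n x ^ 4)" "j \<le> 4" "k \<le> 4" for n j k
  proof -
    have "indep_var borel (X n) borel (\<lambda>x. \<Sum>i\<in>{..<n}. X i x)"
      by (rule indep_vars_sum) (auto intro: indep_vars_subset[OF ind])
    then have "indep_var borel (X n) borel (S n)"
      unfolding S_def .
    from indep_var_compose[OF this, of "\<lambda>y. y ^ k" borel "\<lambda>y. y ^ j" borel]
    have iv: "indep_var borel (\<lambda>x. X n x ^ k) borel (\<lambda>x. S n x ^ j)"
      by (simp add: comp_def)
    have i1: "integrable M (\<lambda>x. S n x ^ j)"
      by (rule integrable_power_le[OF finite_measure_axioms S that(1,2)])
    show "integrable M (\<lambda>x. S n x ^ j * X n x ^ k)"
      using indep_var_integrable[OF iv Xk[OF that(3)] i1] by (simp add: mult.commute)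
    show "expectation (\<lambda>x. S n x ^ j * X n x ^ k) = expectation (\<lambda>x. S n x ^ j) * expectation (\<lambda>x. X n x ^ k)"
      using indep_var_lebesgue_integral[OF iv Xk[OF that(3)] i1] by (simp add: mult.commute)
  qed
  have "integrable M (\<lambda>x. S n x ^ 4) \<and> expectation (S n) = 0 \<and> expectation (\<lambda>x. S n x ^ 2) \<le> c * real n
      \<and> expectation (\<lambda>x. S n x ^ 4) \<le> (6 * c\<^sup>2 + c) * real n ^ 2"
  proof (induction n)
    case 0
    then show ?case by (simp add: S_def)
  next
    case (Suc n)
    then have I: "integrable M (\<lambda>x. S n x ^ 4)" by simp
    note int' = SX(1)[OF I] and ex = SX(2)[OF I]
    have S1: "integrable M (S n)" and X1: "integrable M (X n)"
      using integrable_power_le[OF finite_measure_axioms S I, of 1] Xk[of 1 n] by auto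
    have S2: "integrable M (\<lambda>x. S n x ^ 2)"
      using integrable_power_le[OF finite_measure_axioms S I, of 2] by auto
    \<comment> \<open>The exponents 1 are written out so that the mixed terms have the shape of
      \<open>SX\<close>.\<close>
    have e2: "S (Suc n) x ^ 2 = S n x ^ 2 + 2 * (S n x ^ 1 * X n x ^ 1) + X n x ^ 2" for x
      by (simp add: S_def power2_eq_square algebra_simps)
    have e4: "S (Suc n) x ^ 4 = S n x ^ 4 + 4 * (S n x ^ 3 * X n x ^ 1) + 6 * (S n x ^ 2 * X n x ^ 2)
        + 4 * (S n x ^ 1 * X n x ^ 3) + X n x ^ 4" for x
      by (simp add: S_def power4_eq_xxxx power3_eq_cube power2_eq_square algebra_simps)
    have 1: "expectation (S (Suc n)) = 0"
    proof -
      have "S (Suc n) = (\<lambda>x. S n x + X n x)"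
        by (simp add: S_def fun_eq_iff)
      then show ?thesis
        using Suc mean[of n] S1 X1 by simp
    qed
    have 2: "expectation (\<lambda>x. S (Suc n) x ^ 2) \<le> c * real (Suc n)"
    proof -
      have "expectation (\<lambda>x. S (Suc n) x ^ 2) = expectation (\<lambda>x. S n x ^ 2) + expectation (\<lambda>x. X n x ^ 2)"
        unfolding e2 using S2 Xk[of 2 n] int'[of 1 1] ex[of 1 1] mean[of n] by simp
      then show ?thesis
        using Suc c2[of n] by (simp add: algebra_simps)
    qed
    have 3: "integrable M (\<lambda>x. S (Suc n) x ^ 4)"
      unfolding e4 using I Xk[of 4 n] int'[of 3 1] int'[of 2 2] int'[of 1 3] by simp
    have "expectation (\<lambda>x. S (Suc n) x ^ 4) = expectation (\<lambda>x. S n x ^ 4)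
        + 6 * (expectation (\<lambda>x. S n x ^ 2) * expectation (\<lambda>x. X n x ^ 2)) + expectation (\<lambda>x. X n x ^ 4)"
      unfolding e4 using I Xk[of 4 n] int'[of 3 1] int'[of 2 2] int'[of 1 3] ex[of 3 1] ex[of 2 2] ex[of 1 3] mean[of n] Suc by simp
    also have "\<dots> \<le> (6 * c\<^sup>2 + c) * real n ^ 2 + 6 * ((c * real n) * c) + c"
      using Suc c2[of n] c4[of n] c0
      by (intro add_mono mult_left_mono mult_mono) (auto intro!: Bochner_Integration.integral_nonneg)
    also have "\<dots> \<le> (6 * c\<^sup>2 + c) * real (Suc n) ^ 2"
      using c0 by (simp add: power2_eq_square algebra_simps)
    finally show ?case using 1 2 3 by simp
  qed
  then show "integrable M (\<lambda>x. (\<Sum>i<n. X i x) ^ 4)"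
    and "expectation (\<lambda>x. (\<Sum>i<n. X i x) ^ 4) \<le> (6 * c\<^sup>2 + c) * real n ^ 2"
    by (simp_all add: S_def)
qed

text \<open>The fourth moment of the average is of order 1 / n^2, hence summable. So the series of
  fourth powers of the averages is almost surely finite, and its terms tend to 0.\<close>

lemma (in prob_space) strong_law_fourth_moment:
  fixes X :: "nat \<Rightarrow> 'a \<Rightarrow> real"
  assumes ind: "indep_vars (\<lambda>_. borel) X UNIV"
    and int: "\<And>i. integrable M (\<lambda>x. X i x ^ 4)"
    and mean: "\<And>i. expectation (X i) = 0"
    and c2: "\<And>i. expectation (\<lambda>x. X i x ^ 2) \<le> c" and c4: "\<And>i. expectation (\<lambda>x. X i x ^ 4) \<le> c"
  shows "AE x in M. (\<lambda>n. (\<Sum>i<n. X i x) / real n) \<longlonglongrightarrow> 0"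
proof -
  note S4 = fourth_moment_sum[OF ind int mean c2 c4]
  have X [measurable]: "X i \<in> borel_measurable M" for i
    using ind by (simp add: indep_vars_def)
  define Y where "Y n x = ((\<Sum>i<n. X i x) / real n) ^ 4" for n x
  have Y [measurable]: "Y n \<in> borel_measurable M" for n
    unfolding Y_def by measurable
  have Y0: "0 \<le> Y n x" for n x
    by (simp add: Y_def)
  let ?C = "6 * c\<^sup>2 + c"
  have EY: "(\<integral>\<^sup>+x. ennreal (Y n x) \<partial>M) \<le> ennreal (?C * (1 / real n ^ 2))" for n
  proof -
    have "integrable M (\<lambda>x. (\<Sum>i<n. X i x) ^ 4 / real n ^ 4)"
      using S4(1)[of n] by simp
    then have "(\<integral>\<^sup>+x. ennreal (Y n x) \<partial>M) = ennreal (expectation (\<lambda>x. (\<Sum>i<n. X i x) ^ 4) / real n ^ 4)"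
      by (subst nn_integral_eq_integral) (auto simp: Y_def[abs_def] power_divide)
    also have "\<dots> \<le> ennreal (?C * real n ^ 2 / real n ^ 4)"
      using S4(2)[of n] by (intro ennreal_leI divide_right_mono) auto
    also have "?C * real n ^ 2 / real n ^ 4 = ?C * (1 / real n ^ 2)"
      by (cases "n = 0") (auto simp: field_simps power2_eq_square power4_eq_xxxx)
    finally show ?thesis .
  qed
  have C0: "0 \<le> ?C"
    using c2[of 0] by (smt (verit) zero_le_power2 Bochner_Integration.integral_nonneg zero_le_mult_iff)
  have sm: "summable (\<lambda>n. ?C * (1 / real n ^ 2))"
    by (intro summable_mult inverse_power_summable[of 2, where 'a = real, unfolded inverse_eq_divide]) auto
  have "(\<integral>\<^sup>+x. (\<Sum>n. ennreal (Y n x)) \<partial>M) = (\<Sum>n. \<integral>\<^sup>+x. ennreal (Y n x) \<partial>M)"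
    by (rule nn_integral_suminf) measurable
  also have "\<dots> \<le> (\<Sum>n. ennreal (?C * (1 / real n ^ 2)))"
    by (intro suminf_le EY) auto
  also have "\<dots> = ennreal (\<Sum>n. ?C * (1 / real n ^ 2))"
    by (rule suminf_ennreal2) (use sm C0 in auto)
  also have "\<dots> < \<infinity>" by simp
  finally have "(\<integral>\<^sup>+x. (\<Sum>n. ennreal (Y n x)) \<partial>M) \<noteq> \<infinity>" by simp
  then have "AE x in M. (\<Sum>n. ennreal (Y n x)) \<noteq> \<infinity>"
    by (intro nn_integral_noteq_infinite) auto
  then show ?thesis
  proof eventually_elim
    case (elim x)
    then have "summable (\<lambda>n. Y n x)"
      by (intro summable_suminf_not_top) (auto simp: Y0)
    then have "(\<lambda>n. Y n x) \<longlonglongrightarrow> 0"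
      by (rule summable_LIMSEQ_zero)
    then have "(\<lambda>n. sqrt (sqrt (Y n x))) \<longlonglongrightarrow> sqrt (sqrt 0)"
      by (intro tendsto_real_sqrt)
    moreover have "sqrt (sqrt (Y n x)) = \<bar>(\<Sum>i<n. X i x) / real n\<bar>" for n
    proof -
      have "Y n x = (((\<Sum>i<n. X i x) / real n)\<^sup>2)\<^sup>2"
        by (simp add: Y_def)
      then show ?thesis by (simp only: real_sqrt_abs abs_power2)
    qed
    ultimately have "(\<lambda>n. \<bar>(\<Sum>i<n. X i x) / real n\<bar>) \<longlonglongrightarrow> 0"
      by (simp only: real_sqrt_zero)
    then show ?case
      by (rule tendsto_rabs_zero_cancel)
  qed
qed

text \<open>With \<open>w\<close> strictly between \<open>1 - p\<close> and 1, and \<open>v\<close>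
  the fourth root of \<open>(1 - p) / w\<close>, the convergence of \<open>n * v ^ n\<close> to 0
  bounds \<open>n ^ 4 * ((1 - p) / w) ^ n\<close>. The remaining factor \<open>w ^ n\<close> is
  summable.\<close>

lemma integrable_geometric_fourth:
  assumes p: "0 < p" "p \<le> 1"
  shows "integrable (measure_pmf (geometric_pmf p)) (\<lambda>n. real n ^ 4)"
proof -
  define w where "w = (1 - p / 2)"
  have w: "0 < w" "w < 1" "0 \<le> 1 - p" "1 - p < w"
    using p by (auto simp: w_def)
  define v where "v = sqrt (sqrt ((1 - p) / w))"
  have v: "0 \<le> v" "v < 1" "v ^ 4 = (1 - p) / w"
  proof -
    have "v ^ 4 = ((sqrt (sqrt ((1 - p) / w)))\<^sup>2)\<^sup>2"
      by (simp add: v_def)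
    then show "v ^ 4 = (1 - p) / w"
      using w by simp
  qed (use w in \<open>auto simp: v_def\<close>)
  have "(\<lambda>n. (real n * v ^ n) ^ 4) \<longlonglongrightarrow> 0 ^ 4"
    using v powser_times_n_limit_0[of v] by (intro tendsto_power) auto
  moreover have "(real n * v ^ n) ^ 4 = real n ^ 4 * ((1 - p) / w) ^ n" for n
    using v(3) by (metis power_mult_distrib power_mult mult.commute)
  ultimately have "(\<lambda>n. real n ^ 4 * ((1 - p) / w) ^ n) \<longlonglongrightarrow> 0"
    by simp
  then have "Bseq (\<lambda>n. real n ^ 4 * ((1 - p) / w) ^ n)"
    by (intro convergent_imp_Bseq) (auto simp: convergent_def)
  then obtain B where B: "\<And>n. norm (real n ^ 4 * ((1 - p) / w) ^ n) \<le> B"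
    by (auto simp: Bseq_def)
  have "summable (\<lambda>n. pmf (geometric_pmf p) n * real n ^ 4)"
  proof (rule summable_comparison_test')
    show "summable (\<lambda>n. B * w ^ n)"
      using w by (intro summable_mult summable_geometric) auto
    show "norm (pmf (geometric_pmf p) n * real n ^ 4) \<le> B * w ^ n" for n
    proof -
      have "norm (pmf (geometric_pmf p) n * real n ^ 4) = (real n ^ 4 * ((1 - p) / w) ^ n) * (p * w ^ n)"
        using w p by (simp add: abs_mult power_divide)
      also have "\<dots> \<le> B * (1 * w ^ n)"
        using B[of n] order_trans[OF norm_ge_zero B[of 0]] w p by (intro mult_mono) (auto simp: mult_le_cancel_right1 power_0_left)
      finally show ?thesis by simp
    qed
  qed
  then show ?thesis
    by (subst measure_pmf_eq_density, subst integrable_density)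
       (auto simp: integrable_count_space_nat_iff abs_mult p simp del: pmf_geometric)
qed

subsection \<open>The symmetric spin chain and its stacks\<close>

text \<open>The first component tells whether the spin flips across the site; the second is the
  geometric variable, whose weights are proportional to \<open>(z\<^sup>2) ^ g\<close>.\<close>

definition site_pmf :: "real \<Rightarrow> (bool \<times> nat) pmf"
  where "site_pmf z = pair_pmf (bernoulli_pmf (1 / (1 + z))) (geometric_pmf (1 - z\<^sup>2))"

definition sites :: "real \<Rightarrow> (int \<Rightarrow> bool \<times> nat) measure"
  where "sites z = PiM UNIV (\<lambda>_. measure_pmf (site_pmf z))"

definition parity :: "int set \<Rightarrow> (int \<Rightarrow> bool \<times> nat) \<Rightarrow> bool"
  where "parity J x \<longleftrightarrow> odd (card {i\<in>J. fst (x i)})"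

text \<open>The index is that of the bond between \<open>k\<close> and \<open>k + 1\<close>, as for
  \<open>flux\<close>, and \<open>True\<close> points to the right. The bond 0 is the anchor with
  spin \<open>b\<close>; the interval with \<open>min\<close> and \<open>max\<close> collects the
  sites between it and bond \<open>k\<close> on either side.\<close>

definition spin :: "bool \<Rightarrow> (int \<Rightarrow> bool \<times> nat) \<Rightarrow> int \<Rightarrow> bool"
  where "spin b x k \<longleftrightarrow> (b \<noteq> parity {min 0 k<..max 0 k} x)"

definition height :: "bool \<Rightarrow> bool \<Rightarrow> nat \<Rightarrow> nat"
  where "height c c' g = 2 * (g + (if c \<and> \<not> c' then 0 else 1))"

definition stacks :: "bool \<Rightarrow> (int \<Rightarrow> bool \<times> nat) \<Rightarrow> config"
  where "stacks b x i = height (spin b x (i - 1)) (spin b x i) (snd (x i))"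

definition spin_sites :: "real \<Rightarrow> (bool \<times> (int \<Rightarrow> bool \<times> nat)) measure"
  where "spin_sites z = measure_pmf (bernoulli_pmf (1/2)) \<Otimes>\<^sub>M sites z"

definition gibbs_chain :: "real \<Rightarrow> config measure"
  where "gibbs_chain z = distr (spin_sites z) borel (\<lambda>(b, x). stacks b x)"

lemma parity_empty [simp]: "\<not> parity {} x"
  by (simp add: parity_def)

lemma parity_Un:
  assumes "finite J" "finite K" "J \<inter> K = {}"
  shows "parity (J \<union> K) x \<longleftrightarrow> parity J x \<noteq> parity K x"
proof -
  have "{i \<in> J \<union> K. fst (x i)} = {i\<in>J. fst (x i)} \<union> {i\<in>K. fst (x i)}" by auto
  then have "card {i \<in> J \<union> K. fst (x i)} = card {i\<in>J. fst (x i)} + card {i\<in>K. fst (x i)}"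
    using assms by (simp add: card_Un_disjoint disjoint_iff)
  then show ?thesis by (simp add: parity_def)
qed

lemma parity_cong: "(\<And>i. i \<in> J \<Longrightarrow> x i = y i) \<Longrightarrow> parity J x = parity J y"
  unfolding parity_def by (metis (mono_tags, lifting) Collect_cong)

lemma parity_single: "parity {i} x = fst (x i)"
proof -
  have "{j \<in> {i}. fst (x j)} = (if fst (x i) then {i} else {})" by auto
  then show ?thesis by (simp add: parity_def)
qed

text \<open>The cases put the anchor between the two bonds, to their left, or to their right. From
  here on only the flips between two bonds matter, wherever the anchor lies.\<close>

lemma spin_diff:
  assumes "a \<le> k"
  shows "spin b x k \<longleftrightarrow> (spin b x a \<noteq> parity {a<..k} x)"
proof -
  consider "a \<le> 0" "0 \<le> k" | "0 \<le> a" | "k \<le> 0" by linarith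
  then show ?thesis
  proof cases
    case 1
    have "{a<..k} = {a<..0} \<union> {0<..k}" using 1 by auto
    then have "parity {a<..k} x \<longleftrightarrow> parity {a<..0} x \<noteq> parity {0<..k} x"
      using parity_Un[of "{a<..0}" "{0<..k}" x] by simp
    then show ?thesis using 1 by (auto simp: spin_def min_def max_def)
  next
    case 2
    have "{0<..k} = {0<..a} \<union> {a<..k}" using 2 assms by auto
    then have "parity {0<..k} x \<longleftrightarrow> parity {0<..a} x \<noteq> parity {a<..k} x"
      using parity_Un[of "{0<..a}" "{a<..k}" x] by auto
    then show ?thesis using 2 assms by (auto simp: spin_def min_def max_def)
  next
    case 3
    have "{a<..0} = {a<..k} \<union> {k<..0}" using 3 assms by auto
    then have "parity {a<..0} x \<longleftrightarrow> parity {a<..k} x \<noteq> parity {k<..0} x"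
      using parity_Un[of "{a<..k}" "{k<..0}" x] by auto
    moreover have "min 0 a = a" "max 0 a = 0" "min 0 k = k" "max 0 k = 0"
      using 3 assms by auto
    ultimately show ?thesis
      unfolding spin_def by metis
  qed
qed

lemma spin_step: "spin b x i \<longleftrightarrow> (spin b x (i - 1) \<noteq> fst (x i))"
proof -
  have "{i - 1<..i} = {i}" by auto
  then show ?thesis using spin_diff[of "i - 1" i b x] by (simp add: parity_single)
qed

lemma spin_cong: "(\<And>i. i \<in> {min 0 k<..max 0 k} \<Longrightarrow> x i = y i) \<Longrightarrow> spin b x k = spin b y k"
  unfolding spin_def using parity_cong by blast

lemma spin_not: "spin (\<not> b) x k \<longleftrightarrow> \<not> spin b x k"
  by (auto simp: spin_def)

lemma parity_shift: "parity {a<..b} (\<lambda>i. x (i + k)) = parity {a + k<..b + k} x"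
proof -
  have "bij_betw (\<lambda>i. i + k) {i \<in> {a<..b}. fst (x (i + k))} {i \<in> {a + k<..b + k}. fst (x i)}"
    by (rule bij_betw_byWitness[where f' = "\<lambda>i. i - k"]) auto
  then show ?thesis by (simp add: parity_def bij_betw_same_card)
qed

text \<open>Translating the sites moves the anchor to bond \<open>k\<close>, so the spin there
  becomes the new initial spin.\<close>

lemma spin_shift: "spin b x (i + k) = spin (spin b x k) (\<lambda>i. x (i + k)) i"
proof (cases "0 \<le> i")
  case True
  then show ?thesis
    using spin_diff[of k "i + k" b x] parity_shift[of 0 i x k] by (simp add: spin_def add.commute)
next
  case False
  then show ?thesis
    using spin_diff[of "i + k" k b x] parity_shift[of i 0 x k] by (auto simp: spin_def add.commute)
qed

lemma stacks_shift: "stacks b x (i + k) = stacks (spin b x k) (\<lambda>i. x (i + k)) i"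
  using spin_shift[of b x "i - 1" k] spin_shift[of b x i k]
  by (simp add: stacks_def algebra_simps)

lemma stacks_Xe: "stacks b x \<in> Xe"
  by (auto simp: Xe_def stacks_def height_def)

section \<open>Window events under the product measure of the sites\<close>

lemma sets_sites: "sets (sites z) = sets (PiM UNIV (\<lambda>_. count_space UNIV))"
  unfolding sites_def by (intro sets_PiM_cong) auto

lemma space_sites [simp]: "space (sites z) = UNIV"
  by (simp add: sites_def space_PiM)

lemma measurable_sites_finite:
  fixes f :: "(int \<Rightarrow> bool \<times> nat) \<Rightarrow> 'b"
  assumes "finite J" "\<And>x y. (\<And>i. i \<in> J \<Longrightarrow> x i = y i) \<Longrightarrow> f x = f y"
  shows "f \<in> sites z \<rightarrow>\<^sub>M count_space UNIV"
  unfolding measurable_cong_sets[OF sets_sites refl] by (rule measurable_finitely_determined[OF assms])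

text \<open>The sites behind an event are recorded explicitly, because independence will come from
  disjointness of such sets.\<close>

definition determined :: "int set \<Rightarrow> ((int \<Rightarrow> 'a) \<Rightarrow> bool) \<Rightarrow> bool"
  where "determined J P \<longleftrightarrow> (\<forall>x y. (\<forall>i\<in>J. x i = y i) \<longrightarrow> P x = P y)"

lemma determined_mono: "determined J P \<Longrightarrow> J \<subseteq> K \<Longrightarrow> determined K P"
  unfolding determined_def by blast

lemma determined_conj: "determined J P \<Longrightarrow> determined J Q \<Longrightarrow> determined J (\<lambda>x. P x \<and> Q x)"
  unfolding determined_def by metis

lemma determined_eq: "determined J P \<Longrightarrow> determined J (\<lambda>x. P x = d)"
  unfolding determined_def by metis

lemma determined_site: "i \<in> J \<Longrightarrow> determined J (\<lambda>x. P (x i))"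
  unfolding determined_def by auto

lemma determined_parity: "determined J (parity J)"
  unfolding determined_def using parity_cong by blast

lemma determined_shift: "determined {a<..b} P \<Longrightarrow> determined {a + k<..b + k} (\<lambda>x. P (\<lambda>i. x (i + k)))"
  unfolding determined_def by auto

lemma sets_sites_finite:
  assumes "finite J" "determined J P"
  shows "{x. P x} \<in> sets (sites z)"
proof -
  have "P \<in> sites z \<rightarrow>\<^sub>M count_space UNIV"
    using assms unfolding determined_def by (intro measurable_sites_finite[of J]) auto
  from measurable_sets[OF this, of "{True}"] show ?thesis
    by (simp add: vimage_def)
qed

lemma measurable_site [measurable]: "(\<lambda>x. x i) \<in> sites z \<rightarrow>\<^sub>M count_space UNIV"
  by (rule measurable_sites_finite[of "{i}"]) auto

lemma measurable_spin_sites_iff: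
  assumes "\<And>b. (\<lambda>x. f (b, x)) \<in> sites z \<rightarrow>\<^sub>M N"
  shows "f \<in> spin_sites z \<rightarrow>\<^sub>M N"
proof -
  have "f \<in> count_space UNIV \<Otimes>\<^sub>M sites z \<rightarrow>\<^sub>M N"
    by (rule measurable_pair_measure_countable1) (simp_all add: assms)
  moreover have "sets (spin_sites z) = sets (count_space UNIV \<Otimes>\<^sub>M sites z)"
    unfolding spin_sites_def by (intro sets_pair_measure_cong) auto
  ultimately show ?thesis
    using measurable_cong_sets[OF _ refl] by blast
qed

lemma measurable_spin_sites_spin [measurable]: "(\<lambda>x. spin b x k) \<in> sites z \<rightarrow>\<^sub>M count_space UNIV"
  by (rule measurable_sites_finite[of "{min 0 k<..max 0 k}"]) (simp, rule spin_cong)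

lemma measurable_stacks [measurable]: "stacks b \<in> sites z \<rightarrow>\<^sub>M borel"
proof (rule measurable_into_config)
  show "(\<lambda>x. stacks b x i) \<in> sites z \<rightarrow>\<^sub>M count_space UNIV" for i
    unfolding stacks_def by measurable
qed

lemma measurable_stacks_pair [measurable]: "(\<lambda>(b, x). stacks b x) \<in> spin_sites z \<rightarrow>\<^sub>M borel"
  by (rule measurable_spin_sites_iff) simp

lemma prob_space_sites: "prob_space (sites z)"
  unfolding sites_def by (intro prob_space_PiM prob_space_measure_pmf)

lemma prob_space_spin_sites: "prob_space (spin_sites z)"
proof -
  interpret X: prob_space "sites z" by (rule prob_space_sites)
  interpret pair_prob_space "measure_pmf (bernoulli_pmf (1/2))" "sites z" ..
  show ?thesis unfolding spin_sites_def by unfold_locales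
qed

lemma measure_spin_sites:
  assumes S: "S \<in> sets (spin_sites z)"
  shows "measure (spin_sites z) S = (measure (sites z) {x. (True, x) \<in> S} + measure (sites z) {x. (False, x) \<in> S}) / 2"
proof -
  let ?m = "measure (sites z)"
  interpret X: prob_space "sites z" by (rule prob_space_sites)
  interpret P: prob_space "spin_sites z" by (rule prob_space_spin_sites)
  have "emeasure (spin_sites z) S = (\<integral>\<^sup>+b. emeasure (sites z) (Pair b -` S) \<partial>measure_pmf (bernoulli_pmf (1/2)))"
    using S unfolding spin_sites_def by (intro X.emeasure_pair_measure_alt)
  also have "\<dots> = ennreal (?m {x. (True, x) \<in> S}) * ennreal (1/2)
      + ennreal (?m {x. (False, x) \<in> S}) * ennreal (1/2)"
    by (subst nn_integral_bernoulli_pmf) (auto simp: X.emeasure_eq_measure vimage_def)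
  also have "\<dots> = ennreal ((?m {x. (True, x) \<in> S} + ?m {x. (False, x) \<in> S}) / 2)"
    by (subst ennreal_mult[symmetric], simp, simp, subst ennreal_mult[symmetric], simp, simp, subst ennreal_plus[symmetric])
      (auto simp: add_divide_distrib)
  finally show ?thesis
    by (simp only: P.emeasure_eq_measure) (simp add: ennreal_inj del: ennreal_plus)
qed

lemma sets_spin_sitesI:
  assumes "\<And>b. {x. P b x} \<in> sets (sites z)"
  shows "{(b, x). P b x} \<in> sets (spin_sites z)"
proof -
  have "(\<lambda>(b, x). P b x) \<in> spin_sites z \<rightarrow>\<^sub>M count_space UNIV"
    by (rule measurable_spin_sites_iff) (use assms in \<open>simp add: pred_def\<close>)
  moreover have "space (spin_sites z) = UNIV"
    by (simp add: spin_sites_def space_pair_measure)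
  ultimately show ?thesis
    using measurable_sets[of "\<lambda>(b, x). P b x" "spin_sites z" "count_space UNIV" "{True}"]
    by (simp add: vimage_def split_beta')
qed

text \<open>Whatever the anchor, the spin there is a fair coin independent of all the sites.\<close>

lemma measure_spin_at:
  assumes R: "\<And>c. {x. R c x} \<in> sets (sites z)"
  shows "{(b, x). R (spin b x a) x} \<in> sets (spin_sites z)"
    and "measure (spin_sites z) {(b, x). R (spin b x a) x} = (measure (sites z) {x. R True x} + measure (sites z) {x. R False x}) / 2"
proof -
  let ?m = "measure (sites z)"
  interpret X: prob_space "sites z" by (rule prob_space_sites)
  let ?E = "{x. spin True x a}"
  have E: "?E \<in> sets (sites z)"
    using measurable_sets[OF measurable_spin_sites_spin[of True a z], of "{True}"] by (simp add: vimage_def)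
  have F: "spin False x a \<longleftrightarrow> \<not> spin True x a" for x
    using spin_not[of True] by simp
  \<comment> \<open>For fixed \<open>x\<close> the two values of \<open>b\<close> produce the two
    spins at \<open>a\<close>: in the same order on \<open>?E\<close>, exchanged off
    \<open>?E\<close>. The sum over \<open>b\<close> is insensitive to this exchange.\<close>
  have T: "{x. R (spin True x a) x} = (?E \<inter> {x. R True x}) \<union> ({x. R False x} - ?E)"
    and T': "{x. R (spin False x a) x} = (?E \<inter> {x. R False x}) \<union> ({x. R True x} - ?E)"
    unfolding F by (auto split: if_splits) (metis (full_types))+
  have "{x. R (spin b x a) x} \<in> sets (sites z)" for b
    using E R T T' by (cases b) auto
  from sets_spin_sitesI[OF this] show S: "{(b, x). R (spin b x a) x} \<in> sets (spin_sites z)" .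
  have u: "?m ((?E \<inter> A) \<union> (B - ?E)) = ?m (?E \<inter> A) + ?m (B - ?E)"
    if "A \<in> sets (sites z)" "B \<in> sets (sites z)" for A B
    using that E by (intro X.finite_measure_Union) auto
  have d: "?m A = ?m (?E \<inter> A) + ?m (A - ?E)" if "A \<in> sets (sites z)" for A
    using u[OF that that] by (simp add: Un_Diff_Int Int_commute Un_commute)
  show "measure (spin_sites z) {(b, x). R (spin b x a) x} = (?m {x. R True x} + ?m {x. R False x}) / 2"
    by (subst measure_spin_sites[OF S]) (simp add: T T' u R d[OF R])
qed

lemma measure_sites_shift:
  assumes "A \<in> sets (sites z)"
  shows "measure (sites z) {x. (\<lambda>i. x (i + k)) \<in> A} = measure (sites z) A"
proof -
  have "distr (sites z) (PiM UNIV (\<lambda>_. measure_pmf (site_pmf z))) (\<lambda>x. \<lambda>i\<in>UNIV. x (i + k)) = PiM UNIV (\<lambda>_. measure_pmf (site_pmf z))"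
    unfolding sites_def by (rule distr_PiM_reindex) (auto simp: prob_space_measure_pmf inj_on_def)
  then have d: "distr (sites z) (sites z) (\<lambda>x i. x (i + k)) = sites z"
    by (simp add: sites_def[symmetric] restrict_UNIV)
  have m: "(\<lambda>x i. x (i + k)) \<in> sites z \<rightarrow>\<^sub>M sites z"
    unfolding measurable_cong_sets[OF refl sets_sites] by (rule measurable_PiM_single') (auto simp: space_PiM)
  have "measure (sites z) A = measure (distr (sites z) (sites z) (\<lambda>x i. x (i + k))) A"
    by (simp only: d)
  also have "\<dots> = measure (sites z) ((\<lambda>x i. x (i + k)) -` A \<inter> space (sites z))"
    by (rule measure_distr[OF m assms])
  finally show ?thesis by (simp add: vimage_def)
qed

lemma measure_sites_box:
  assumes "finite J"
  shows "measure (sites z) {x. \<forall>i\<in>J. x i \<in> X i} = (\<Prod>i\<in>J. measure_pmf.prob (site_pmf z) (X i))"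
proof -
  interpret product_prob_space "\<lambda>_. measure_pmf (site_pmf z)" "UNIV :: int set"
    by unfold_locales
  have "{x. \<forall>i\<in>J. x i \<in> X i} = prod_emb UNIV (\<lambda>_. measure_pmf (site_pmf z)) J (PiE J X)"
    by (auto simp: prod_emb_def PiE_iff)
  then show ?thesis
    unfolding sites_def using measure_PiM_emb[of J X] assms by simp
qed

lemma indep_vars_sites: "prob_space.indep_vars (sites z) (\<lambda>_. measure_pmf (site_pmf z)) (\<lambda>i x. x i) UNIV"
proof -
  interpret prob_space "sites z" by (rule prob_space_sites)
  interpret P: product_prob_space "\<lambda>_. measure_pmf (site_pmf z)" "UNIV :: int set"
    by unfold_locales
  have d: "distr (sites z) (measure_pmf (site_pmf z)) (\<lambda>x. x i) = measure_pmf (site_pmf z)" for i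
    unfolding sites_def using P.PiM_component[of i] by simp
  have "distr (sites z) (PiM UNIV (\<lambda>_. measure_pmf (site_pmf z))) (\<lambda>x. x) = sites z"
    by (simp add: sites_def distr_id2)
  then show ?thesis
    by (subst indep_vars_iff_distr_eq_PiM') (auto simp: d restrict_UNIV sites_def[symmetric])
qed

text \<open>Restrictions of an independent family to disjoint blocks are independent, and on a
  finite block every set of patterns is measurable.\<close>

lemma prob_indep_blocks:
  assumes J: "finite J" "determined J P" and K: "finite K" "determined K Q"
    and disj: "J \<inter> K = {}"
  shows "measure (sites z) {x. P x \<and> Q x} = measure (sites z) {x. P x} * measure (sites z) {x. Q x}"
proof -
  interpret prob_space "sites z" by (rule prob_space_sites)
  let ?M = "\<lambda>_::int. measure_pmf (site_pmf z)"
  have "indep_vars (\<lambda>j. PiM (if j then J else K) ?M) (\<lambda>j x. restrict (\<lambda>i. x i) (if j then J else K)) (UNIV :: bool set)"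
    by (rule indep_vars_restrict[OF indep_vars_sites]) (use disj in \<open>auto simp: disjoint_family_on_def\<close>)
  then have iv: "indep_var (PiM J ?M) (\<lambda>x. restrict x J) (PiM K ?M) (\<lambda>x. restrict x K)"
    unfolding indep_var_def by (rule indep_vars_cong[THEN iffD1, rotated 3]) (auto split: bool.splits)
  have sets: "sets (PiM L ?M) = Pow (L \<rightarrow>\<^sub>E UNIV)" if "finite L" for L :: "int set"
  proof -
    have "sets (PiM L ?M) = sets (PiM L (\<lambda>_. count_space (UNIV :: (bool \<times> nat) set)))"
      by (intro sets_PiM_cong) auto
    also have "\<dots> = sets (count_space (L \<rightarrow>\<^sub>E UNIV))"
      using that by (subst count_space_PiM_finite) auto
    finally show ?thesis by simp
  qed
  let ?A = "{y \<in> J \<rightarrow>\<^sub>E UNIV. P y}" and ?B = "{y \<in> K \<rightarrow>\<^sub>E UNIV. Q y}"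
  have P: "P (restrict x J) = P x" and Q: "Q (restrict x K) = Q x" for x
    using J(2) K(2) unfolding determined_def by auto
  have "prob ((\<lambda>x. (restrict x J, restrict x K)) -` (?A \<times> ?B) \<inter> space (sites z))
      = prob ((\<lambda>x. restrict x J) -` ?A \<inter> space (sites z)) * prob ((\<lambda>x. restrict x K) -` ?B \<inter> space (sites z))"
    by (rule indep_varD[OF iv]) (auto simp: sets[OF J(1)] sets[OF K(1)])
  then show ?thesis
    by (simp add: vimage_def P Q)
qed

section \<open>Parity of the number of flips\<close>

lemma prob_site_flip:
  assumes "0 < z"
  shows "measure_pmf.prob (site_pmf z) {y. fst y} = 1 / (1 + z)"
    and "measure_pmf.prob (site_pmf z) {y. \<not> fst y} = z / (1 + z)"
proof -
  have *: "measure_pmf.prob (site_pmf z) (fst -` {d}) = pmf (bernoulli_pmf (1 / (1 + z))) d" for d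
    using measure_map_pmf[of fst "site_pmf z" "{d}"]
    by (simp add: site_pmf_def map_fst_pair_pmf measure_pmf_single del: measure_map_pmf)
  have "fst -` {True} = {y :: bool \<times> nat. fst y}" "fst -` {False} = {y :: bool \<times> nat. \<not> fst y}"
    by auto
  with *[of True] *[of False] assms
  show "measure_pmf.prob (site_pmf z) {y. fst y} = 1 / (1 + z)"
    and "measure_pmf.prob (site_pmf z) {y. \<not> fst y} = z / (1 + z)"
    by (auto simp: field_simps)
qed

text \<open>The base \<open>(z - 1) / (z + 1)\<close> is the mean of the sign that is -1 for a flip
  and 1 otherwise. By independence the mean sign of a block is its power, and a mean sign
  \<open>r\<close> means probability \<open>(1 + r) / 2\<close> for even parity.\<close>

lemma prob_parity:
  assumes z: "0 < z" and J: "finite J"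
  shows "measure (sites z) {x. parity J x = d} = (1 + (if d then - 1 else 1) * ((z - 1) / (z + 1)) ^ card J) / 2"
  using J
proof (induction J arbitrary: d rule: finite_induct)
  case empty
  interpret prob_space "sites z" by (rule prob_space_sites)
  have "prob UNIV = 1"
    using prob_space by simp
  then show ?case by (cases d) simp_all
next
  case (insert j J)
  interpret prob_space "sites z" by (rule prob_space_sites)
  have "parity (insert j J) x \<longleftrightarrow> fst (x j) \<noteq> parity J x" for x
    using parity_Un[of "{j}" J x] insert by (simp add: parity_single)
  then have "{x. parity (insert j J) x = d} = {x. fst (x j) \<and> parity J x = (\<not> d)} \<union> {x. \<not> fst (x j) \<and> parity J x = d}"
    by auto
  moreover have "{x. fst (x j) \<and> parity J x = (\<not> d)} \<in> sets (sites z)" "{x. \<not> fst (x j) \<and> parity J x = d} \<in> sets (sites z)"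
    by (intro sets_sites_finite[of "insert j J"] determined_conj determined_site determined_eq
        determined_mono[OF determined_parity]; use insert(1) in force)+
  ultimately have "prob {x. parity (insert j J) x = d}
      = prob {x. fst (x j) \<and> parity J x = (\<not> d)} + prob {x. \<not> fst (x j) \<and> parity J x = d}"
    by (simp only:) (rule finite_measure_Union, auto)
  also have "prob {x. fst (x j) \<and> parity J x = (\<not> d)} = prob {x. fst (x j)} * prob {x. parity J x = (\<not> d)}"
    by (intro prob_indep_blocks[of "{j}" _ J] determined_eq determined_parity determined_site) (use insert in auto)
  also have "prob {x. \<not> fst (x j) \<and> parity J x = d} = prob {x. \<not> fst (x j)} * prob {x. parity J x = d}"
    by (intro prob_indep_blocks[of "{j}" _ J] determined_eq determined_parity determined_site[of j _ "\<lambda>y. \<not> fst y"]) (use insert in auto)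
  also have "prob {x. fst (x j)} = 1 / (1 + z)"
    using measure_sites_box[of "{j}" z "\<lambda>_. {y. fst y}"] prob_site_flip[OF z] by simp
  also have "prob {x. \<not> fst (x j)} = z / (1 + z)"
    using measure_sites_box[of "{j}" z "\<lambda>_. {y. \<not> fst y}"] prob_site_flip[OF z] by simp
  finally have rec: "prob {x. parity (insert j J) x = d}
      = 1 / (1 + z) * prob {x. parity J x = (\<not> d)} + z / (1 + z) * prob {x. parity J x = d}" .
  define r where "r = ((z - 1) / (z + 1)) ^ card J"
  show ?case
  proof -
    have "z + 1 \<noteq> 0" using z by simp
    then have "1 / (1 + z) * ((1 + (if \<not> d then - 1 else 1) * r) / 2) + z / (1 + z) * ((1 + (if d then - 1 else 1) * r) / 2)
        = (1 + (if d then - 1 else 1) * ((z - 1) / (z + 1) * r)) / 2"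
      by (cases d; simp add: divide_simps; simp add: algebra_simps)
    then show ?thesis
      using insert(1,2) by (simp add: insert(3) r_def[symmetric] rec)
  qed
qed

text \<open>For positive \<open>z\<close> the base lies strictly between -1 and 1; at
  \<open>z = 0\<close> it would be -1 and the parity would never become random.\<close>

lemma tendsto_prob_parity:
  assumes z: "0 < z" and J: "\<And>k. finite (J k)" "filterlim (\<lambda>k. card (J k)) at_top sequentially"
  shows "(\<lambda>k. measure (sites z) {x. parity (J k) x = d}) \<longlonglongrightarrow> 1 / 2"
proof -
  have "\<bar>(z - 1) / (z + 1)\<bar> < 1"
    using z by (simp add: abs_if field_simps)
  then have "(\<lambda>n. ((z - 1) / (z + 1)) ^ n) \<longlonglongrightarrow> 0"
    by (simp add: LIMSEQ_power_zero)
  then have "(\<lambda>k. ((z - 1) / (z + 1)) ^ card (J k)) \<longlonglongrightarrow> 0"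
    using J(2) by (rule filterlim_compose)
  then have "(\<lambda>k. (1 + (if d then - 1 else 1) * ((z - 1) / (z + 1)) ^ card (J k)) / 2) \<longlonglongrightarrow> (1 + (if d then - 1 else 1) * 0) / 2"
    by (intro tendsto_intros) auto
  then show ?thesis
    by (simp add: prob_parity[OF z J(1)])
qed

section \<open>Translation invariance and mixing of the stacks\<close>

lemma prob_space_gibbs_chain: "prob_space (gibbs_chain z)"
  unfolding gibbs_chain_def by (rule prob_space.prob_space_distr[OF prob_space_spin_sites]) measurable

lemma sets_gibbs_chain [simp, measurable_cong]: "sets (gibbs_chain z) = sets borel"
  by (simp add: gibbs_chain_def)

lemma space_gibbs_chain [simp]: "space (gibbs_chain z) = UNIV"
  by (simp add: gibbs_chain_def)

lemma sets_stacks: "A \<in> sets borel \<Longrightarrow> {x. stacks c x \<in> A} \<in> sets (sites z)"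
  using measurable_sets[OF measurable_stacks[of c z], of A] by (simp add: vimage_def)

lemma measure_gibbs_chain:
  assumes "A \<in> sets borel"
  shows "measure (gibbs_chain z) A = measure (spin_sites z) {(b, x). stacks b x \<in> A}"
    and "measure (gibbs_chain z) A = (measure (sites z) {x. stacks True x \<in> A} + measure (sites z) {x. stacks False x \<in> A}) / 2"
proof -
  let ?m = "measure (sites z)"
  have "space (spin_sites z) = UNIV"
    by (simp add: spin_sites_def space_pair_measure)
  then show *: "measure (gibbs_chain z) A = measure (spin_sites z) {(b, x). stacks b x \<in> A}"
    unfolding gibbs_chain_def using assms by (subst measure_distr[OF measurable_stacks_pair]) (auto simp: vimage_def split_beta')
  show "measure (gibbs_chain z) A = (?m {x. stacks True x \<in> A} + ?m {x. stacks False x \<in> A}) / 2"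
    unfolding * using sets_stacks[OF assms] by (subst measure_spin_sites) (auto intro: sets_spin_sitesI)
qed

lemma sets_sites_shift:
  assumes "A \<in> sets (sites z)"
  shows "{x. (\<lambda>i. x (i + k)) \<in> A} \<in> sets (sites z)"
proof -
  have "(\<lambda>x i. x (i + k)) \<in> sites z \<rightarrow>\<^sub>M sites z"
    unfolding measurable_cong_sets[OF refl sets_sites] by (rule measurable_PiM_single') (auto simp: space_PiM)
  from measurable_sets[OF this assms] show ?thesis by (simp add: vimage_def)
qed

text \<open>After a shift the anchor is bond 1 instead of bond 0. The spin there is again a fair
  coin independent of the sites, and the law of the sites is invariant.\<close>

lemma translation_invariant_gibbs_chain: "translation_invariant (gibbs_chain z)"
  unfolding translation_invariant_def
proof (rule config_measure_eqI)
  let ?m = "measure (sites z)"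
  show "prob_space (distr (gibbs_chain z) borel shift)"
    by (rule prob_space.prob_space_distr[OF prob_space_gibbs_chain]) measurable
  fix A assume "A \<in> cylinders"
  then have A: "A \<in> sets borel" by (rule cylinders_sets)
  have sA: "shift -` A \<in> sets borel"
    using measurable_sets[OF measurable_shift A] by simp
  let ?R = "\<lambda>c x. stacks c (\<lambda>i. x (i + 1)) \<in> A"
  have R: "{x. ?R c x} = {x. (\<lambda>i. x (i + 1)) \<in> {x. stacks c x \<in> A}}" for c
    by simp
  have "shift (stacks b x) = stacks (spin b x 1) (\<lambda>i. x (i + 1))" for b x
    unfolding shift_def using stacks_shift[of b x _ 1] by simp
  then have "measure (gibbs_chain z) (shift -` A) = measure (spin_sites z) {(b, x). ?R (spin b x 1) x}"
    by (simp add: measure_gibbs_chain(1)[OF sA])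
  also have "\<dots> = (?m {x. ?R True x} + ?m {x. ?R False x}) / 2"
    by (rule measure_spin_at) (unfold R, intro sets_sites_shift sets_stacks A)
  also have "\<dots> = measure (gibbs_chain z) A"
    unfolding R measure_sites_shift[OF sets_stacks[OF A]] measure_gibbs_chain(2)[OF A] ..
  finally show "measure (distr (gibbs_chain z) borel shift) A = measure (gibbs_chain z) A"
    using A by (subst measure_distr) auto
qed (simp_all add: prob_space_gibbs_chain)

text \<open>The configuration rebuilt from the spin \<open>c\<close> at bond \<open>a\<close>. At a
  site to the right of \<open>a\<close> it uses only sites beyond \<open>a\<close>, so a window
  needs nothing but its own sites and one fair coin.\<close>

definition stacks_from :: "int \<Rightarrow> bool \<Rightarrow> (int \<Rightarrow> bool \<times> nat) \<Rightarrow> config"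
  where "stacks_from a c x i = stacks c (\<lambda>j. x (j + a)) (i - a)"

lemma stacks_eq_from: "stacks b x = stacks_from a (spin b x a) x"
  unfolding stacks_from_def fun_eq_iff using stacks_shift[of b x "_ - a" a] by simp

lemma stacks_from_cong:
  assumes "a < i" "\<And>j. j \<in> {a<..i} \<Longrightarrow> x j = y j"
  shows "stacks_from a c x i = stacks_from a c y i"
  using assms by (auto simp: stacks_from_def stacks_def intro!: arg_cong2[where f = "\<lambda>c c'. height c c' _"] spin_cong)

lemma determined_stacks_from:
  assumes "depends_on {a<..b} A"
  shows "determined {a<..b} (\<lambda>x. stacks_from a c x \<in> A)"
  unfolding determined_def
proof (intro allI impI)
  fix x y :: "int \<Rightarrow> bool \<times> nat"
  assume "\<forall>i\<in>{a<..b}. x i = y i"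
  then have "stacks_from a c x i = stacks_from a c y i" if "i \<in> {a<..b}" for i
    using that by (intro stacks_from_cong) auto
  then show "(stacks_from a c x \<in> A) = (stacks_from a c y \<in> A)"
    using assms unfolding depends_on_def by blast
qed

lemma measure_gibbs_chain_from:
  assumes A: "depends_on {a<..b} A"
  shows "measure (gibbs_chain z) A = (measure (sites z) {x. stacks_from a True x \<in> A} + measure (sites z) {x. stacks_from a False x \<in> A}) / 2"
proof -
  have "A \<in> sets borel"
    using A by (rule sets_depends_on[rotated]) simp
  moreover have "measure (spin_sites z) {(b, x). stacks_from a (spin b x a) x \<in> A}
      = (measure (sites z) {x. stacks_from a True x \<in> A} + measure (sites z) {x. stacks_from a False x \<in> A}) / 2"
    by (rule measure_spin_at, rule sets_sites_finite[of "{a<..b}"]) (simp, rule determined_stacks_from[OF A])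
  ultimately show ?thesis
    by (simp add: measure_gibbs_chain(1) stacks_eq_from[symmetric])
qed

lemma prob_sites_split:
  assumes "{x. P x} \<in> sets (sites z)" "{x. Q x} \<in> sets (sites z)"
  shows "measure (sites z) {x. P x} = (\<Sum>d\<in>UNIV. measure (sites z) {x. P x \<and> Q x = d})"
proof -
  let ?m = "measure (sites z)"
  interpret prob_space "sites z" by (rule prob_space_sites)
  have "{x. P x} = ({x. P x} \<inter> {x. Q x}) \<union> ({x. P x} - {x. Q x})"
    by auto
  also have "prob \<dots> = prob ({x. P x} \<inter> {x. Q x}) + prob ({x. P x} - {x. Q x})"
    using assms by (intro finite_measure_Union) auto
  finally show ?thesis
    by (simp add: UNIV_bool set_diff_eq Collect_conj_eq[symmetric] Int_def)
qed

text \<open>Only the parity of the number of flips between two windows couples them, and this parity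
  becomes a fair coin when the windows are far apart.\<close>

lemma mixing_gibbs_chain:
  assumes z: "0 < z"
  shows "mixing (gibbs_chain z)"
proof (rule mixing_if_cylinders)
  let ?m = "measure (sites z)"
  fix A B assume "A \<in> cylinders" "B \<in> cylinders"
  then obtain M1 M2 :: nat where "depends_on {- int M1..int M1} A" "depends_on {- int M2..int M2} B"
    by (auto simp: cylinders_def)
  moreover define M where "M = max M1 M2"
  \<comment> \<open>Bond \<open>a\<close> is the one immediately left of the site
    \<open>- int M\<close>; its spin enters the window from the left.\<close>
  moreover define a where "a = - int M - 1"
  ultimately have A: "depends_on {a<..int M} A" and B: "depends_on {a<..int M} B"
    by (auto elim!: depends_on_mono)
  let ?W = "{a<..int M}"
  \<comment> \<open>\<open>\<alpha>\<close> is the probability of \<open>A\<close> given its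
    entering spin, \<open>\<beta>\<close> couples \<open>B\<close> with the parity of the flips in
    its window, and \<open>\<pi>\<close> is the law of the parity in the gap before the translate.
    The sum \<open>?s\<close> averages over the fair spin at \<open>a\<close>.\<close>
  define \<alpha> where "\<alpha> c = ?m {x. stacks_from a c x \<in> A}" for c
  define \<beta> where "\<beta> c d = ?m {x. stacks_from a c x \<in> B \<and> parity ?W x = d}" for c d
  define \<pi> where "\<pi> k e = ?m {x. parity {int M<..a + int k} x = e}" for k e
  let ?s = "\<lambda>\<pi>. (\<Sum>c\<in>UNIV. \<Sum>d\<in>UNIV. \<Sum>e\<in>UNIV. \<beta> c d * (\<pi> e * \<alpha> (c \<noteq> (d \<noteq> e)))) / 2"
  note detA = determined_stacks_from[OF A] and detB = determined_stacks_from[OF B]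
  have mA: "{x. stacks_from a c x \<in> A} \<in> sets (sites z)" and mB: "{x. stacks_from a c x \<in> B} \<in> sets (sites z)" for c
    by (rule sets_sites_finite[OF _ detA] sets_sites_finite[OF _ detB], simp)+
  have mP: "{x. parity J x} \<in> sets (sites z)" if "finite J" for J
    by (rule sets_sites_finite[OF that determined_parity])
  have "A \<in> sets borel" "B \<in> sets borel"
    using A B by (auto intro: sets_depends_on[rotated])
  have val: "measure (gibbs_chain z) ((shift ^^ k) -` A \<inter> B)
      = ?s (\<pi> k)"
    \<comment> \<open>This is \<open>int M \<le> a + int k\<close>: the window and its translate are
      disjoint, with the gap \<open>{int M<..a + int k}\<close> between them.\<close>
    if k: "int k \<ge> 2 * int M + 1" for k
  proof -
    let ?mid = "{int M<..a + int k}"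
    define R where "R c x \<longleftrightarrow> stacks_from a c x \<in> B \<and> stacks_from a (c \<noteq> (parity ?W x \<noteq> parity ?mid x)) (\<lambda>i. x (i + int k)) \<in> A" for c x
    let ?S = "{a + int k<..int M + int k}"
    have detS: "determined ?S (\<lambda>x. stacks_from a h (\<lambda>i. x (i + int k)) \<in> A)" for h
      by (rule determined_shift[OF detA])
    have detR: "determined {a<..int M + int k} (R c)" for c
      unfolding determined_def
    proof (intro allI impI)
      fix x y :: "int \<Rightarrow> bool \<times> nat"
      assume xy: "\<forall>i\<in>{a<..int M + int k}. x i = y i"
      then have "parity ?W x = parity ?W y" "parity ?mid x = parity ?mid y"
        using k by (auto intro!: parity_cong simp: a_def)
      then show "R c x = R c y"
      proof -
        assume eq: "parity ?W x = parity ?W y" "parity ?mid x = parity ?mid y"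
        have "(stacks_from a c x \<in> B) = (stacks_from a c y \<in> B)"
          using detB[of c] xy unfolding determined_def by simp
        moreover have "(stacks_from a h (\<lambda>i. x (i + int k)) \<in> A) = (stacks_from a h (\<lambda>i. y (i + int k)) \<in> A)" for h
          using detS[of h] xy unfolding determined_def by simp
        ultimately show ?thesis
          unfolding R_def eq by simp
      qed
    qed
    \<comment> \<open>The spin that enters the translated window is the one at \<open>a\<close>,
      reversed once for every flip in the first window and in the gap.\<close>
    have "(shift ^^ k) (stacks b x) = stacks_from a (spin b x a \<noteq> (parity ?W x \<noteq> parity ?mid x)) (\<lambda>i. x (i + int k))" for b x
    proof -
      have "{a<..a + int k} = ?W \<union> ?mid"
        using k by (auto simp: a_def)
      then have "parity {a<..a + int k} x = (parity ?W x \<noteq> parity ?mid x)"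
        using parity_Un[of ?W ?mid x] by (simp add: disjoint_iff)
      moreover have "(shift ^^ k) (stacks b x) = stacks (spin b x (int k)) (\<lambda>i. x (i + int k))"
        unfolding shift_power fun_eq_iff using stacks_shift[of b x _ "int k"] by simp
      ultimately show ?thesis
        using stacks_eq_from[of "spin b x (int k)" "\<lambda>i. x (i + int k)" a] spin_shift[of b x a "int k"]
          spin_diff[of a "a + int k" b x] by simp
    qed
    then have "measure (gibbs_chain z) ((shift ^^ k) -` A \<inter> B) = measure (spin_sites z) {(b, x). R (spin b x a) x}"
      using measurable_sets[OF measurable_shift_power \<open>A \<in> sets borel\<close>, of k] \<open>B \<in> sets borel\<close>
      by (subst measure_gibbs_chain(1)) (auto simp: R_def stacks_eq_from[symmetric] conj_commute)
    also have "\<dots> = (?m {x. R True x} + ?m {x. R False x}) / 2"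
      by (rule measure_spin_at, rule sets_sites_finite[OF _ detR]) simp
    finally have sum: "measure (gibbs_chain z) ((shift ^^ k) -` A \<inter> B) = (?m {x. R True x} + ?m {x. R False x}) / 2" .
    have "?m {x. R c x} = (\<Sum>d\<in>UNIV. \<Sum>e\<in>UNIV. \<beta> c d * (\<pi> k e * \<alpha> (c \<noteq> (d \<noteq> e))))" for c
    proof -
      have piece: "?m {x. (R c x \<and> parity ?W x = d) \<and> parity ?mid x = e} = \<beta> c d * (\<pi> k e * \<alpha> (c \<noteq> (d \<noteq> e)))" for d e
      proof -
        have "{x. (R c x \<and> parity ?W x = d) \<and> parity ?mid x = e}
          = {x. (stacks_from a c x \<in> B \<and> parity ?W x = d) \<and> (parity ?mid x = e \<and> stacks_from a (c \<noteq> (d \<noteq> e)) (\<lambda>i. x (i + int k)) \<in> A)}"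
          unfolding R_def by (intro Collect_cong) blast
        also have "?m \<dots> = \<beta> c d * ?m {x. parity ?mid x = e \<and> stacks_from a (c \<noteq> (d \<noteq> e)) (\<lambda>i. x (i + int k)) \<in> A}"
          unfolding \<beta>_def
          by (intro prob_indep_blocks[of ?W _ "?mid \<union> ?S"] determined_conj determined_eq detB determined_parity
              determined_mono[OF detS] determined_mono[OF determined_parity, of ?mid]) (use k in \<open>auto simp: a_def\<close>)
        also have "?m {x. parity ?mid x = e \<and> stacks_from a (c \<noteq> (d \<noteq> e)) (\<lambda>i. x (i + int k)) \<in> A}
          = \<pi> k e * ?m {x. stacks_from a (c \<noteq> (d \<noteq> e)) (\<lambda>i. x (i + int k)) \<in> A}"
          unfolding \<pi>_def
          by (rule prob_indep_blocks[of ?mid _ ?S]) (auto intro!: determined_eq determined_parity detS)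
        also have "?m {x. stacks_from a (c \<noteq> (d \<noteq> e)) (\<lambda>i. x (i + int k)) \<in> A} = \<alpha> (c \<noteq> (d \<noteq> e))"
          unfolding \<alpha>_def using measure_sites_shift[OF mA, of "int k" "c \<noteq> (d \<noteq> e)"] by simp
        finally show ?thesis .
      qed
      have mR: "{x. R c x} \<in> sets (sites z)"
        by (rule sets_sites_finite[OF _ detR]) simp
      have mR': "{x. R c x \<and> parity ?W x = d} \<in> sets (sites z)" for d
        by (rule sets_sites_finite[of "{a<..int M + int k}"])
          (auto intro!: determined_conj detR determined_eq determined_mono[OF determined_parity])
      have "?m {x. R c x} = (\<Sum>d\<in>UNIV. ?m {x. R c x \<and> parity ?W x = d})"
        by (rule prob_sites_split[OF mR mP]) simp
      also have "\<dots> = (\<Sum>d\<in>UNIV. \<Sum>e\<in>UNIV. ?m {x. (R c x \<and> parity ?W x = d) \<and> parity ?mid x = e})"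
        by (intro sum.cong refl prob_sites_split[OF mR' mP]) simp
      finally show ?thesis
        unfolding piece .
    qed
    then show ?thesis unfolding sum by (simp add: UNIV_bool add.commute)
  qed
  have \<beta>: "\<beta> c True + \<beta> c False = ?m {x. stacks_from a c x \<in> B}" for c
    unfolding \<beta>_def 
    by (subst prob_sites_split[OF mB mP, of ?W]) (simp_all add: UNIV_bool)
  have "(\<lambda>k. \<pi> k e) \<longlonglongrightarrow> 1 / 2" for e
    unfolding \<pi>_def
  proof (rule tendsto_prob_parity[OF z])
    show "filterlim (\<lambda>k. card {int M<..a + int k}) at_top sequentially"
    proof (rule filterlim_at_top_mono)
      show "\<forall>\<^sub>F k in sequentially. k - (2 * M + 1) \<le> card {int M<..a + int k}"
        by (auto simp: a_def intro!: always_eventually)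
    qed (rule filterlim_minus_const_nat_at_top)
  qed simp
  then have "(\<lambda>k. ?s (\<pi> k))
      \<longlonglongrightarrow> ?s (\<lambda>_. 1 / 2)"
    by (intro tendsto_intros) auto
  \<comment> \<open>With a fair gap parity, summing over \<open>e\<close> gives the mean of
    \<open>\<alpha>\<close> over both spins, whatever \<open>c\<close> and \<open>d\<close> are.
    Then the sum over \<open>d\<close> removes the parity from \<open>\<beta>\<close> and the
    expression factorises.\<close>
  moreover have "?s (\<lambda>_. 1 / 2)
      = measure (gibbs_chain z) A * measure (gibbs_chain z) B"
    unfolding measure_gibbs_chain_from[OF A] measure_gibbs_chain_from[OF B] \<beta>[symmetric] \<alpha>_def[symmetric]
    by (simp add: UNIV_bool field_simps)
  moreover have "\<forall>\<^sub>F k in sequentially. ?s (\<pi> k)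
      = measure (gibbs_chain z) ((shift ^^ k) -` A \<inter> B)"
    using eventually_ge_at_top[of "2 * M + 1"] by eventually_elim (subst val, auto)
  ultimately show "(\<lambda>k. measure (gibbs_chain z) ((shift ^^ k) -` A \<inter> B)) \<longlonglongrightarrow> measure (gibbs_chain z) A * measure (gibbs_chain z) B"
    by (simp add: tendsto_cong)
qed (simp_all add: prob_space_gibbs_chain translation_invariant_gibbs_chain)

section \<open>Density of the stacks\<close>

lemma AE_spin_sitesI:
  assumes "AE x in sites z. Q x"
  shows "AE p in spin_sites z. Q (snd p)"
proof -
  interpret P: prob_space "spin_sites z" by (rule prob_space_spin_sites)
  obtain N where N: "N \<in> null_sets (sites z)" "{x. \<not> Q x} \<subseteq> N"
    using assms unfolding eventually_ae_filter by auto
  have "{(b, x). x \<in> N} \<in> sets (spin_sites z)"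
    using N by (intro sets_spin_sitesI) auto
  moreover from measure_spin_sites[OF this] have "measure (spin_sites z) {(b, x). x \<in> N} = 0"
    using N by (simp add: measure_eq_0_null_sets)
  ultimately have "{(b, x). x \<in> N} \<in> null_sets (spin_sites z)"
    by (auto simp: P.emeasure_eq_measure)
  then show ?thesis
    by (rule AE_I') (use N in auto)
qed

text \<open>The lowering by 2 between inward spins equals the flip indicator plus the left spin
  minus the right spin. Dropping the telescoping difference leaves this function of one site, to
  which the law of large numbers applies.\<close>

definition site_mass :: "bool \<times> nat \<Rightarrow> real"
  where "site_mass y = 2 * real (snd y) + 2 - of_bool (fst y)"

lemma of_nat_stacks:
  "real (stacks b x i) = site_mass (x i) + of_bool (spin b x i) - of_bool (spin b x (i - 1))"
  using spin_step[of b x i] by (auto simp: stacks_def height_def site_mass_def)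

lemma sum_stacks:
  "(\<Sum>i = a + 1..a + int N. real (stacks b x i))
    = (\<Sum>i = a + 1..a + int N. site_mass (x i)) + of_bool (spin b x (a + int N)) - of_bool (spin b x a)"
proof (induction N)
  case (Suc N)
  have "{a + 1..a + int (Suc N)} = insert (a + int (Suc N)) {a + 1..a + int N}" by auto
  then show ?case
    using Suc by (simp add: of_nat_stacks algebra_simps)
qed simp

lemma site_mass_moments:
  assumes z: "0 < z" "z < 1"
  shows "measure_pmf.expectation (site_pmf z) site_mass = 1 / (1 - z)"
    and "integrable (measure_pmf (site_pmf z)) (\<lambda>y. (site_mass y - c) ^ 4)"
proof -
  have p: "0 < 1 - z\<^sup>2" "1 - z\<^sup>2 \<le> 1"
    using z by (simp_all add: abs_square_less_1)
  have snd: "map_pmf snd (site_pmf z) = geometric_pmf (1 - z\<^sup>2)" and fst: "map_pmf fst (site_pmf z) = bernoulli_pmf (1 / (1 + z))"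
    by (simp_all add: site_pmf_def map_snd_pair_pmf map_fst_pair_pmf)
  have i1: "integrable (measure_pmf (site_pmf z)) (\<lambda>y. real (snd y))"
    using integrable_real_geometric_pmf[of "1 - z\<^sup>2"] p unfolding snd[symmetric] by (simp add: integrable_map_pmf_eq)
  have i4: "integrable (measure_pmf (site_pmf z)) (\<lambda>y. real (snd y) ^ 4)"
    using integrable_geometric_fourth[of "1 - z\<^sup>2"] p unfolding snd[symmetric] by (simp add: integrable_map_pmf_eq)
  have i2: "integrable (measure_pmf (site_pmf z)) (\<lambda>y. of_bool (fst y) :: real)"
    by (rule measure_pmf.integrable_const_bound[where B = 1]) auto
  have "measure_pmf.expectation (site_pmf z) (\<lambda>y. real (snd y)) = measure_pmf.expectation (geometric_pmf (1 - z\<^sup>2)) real"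
    unfolding snd[symmetric] by simp
  also have "\<dots> = z\<^sup>2 / (1 - z\<^sup>2)"
    using expectation_geometric_pmf[of "1 - z\<^sup>2"] p by simp
  finally have e1: "measure_pmf.expectation (site_pmf z) (\<lambda>y. real (snd y)) = z\<^sup>2 / (1 - z\<^sup>2)" .
  have "measure_pmf.expectation (site_pmf z) (\<lambda>y. of_bool (fst y) :: real) = measure_pmf.expectation (bernoulli_pmf (1 / (1 + z))) of_bool"
    unfolding fst[symmetric] by simp
  also have "\<dots> = 1 / (1 + z)"
    using z by (subst integral_bernoulli_pmf) auto
  finally have e2: "measure_pmf.expectation (site_pmf z) (\<lambda>y. of_bool (fst y) :: real) = 1 / (1 + z)" .
  have "measure_pmf.expectation (site_pmf z) site_mass = 2 * (z\<^sup>2 / (1 - z\<^sup>2)) + 2 - 1 / (1 + z)"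
    unfolding site_mass_def[abs_def] using i1 i2 e1 e2 by simp
  also have "\<dots> = 1 / (1 - z)"
  proof -
    have "1 - z\<^sup>2 = (1 - z) * (1 + z)"
      by (simp add: power2_eq_square algebra_simps)
    moreover have "1 - z \<noteq> 0" "1 + z \<noteq> 0" using z by auto
    ultimately show ?thesis
      by (simp add: divide_simps power2_eq_square)
  qed
  finally show "measure_pmf.expectation (site_pmf z) site_mass = 1 / (1 - z)" .
  show "integrable (measure_pmf (site_pmf z)) (\<lambda>y. (site_mass y - c) ^ 4)"
  proof (rule Bochner_Integration.integrable_bound)
    show "integrable (measure_pmf (site_pmf z)) (\<lambda>y. 8 * (16 * real (snd y) ^ 4 + (2 + \<bar>c\<bar>) ^ 4))"
      using i4 by simp
    show "AE y in measure_pmf (site_pmf z). norm ((site_mass y - c) ^ 4) \<le> norm (8 * (16 * real (snd y) ^ 4 + (2 + \<bar>c\<bar>) ^ 4))"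
    proof (rule AE_I2)
      fix y :: "bool \<times> nat"
      define u v where "u = 2 * real (snd y)" and "v = 2 + \<bar>c\<bar>"
      \<comment> \<open>The bound \<open>(p + q)\<^sup>2 \<le> 2 * (p\<^sup>2 + q\<^sup>2)\<close>
        is applied twice, to \<open>u\<close> and \<open>v\<close> and then to their
        squares.\<close>
      have uv: "(u + v) ^ 4 \<le> 8 * (u ^ 4 + v ^ 4)"
      proof -
        have "(u + v)\<^sup>2 \<le> 2 * (u\<^sup>2 + v\<^sup>2)"
          using zero_le_power2[of "u - v"] by (simp add: power2_eq_square algebra_simps)
        then have "((u + v)\<^sup>2)\<^sup>2 \<le> (2 * (u\<^sup>2 + v\<^sup>2))\<^sup>2"
          by (intro power_mono) auto
        also have "\<dots> \<le> 8 * ((u\<^sup>2)\<^sup>2 + (v\<^sup>2)\<^sup>2)"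
          using zero_le_power2[of "u\<^sup>2 - v\<^sup>2"] by (simp add: power2_eq_square algebra_simps)
        finally show ?thesis by simp
      qed
      have "\<bar>site_mass y - c\<bar> \<le> u + v"
        by (auto simp: site_mass_def u_def v_def)
      then have "\<bar>site_mass y - c\<bar> ^ 4 \<le> (u + v) ^ 4"
        by (intro power_mono) auto
      then show "norm ((site_mass y - c) ^ 4) \<le> norm (8 * (16 * real (snd y) ^ 4 + (2 + \<bar>c\<bar>) ^ 4))"
        using uv by (simp add: u_def v_def power_abs power_mult_distrib)
    qed
  qed simp
qed

text \<open>An injective enumeration \<open>s\<close> of sites again gives independent variables, so
  this single statement serves the right and the left half-line.\<close>

lemma AE_site_mass_average:
  assumes z: "0 < z" "z < 1" and s: "inj s"
  shows "AE x in sites z. (\<lambda>N. (\<Sum>i<N. site_mass (x (s i))) / real N) \<longlonglongrightarrow> 1 / (1 - z)"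
proof -
  interpret prob_space "sites z" by (rule prob_space_sites)
  interpret P: product_prob_space "\<lambda>_. measure_pmf (site_pmf z)" "UNIV :: int set"
    by unfold_locales
  let ?h = "\<lambda>y. site_mass y - 1 / (1 - z)"
  let ?X = "\<lambda>i x. ?h (x (s i))"
  have d: "distr (sites z) (measure_pmf (site_pmf z)) (\<lambda>x. x i) = measure_pmf (site_pmf z)" for i
    unfolding sites_def using P.PiM_component[of i] by simp
  have m: "(\<lambda>x. x i) \<in> sites z \<rightarrow>\<^sub>M measure_pmf (site_pmf z)" for i
    using measurable_site[of i z] by (simp cong: measurable_cong_sets)
  have ex: "expectation (\<lambda>x. f (x i)) = measure_pmf.expectation (site_pmf z) f"
    and int: "integrable (sites z) (\<lambda>x. f (x i)) \<longleftrightarrow> integrable (measure_pmf (site_pmf z)) f" for f :: "bool \<times> nat \<Rightarrow> real" and i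
    using integral_distr[OF m[of i], of f] integrable_distr_eq[OF m[of i], of f] d[of i] by simp_all
  have "distr (sites z) (PiM UNIV (\<lambda>_. measure_pmf (site_pmf z))) (\<lambda>x. \<lambda>i\<in>UNIV. x (s i)) = PiM UNIV (\<lambda>_. measure_pmf (site_pmf z))"
    unfolding sites_def by (rule distr_PiM_reindex) (use s in \<open>auto simp: prob_space_measure_pmf\<close>)
  then have "indep_vars (\<lambda>_. measure_pmf (site_pmf z)) (\<lambda>i x. x (s i)) UNIV"
    using m by (subst indep_vars_iff_distr_eq_PiM') (auto simp: d)
  then have iv: "indep_vars (\<lambda>_. borel) ?X UNIV"
    by (intro indep_vars_compose2[of _ _ _ "\<lambda>_. ?h"]) (auto simp: comp_def)
  have i4: "integrable (measure_pmf (site_pmf z)) (\<lambda>y. ?h y ^ 4)"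
    by (rule site_mass_moments[OF z])
  have i1: "integrable (measure_pmf (site_pmf z)) (\<lambda>y. ?h y)"
    using integrable_power_le[OF measure_pmf.finite_measure_axioms _ i4, of 1] by simp
  then have i0: "integrable (measure_pmf (site_pmf z)) site_mass"
    using Bochner_Integration.integrable_add[OF i1, of "\<lambda>_. 1 / (1 - z)"] by simp
  have "AE x in sites z. (\<lambda>N. (\<Sum>i<N. ?X i x) / real N) \<longlonglongrightarrow> 0"
  proof (rule strong_law_fourth_moment[OF iv])
    define C where "C = max (measure_pmf.expectation (site_pmf z) (\<lambda>y. ?h y ^ 2)) (measure_pmf.expectation (site_pmf z) (\<lambda>y. ?h y ^ 4))"
    show "integrable (sites z) (\<lambda>x. ?X i x ^ 4)" for i
      using i4 by (simp add: int[of "\<lambda>y. ?h y ^ 4"])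
    show "expectation (?X i) = 0" for i
      using ex[of ?h] i0 site_mass_moments(1)[OF z] by simp
    show "expectation (\<lambda>x. ?X i x ^ 2) \<le> C" for i
      using ex[of "\<lambda>y. ?h y ^ 2"] by (simp add: C_def)
    show "expectation (\<lambda>x. ?X i x ^ 4) \<le> C" for i
      using ex[of "\<lambda>y. ?h y ^ 4"] by (simp add: C_def)
  qed
  then show ?thesis
  proof eventually_elim
    case (elim x)
    have "(\<lambda>N. (\<Sum>i<N. ?X i x) / real N + 1 / (1 - z)) \<longlonglongrightarrow> 0 + 1 / (1 - z)"
      by (intro tendsto_add elim tendsto_const)
    moreover have "\<forall>\<^sub>F N in sequentially. (\<Sum>i<N. ?X i x) / real N + 1 / (1 - z) = (\<Sum>i<N. site_mass (x (s i))) / real N"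
      using eventually_gt_at_top[of 0]
    proof eventually_elim
      case (elim N)
      have "(\<Sum>i<N. ?X i x) = (\<Sum>i<N. site_mass (x (s i))) - real N * (1 / (1 - z))"
        by (simp add: sum_subtractf)
      then show ?case
        using elim by (simp only: diff_divide_distrib) simp
    qed
    ultimately show ?case
      by (simp add: tendsto_cong)
  qed
qed

lemma tendsto_average_bounded_perturbation:
  fixes f g :: "nat \<Rightarrow> real"
  assumes "(\<lambda>N. f N / real N) \<longlonglongrightarrow> l" and "\<And>N. \<bar>g N - f N\<bar> \<le> C"
  shows "(\<lambda>N. g N / real N) \<longlonglongrightarrow> l"
proof -
  have "(\<lambda>N. (g N - f N) / real N) \<longlonglongrightarrow> 0"
  proof (rule Lim_null_comparison)
    show "\<forall>\<^sub>F N in sequentially. norm ((g N - f N) / real N) \<le> C / real N"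
      using assms(2) by (auto intro!: always_eventually divide_right_mono simp: abs_divide)
  qed (rule lim_const_over_n)
  from tendsto_add[OF this assms(1)] show ?thesis
    by (simp add: diff_divide_distrib)
qed

text \<open>Convergence is expressed by countably many conditions. Measurability is needed because
  an almost sure statement is carried along \<open>distr\<close> by
  \<open>AE_distr_iff\<close>.\<close>

lemma borel_Collect_tendsto:
  fixes f :: "nat \<Rightarrow> 'a \<Rightarrow> real"
  assumes [measurable]: "\<And>i. f i \<in> borel_measurable M"
  shows "{x \<in> space M. (\<lambda>i. f i x) \<longlonglongrightarrow> l} \<in> sets M"
proof -
  have "(\<lambda>i. f i x) \<longlonglongrightarrow> l \<longleftrightarrow> (\<forall>m::nat. \<exists>N. \<forall>n\<ge>N. \<bar>f n x - l\<bar> < inverse (real (Suc m)))" for x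
  proof
    assume "(\<lambda>i. f i x) \<longlonglongrightarrow> l"
    then show "\<forall>m::nat. \<exists>N. \<forall>n\<ge>N. \<bar>f n x - l\<bar> < inverse (real (Suc m))"
      using LIMSEQ_D[of "\<lambda>i. f i x" l] by (metis inverse_Suc real_norm_def)
  next
    assume *: "\<forall>m::nat. \<exists>N. \<forall>n\<ge>N. \<bar>f n x - l\<bar> < inverse (real (Suc m))"
    show "(\<lambda>i. f i x) \<longlonglongrightarrow> l"
    proof (rule LIMSEQ_I)
      fix r :: real assume "0 < r"
      then obtain m where "inverse (real (Suc m)) < r"
        using reals_Archimedean by blast
      then show "\<exists>no. \<forall>n\<ge>no. norm (f n x - l) < r"
        using * by (metis less_trans real_norm_def)
    qed
  qed
  moreover have "{x \<in> space M. \<forall>m::nat. \<exists>N. \<forall>n\<ge>N. \<bar>f n x - l\<bar> < inverse (real (Suc m))} \<in> sets M"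
    by measurable
  ultimately show ?thesis by simp
qed

lemma has_density_gibbs_chain:
  assumes z: "0 < z" "z < 1"
  shows "has_density (gibbs_chain z) (1 / (1 - z))"
proof -
  define P where "P n \<longleftrightarrow> (\<lambda>N. (\<Sum>i = 1..int N. real (n i)) / real N) \<longlonglongrightarrow> 1 / (1 - z) \<and>
    (\<lambda>N. (\<Sum>i = - int N..-1. real (n i)) / real N) \<longlonglongrightarrow> 1 / (1 - z)" for n :: config
  have "AE x in sites z. (\<lambda>N. (\<Sum>i<N. site_mass (x (int i + 1))) / real N) \<longlonglongrightarrow> 1 / (1 - z)"
    "AE x in sites z. (\<lambda>N. (\<Sum>i<N. site_mass (x (- 1 - int i))) / real N) \<longlonglongrightarrow> 1 / (1 - z)"
    by (rule AE_site_mass_average[OF z]; simp add: inj_on_def)+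
  then have "AE x in sites z. \<forall>b. P (stacks b x)"
  proof eventually_elim
    case (elim x)
    have s1: "(\<Sum>i<N. site_mass (x (int i + 1))) = (\<Sum>i = 1..int N. site_mass (x i))" for N
      by (rule sum.reindex_bij_witness[of _ "\<lambda>i. nat (i - 1)" "\<lambda>i. int i + 1"]) auto
    have s2: "(\<Sum>i<N. site_mass (x (- 1 - int i))) = (\<Sum>i = - int N..-1. site_mass (x i))" for N
      by (rule sum.reindex_bij_witness[of _ "\<lambda>i. nat (- 1 - i)" "\<lambda>i. - 1 - int i"]) auto
    show ?case
      unfolding P_def
    proof (intro allI conjI)
      fix b
      show "(\<lambda>N. (\<Sum>i = 1..int N. real (stacks b x i)) / real N) \<longlonglongrightarrow> 1 / (1 - z)"
        by (rule tendsto_average_bounded_perturbation[OF elim(1)[unfolded s1], where C = 1])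
          (use sum_stacks[where a = 0 and b = b and x = x] in \<open>auto simp: of_bool_def\<close>)
      show "(\<lambda>N. (\<Sum>i = - int N..-1. real (stacks b x i)) / real N) \<longlonglongrightarrow> 1 / (1 - z)"
      proof (rule tendsto_average_bounded_perturbation[OF elim(2)[unfolded s2], where C = 1])
        show "\<bar>(\<Sum>i = - int N..-1. real (stacks b x i)) - (\<Sum>i = - int N..-1. site_mass (x i))\<bar> \<le> 1" for N
          using sum_stacks[where a = "- 1 - int N" and N = N and b = b and x = x] by (auto simp: of_bool_def)
      qed
    qed
  qed
  from AE_spin_sitesI[OF this] have "AE p in spin_sites z. P (case p of (b, x) \<Rightarrow> stacks b x)"
    by eventually_elim (auto split: prod.split)
  moreover have "{n \<in> space borel. P n} \<in> sets (borel :: config measure)"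
  proof -
    have m: "(\<lambda>n. real (n i)) \<in> borel_measurable (borel :: config measure)" for i
      using measurable_compose[OF measurable_coord, of real borel i] by simp
    have "{n \<in> space borel. P n} = {n \<in> space borel. (\<lambda>N. (\<Sum>i = 1..int N. real (n i)) / real N) \<longlonglongrightarrow> 1 / (1 - z)}
      \<inter> {n \<in> space borel. (\<lambda>N. (\<Sum>i = - int N..-1. real (n i)) / real N) \<longlonglongrightarrow> 1 / (1 - z)}"
      by (auto simp: P_def)
    also have "\<dots> \<in> sets (borel :: config measure)"
      by (intro sets.Int borel_Collect_tendsto borel_measurable_divide borel_measurable_sum m) auto
    finally show ?thesis .
  qed
  ultimately show ?thesis
    unfolding has_density_def gibbs_chain_def P_def[symmetric]
    by (subst AE_distr_iff[OF measurable_stacks_pair]) auto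
qed

subsection \<open>Stationarity\<close>

text \<open>Given the stacks, the spins between them are free fair coins apart from the bonds next to an
  empty stack, and this is exactly the law of the fluxes.\<close>

definition spin_weight :: "real \<Rightarrow> bool \<Rightarrow> real"
  where "spin_weight z c = (if c then z else 1)"

text \<open>Given the left spin \<open>c\<close>, this is the probability of height \<open>n\<close>
  and right spin \<open>c'\<close>, written as a function of \<open>n\<close> times a ratio that
  telescopes. The power \<open>z ^ n / z\<close> also covers \<open>n = 0\<close>, where the ratio
  is \<open>z\<close>.\<close>

definition site_weight :: "real \<Rightarrow> bool \<Rightarrow> nat \<Rightarrow> bool \<Rightarrow> real"
  where "site_weight z c n c' = (if even n \<and> (n = 0 \<longrightarrow> c \<and> \<not> c')
    then (1 - z) * z ^ n / z * (spin_weight z c / spin_weight z c') else 0)"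

lemma prob_site_height:
  assumes z: "0 < z" "z < 1"
  shows "measure_pmf.prob (site_pmf z) {y. fst y = (c \<noteq> c') \<and> height c c' (snd y) = n} = site_weight z c n c'"
proof -
  have p: "0 < 1 - z\<^sup>2" "1 - z\<^sup>2 \<le> 1" "0 \<le> 1 / (1 + z)" "1 / (1 + z) \<le> 1"
    using z by (simp_all add: abs_square_less_1)
  define k where "k = (if c \<and> \<not> c' then 0 else 1 :: nat)"
  show ?thesis
  proof (cases "even n \<and> (n = 0 \<longrightarrow> c \<and> \<not> c')")
    case True
    then obtain m where m: "n = 2 * m" by auto
    define g where "g = m - k"
    have g: "m = g + k"
      using True m by (auto simp: k_def g_def)
    have "{y :: bool \<times> nat. fst y = (c \<noteq> c') \<and> height c c' (snd y) = n} = {(c \<noteq> c', g)}"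
      unfolding m g by (auto simp: height_def k_def)
    then have "measure_pmf.prob (site_pmf z) {y. fst y = (c \<noteq> c') \<and> height c c' (snd y) = n}
        = pmf (bernoulli_pmf (1 / (1 + z))) (c \<noteq> c') * ((z\<^sup>2) ^ g * (1 - z\<^sup>2))"
      using pmf_geometric[OF p(1,2), of g] by (simp add: measure_pmf_single site_pmf_def pmf_pair)
    also have "pmf (bernoulli_pmf (1 / (1 + z))) (c \<noteq> c') = (if c \<noteq> c' then 1 else z) / (1 + z)"
    proof -
      have "1 - 1 / (1 + z) = z / (1 + z)"
        using z by (simp add: field_simps)
      then show ?thesis
        using p by (cases "c \<noteq> c'") simp_all
    qed
    also have "1 - z\<^sup>2 = (1 - z) * (1 + z)"
      by (simp add: power2_eq_square algebra_simps)
    also have "(if c \<noteq> c' then 1 else z) / (1 + z) * ((z\<^sup>2) ^ g * ((1 - z) * (1 + z))) = (1 - z) * ((if c \<noteq> c' then 1 else z) * z ^ (2 * g))"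
      using z by (simp add: power_mult)
    also have "(if c \<noteq> c' then 1 else z) * z ^ (2 * g) = z ^ n / z * (spin_weight z c / spin_weight z c')"
      unfolding m g using z by (auto simp: k_def spin_weight_def power2_eq_square power_add)
    finally show ?thesis
      using True by (simp add: site_weight_def)
  next
    case False
    then have "{y :: bool \<times> nat. fst y = (c \<noteq> c') \<and> height c c' (snd y) = n} = {}"
      by (auto simp: height_def split: if_splits)
    then show ?thesis
      unfolding site_weight_def by (simp only: False if_False measure_empty)
  qed
qed

text \<open>Once all spins are prescribed, the requirement at each site concerns that site alone.
  The event becomes the left spin together with a box, whose probability is a product.\<close>

lemma spins_stacks_iff:
  assumes "a \<le> b"
  shows "(\<forall>i\<in>{a<..b}. stacks c x i = \<nu> i) \<and> (\<forall>i\<in>{a..b}. spin c x i = \<phi> i)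
    \<longleftrightarrow> spin c x a = \<phi> a \<and> (\<forall>i\<in>{a<..b}. x i \<in> {y. fst y = (\<phi> (i - 1) \<noteq> \<phi> i) \<and> height (\<phi> (i - 1)) (\<phi> i) (snd y) = \<nu> i})"
    (is "?L \<longleftrightarrow> ?R")
proof
  assume L: ?L
  have "x i \<in> {y. fst y = (\<phi> (i - 1) \<noteq> \<phi> i) \<and> height (\<phi> (i - 1)) (\<phi> i) (snd y) = \<nu> i}" if "i \<in> {a<..b}" for i
  proof -
    have "spin c x (i - 1) = \<phi> (i - 1)" "spin c x i = \<phi> i" "stacks c x i = \<nu> i"
      using L that by auto
    then show ?thesis
      using spin_step[of c x i] by (auto simp: stacks_def)
  qed
  then show ?R using L assms by auto
next
  assume R: ?R
  have sp: "i \<le> b \<longrightarrow> spin c x i = \<phi> i" if "a \<le> i" for i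
    using that
  proof (induction i rule: int_ge_induct)
    case (step i)
    show ?case
    proof
      assume "i + 1 \<le> b"
      then have "fst (x (i + 1)) = (\<phi> i \<noteq> \<phi> (i + 1))"
        using R step(1) by auto
      then show "spin c x (i + 1) = \<phi> (i + 1)"
        using spin_step[of c x "i + 1"] step \<open>i + 1 \<le> b\<close> by auto
    qed
  qed (use R in simp)
  have "stacks c x i = \<nu> i" if "i \<in> {a<..b}" for i
  proof -
    have "spin c x i = \<phi> i" "spin c x (i - 1) = \<phi> (i - 1)"
      using sp[of i] sp[of "i - 1"] that by auto
    then show ?thesis
      using R that by (auto simp: stacks_def)
  qed
  then show ?L using sp by auto
qed

lemma prod_telescope_int:
  fixes u :: "int \<Rightarrow> real"
  assumes "a \<le> b" "\<And>i. u i \<noteq> 0"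
  shows "(\<Prod>i\<in>{a<..b}. u (i - 1) / u i) = u a / u b"
  using assms(1)
proof (induction b rule: int_ge_induct)
  case base
  then show ?case using assms(2) by simp
next
  case (step b)
  have "{a<..b + 1} = insert (b + 1) {a<..b}" using step(1) by auto
  then show ?case using step assms(2) by simp
qed

text \<open>The factor 1/2 is the probability of the left spin \<open>\<phi> a\<close>; the other
  spins are produced by the flips.\<close>

lemma prob_spins_stacks:
  assumes z: "0 < z" "z < 1" and ab: "a \<le> b"
  shows "{(c, x). (\<forall>i\<in>{a<..b}. stacks c x i = \<nu> i) \<and> (\<forall>i\<in>{a..b}. spin c x i = \<phi> i)} \<in> sets (spin_sites z)" (is "?E \<in> _")
    and "measure (spin_sites z) {(c, x). (\<forall>i\<in>{a<..b}. stacks c x i = \<nu> i) \<and> (\<forall>i\<in>{a..b}. spin c x i = \<phi> i)}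
      = (\<Prod>i\<in>{a<..b}. site_weight z (\<phi> (i - 1)) (\<nu> i) (\<phi> i)) / 2"
proof -
  let ?m = "measure (sites z)"
  let ?X = "\<lambda>i. {y. fst y = (\<phi> (i - 1) \<noteq> \<phi> i) \<and> height (\<phi> (i - 1)) (\<phi> i) (snd y) = \<nu> i}"
  let ?R = "\<lambda>c x. c = \<phi> a \<and> (\<forall>i\<in>{a<..b}. x i \<in> ?X i)"
  have E: "?E = {(c, x). ?R (spin c x a) x}"
    using spins_stacks_iff[OF ab] by auto
  have m: "{x. ?R c x} \<in> sets (sites z)" for c
    by (rule sets_sites_finite[of "{a<..b}"]) (auto simp: determined_def)
  show "?E \<in> sets (spin_sites z)"
    unfolding E by (rule measure_spin_at(1)[OF m])
  have "measure (spin_sites z) ?E = (?m {x. ?R True x} + ?m {x. ?R False x}) / 2"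
    unfolding E by (rule measure_spin_at(2)[OF m])
  also have "\<dots> = ?m {x. \<forall>i\<in>{a<..b}. x i \<in> ?X i} / 2"
    by (cases "\<phi> a") auto
  also have "?m {x. \<forall>i\<in>{a<..b}. x i \<in> ?X i} = (\<Prod>i\<in>{a<..b}. measure_pmf.prob (site_pmf z) (?X i))"
    by (rule measure_sites_box) simp
  also have "\<dots> = (\<Prod>i\<in>{a<..b}. site_weight z (\<phi> (i - 1)) (\<nu> i) (\<phi> i))"
    by (intro prod.cong refl prob_site_height z)
  finally show "measure (spin_sites z) ?E = (\<Prod>i\<in>{a<..b}. site_weight z (\<phi> (i - 1)) (\<nu> i) (\<phi> i)) / 2" .
qed

text \<open>Interior spins survive only in the compatibility condition. This uniformity is what
  makes them behave like fair coins given the stacks.\<close>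

lemma prod_site_weight:
  fixes a b :: int
  assumes z: "0 < z" and ab: "a \<le> b"
  shows "(\<Prod>i\<in>{a<..b}. site_weight z (\<phi> (i - 1)) (\<nu> i) (\<phi> i))
    = (if \<forall>i\<in>{a<..b}. even (\<nu> i) \<and> (\<nu> i = 0 \<longrightarrow> \<phi> (i - 1) \<and> \<not> \<phi> i)
       then (\<Prod>i\<in>{a<..b}. (1 - z) * z ^ \<nu> i / z) * (spin_weight z (\<phi> a) / spin_weight z (\<phi> b)) else 0)"
proof (cases "\<forall>i\<in>{a<..b}. even (\<nu> i) \<and> (\<nu> i = 0 \<longrightarrow> \<phi> (i - 1) \<and> \<not> \<phi> i)")
  case True
  have "(\<Prod>i\<in>{a<..b}. site_weight z (\<phi> (i - 1)) (\<nu> i) (\<phi> i))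
    = (\<Prod>i\<in>{a<..b}. ((1 - z) * z ^ \<nu> i / z) * (spin_weight z (\<phi> (i - 1)) / spin_weight z (\<phi> i)))"
    using True by (intro prod.cong) (auto simp: site_weight_def)
  also have "\<dots> = (\<Prod>i\<in>{a<..b}. (1 - z) * z ^ \<nu> i / z) * (\<Prod>i\<in>{a<..b}. spin_weight z (\<phi> (i - 1)) / spin_weight z (\<phi> i))"
    by (rule prod.distrib)
  also have "(\<Prod>i\<in>{a<..b}. spin_weight z (\<phi> (i - 1)) / spin_weight z (\<phi> i)) = spin_weight z (\<phi> a) / spin_weight z (\<phi> b)"
    using prod_telescope_int[OF ab, of "\<lambda>i. spin_weight z (\<phi> i)"] z by (simp add: spin_weight_def)
  finally show ?thesis using True by simp
next
  case False
  then obtain i where "i \<in> {a<..b}" "site_weight z (\<phi> (i - 1)) (\<nu> i) (\<phi> i) = 0"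
    by (auto simp: site_weight_def)
  then have "(\<Prod>i\<in>{a<..b}. site_weight z (\<phi> (i - 1)) (\<nu> i) (\<phi> i)) = 0"
    by (intro prod_zero) auto
  then show ?thesis by (simp only: False if_False)
qed

lemma (in prob_space) prob_sum_patterns:
  fixes g :: "'a \<Rightarrow> int \<Rightarrow> bool"
  assumes B: "finite B" and S: "S \<in> events" and g: "\<And>k. k \<in> B \<Longrightarrow> {x \<in> space M. g x k} \<in> events"
  shows "prob S = (\<Sum>\<phi>\<in>B \<rightarrow>\<^sub>E UNIV. prob {x \<in> S. \<forall>k\<in>B. g x k = \<phi> k})"
proof -
  have fin: "finite (B \<rightarrow>\<^sub>E (UNIV :: bool set))"
    using B by (intro finite_PiE) auto
  have Ssp: "S \<subseteq> space M" using sets.sets_into_space[OF S] .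
  have meas: "{x \<in> S. \<forall>k\<in>B. g x k = \<phi> k} \<in> events" for \<phi>
  proof -
    have "{x \<in> space M. g x k = \<phi> k} \<in> events" if "k \<in> B" for k
      using g[OF that] sets.compl_sets[OF g[OF that]] by (cases "\<phi> k") (auto simp: set_diff_eq elim: back_subst[of "\<lambda>A. A \<in> events"])
    then have "{x \<in> space M. \<forall>k\<in>B. g x k = \<phi> k} \<in> events"
      using B by (intro sets.sets_Collect_finite_All) auto
    moreover have "{x \<in> S. \<forall>k\<in>B. g x k = \<phi> k} = S \<inter> {x \<in> space M. \<forall>k\<in>B. g x k = \<phi> k}"
      using Ssp by auto
    ultimately show ?thesis using S by auto
  qed
  have eq: "S = (\<Union>\<phi>\<in>B \<rightarrow>\<^sub>E UNIV. {x \<in> S. \<forall>k\<in>B. g x k = \<phi> k})"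
  proof
    show "S \<subseteq> (\<Union>\<phi>\<in>B \<rightarrow>\<^sub>E UNIV. {x \<in> S. \<forall>k\<in>B. g x k = \<phi> k})"
    proof
      fix x assume "x \<in> S"
      then show "x \<in> (\<Union>\<phi>\<in>B \<rightarrow>\<^sub>E UNIV. {x \<in> S. \<forall>k\<in>B. g x k = \<phi> k})"
        by (intro UN_I[of "restrict (g x) B"]) auto
    qed
  qed auto
  have "prob (\<Union>\<phi>\<in>B \<rightarrow>\<^sub>E UNIV. {x \<in> S. \<forall>k\<in>B. g x k = \<phi> k}) = (\<Sum>\<phi>\<in>B \<rightarrow>\<^sub>E UNIV. prob {x \<in> S. \<forall>k\<in>B. g x k = \<phi> k})"
  proof (rule finite_measure_finite_Union[OF fin])
    show "disjoint_family_on (\<lambda>\<phi>. {x \<in> S. \<forall>k\<in>B. g x k = \<phi> k}) (B \<rightarrow>\<^sub>E UNIV)"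
      unfolding disjoint_family_on_def
    proof (intro ballI impI)
      fix \<phi> \<psi> :: "int \<Rightarrow> bool" assume "\<phi> \<in> B \<rightarrow>\<^sub>E UNIV" "\<psi> \<in> B \<rightarrow>\<^sub>E UNIV" "\<phi> \<noteq> \<psi>"
      then have "\<exists>k\<in>B. \<phi> k \<noteq> \<psi> k"
        using PiE_ext[of \<phi> B "\<lambda>_. UNIV" \<psi>] by blast
      then obtain k where "k \<in> B" "\<phi> k \<noteq> \<psi> k" ..
      then show "{x \<in> S. \<forall>k\<in>B. g x k = \<phi> k} \<inter> {x \<in> S. \<forall>k\<in>B. g x k = \<psi> k} = {}"
        by auto
    qed
  qed (use meas in auto)
  with eq show ?thesis by metis
qed

text \<open>The bonds strictly between \<open>a\<close> and \<open>b\<close> have both ends among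
  the sites \<open>{a<..b}\<close>. The two boundary bonds are left out, since the fluxes across
  them also depend on stacks outside.\<close>

definition compatible :: "int \<Rightarrow> int \<Rightarrow> config \<Rightarrow> (int \<Rightarrow> bool) \<Rightarrow> bool"
  where "compatible a b \<nu> \<phi> \<longleftrightarrow> (\<forall>k\<in>{a<..<b}. (\<nu> k = 0 \<longrightarrow> \<not> \<phi> k) \<and> (\<nu> (k + 1) = 0 \<longrightarrow> \<phi> k))"

abbreviation (input) window :: "int \<Rightarrow> int \<Rightarrow> config \<Rightarrow> (int \<Rightarrow> bool) \<Rightarrow> (bool \<times> (int \<Rightarrow> bool \<times> nat)) set"
  where "window a b \<nu> \<phi> \<equiv> {(c, x). (\<forall>i\<in>{a<..b}. stacks c x i = \<nu> i) \<and> (\<forall>k\<in>{a<..<b}. spin c x k = \<phi> k)}"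

abbreviation (input) coin_window :: "int \<Rightarrow> int \<Rightarrow> config \<Rightarrow> (int \<Rightarrow> bool) \<Rightarrow> (int \<Rightarrow> bool) set"
  where "coin_window a b \<nu> \<phi> \<equiv> {\<omega>. \<forall>k\<in>{a<..<b}. (flux \<nu> \<omega> k = 1) = \<phi> k}"

lemma sets_spin_sites_spin: "{(c, x). spin c x k} \<in> sets (spin_sites z)"
  using measurable_sets[OF measurable_spin_sites_spin, of "{True}" _ k z]
  by (intro sets_spin_sitesI) (simp add: vimage_def)

lemma sets_spin_sites_stacks: "finite J \<Longrightarrow> {(c, x). \<forall>i\<in>J. stacks c x i = \<nu> i} \<in> sets (spin_sites z)"
proof (rule sets_spin_sitesI)
  fix b assume "finite J"
  then have "{n. \<forall>i\<in>J. n i = \<nu> i} \<in> sets borel"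
    by (rule sets_depends_on) (auto simp: depends_on_def)
  from sets_stacks[OF this] show "{x. \<forall>i\<in>J. stacks b x i = \<nu> i} \<in> sets (sites z)"
    by simp
qed

lemma sets_interior_spins:
  "(window a b \<nu> \<phi>) \<in> sets (spin_sites z)"
proof -
  have "{(c, x). spin c x k = \<phi> k} \<in> sets (spin_sites z)" for k
  proof (rule sets_spin_sitesI)
    show "{x. spin b x k = \<phi> k} \<in> sets (sites z)" for b
      using measurable_sets[OF measurable_spin_sites_spin, of "{\<phi> k}" b k z] by (simp add: vimage_def)
  qed
  then have "{p \<in> space (spin_sites z). \<forall>k\<in>{a<..<b}. (case p of (c, x) \<Rightarrow> spin c x k = \<phi> k)} \<in> sets (spin_sites z)"
    by (intro sets.sets_Collect_finite_All) (auto simp: spin_sites_def space_pair_measure split_beta')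
  from sets.Int[OF sets_spin_sites_stacks[of "{a<..b}" \<nu> z] this] show ?thesis
    by (auto simp: spin_sites_def space_pair_measure split_beta' Int_def elim: back_subst[of "\<lambda>A. A \<in> sets (spin_sites z)"])
qed

lemma AE_gibbs_chain_Xe: "AE n in gibbs_chain z. n \<in> Xe"
proof -
  have "Xe = (\<Inter>i. {n. even (n i) \<and> \<not> (n i = 0 \<and> n (i + 1) = 0)})"
    by (auto simp: Xe_def)
  also have "\<dots> \<in> sets borel"
    by (intro sets.countable_INT' sets_depends_on[where W = "{_, _ + 1}"]) (auto simp: depends_on_def)
  finally have "{n \<in> space borel. n \<in> Xe} \<in> sets borel" by simp
  then show ?thesis
    unfolding gibbs_chain_def by (subst AE_distr_iff[OF measurable_stacks_pair]) (auto simp: stacks_Xe)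
qed

text \<open>The two boundary spins are summed out. Their constraints and their weights do not
  involve the interior spins, so the sum is one constant for all compatible interior
  patterns.\<close>

lemma prob_interior_spins:
  assumes z: "0 < z" "z < 1" and ab: "a < b" and ev: "\<And>i. i \<in> {a<..b} \<Longrightarrow> even (\<nu> i)"
  obtains C where "\<And>\<phi>. measure (spin_sites z) (window a b \<nu> \<phi>)
      = (if compatible a b \<nu> \<phi> then C else 0)"
proof
  let ?ok = "\<lambda>\<psi>. (\<nu> (a + 1) = 0 \<longrightarrow> \<psi> a) \<and> (\<nu> b = 0 \<longrightarrow> \<not> \<psi> b)"
  interpret prob_space "spin_sites z" by (rule prob_space_spin_sites)
  define w where "w = (\<Prod>i\<in>{a<..b}. (1 - z) * z ^ \<nu> i / z)"
  define C where "C = (\<Sum>\<psi>\<in>{a, b} \<rightarrow>\<^sub>E UNIV. if ?ok \<psi>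
      then w * (spin_weight z (\<psi> a) / spin_weight z (\<psi> b)) / 2 else 0)"
  fix \<phi>
  let ?S = "(window a b \<nu> \<phi>)"
  have sp: "space (spin_sites z) = UNIV"
    by (simp add: spin_sites_def space_pair_measure)
  have mk: "{p \<in> space (spin_sites z). (case p of (c, x) \<Rightarrow> spin c x k)} \<in> events" for k
    using sets_spin_sites_spin[of k z] by (simp add: sp split_beta')
  have S: "?S \<in> events"
    by (rule sets_interior_spins)
  have "prob ?S = (\<Sum>\<psi>\<in>{a, b} \<rightarrow>\<^sub>E UNIV. prob {p \<in> ?S. \<forall>k\<in>{a, b}. (case p of (c, x) \<Rightarrow> spin c x k) = \<psi> k})"
    by (rule prob_sum_patterns[where g = "\<lambda>p k. case p of (c, x) \<Rightarrow> spin c x k"]) (use S mk in auto)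
  also have "\<dots> = (\<Sum>\<psi>\<in>{a, b} \<rightarrow>\<^sub>E UNIV. if compatible a b \<nu> \<phi> \<and> ?ok \<psi>
      then w * (spin_weight z (\<psi> a) / spin_weight z (\<psi> b)) / 2 else 0)"
  proof (rule sum.cong[OF refl])
    fix \<psi> :: "int \<Rightarrow> bool"
    define \<eta> where "\<eta> k = (if k = a \<or> k = b then \<psi> k else \<phi> k)" for k
    have "(\<forall>k\<in>{a..b}. spin c x k = \<eta> k) \<longleftrightarrow> (\<forall>k\<in>{a<..<b}. spin c x k = \<phi> k) \<and> (\<forall>k\<in>{a, b}. spin c x k = \<psi> k)" for c x
    proof -
      have "{a..b} = {a<..<b} \<union> {a, b}" using ab by auto
      then show ?thesis by (auto simp: \<eta>_def)
    qed
    then have "{p \<in> ?S. \<forall>k\<in>{a, b}. (case p of (c, x) \<Rightarrow> spin c x k) = \<psi> k}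
      = {(c, x). (\<forall>i\<in>{a<..b}. stacks c x i = \<nu> i) \<and> (\<forall>k\<in>{a..b}. spin c x k = \<eta> k)}"
      by auto
    then have "prob {p \<in> ?S. \<forall>k\<in>{a, b}. (case p of (c, x) \<Rightarrow> spin c x k) = \<psi> k}
      = (\<Prod>i\<in>{a<..b}. site_weight z (\<eta> (i - 1)) (\<nu> i) (\<eta> i)) / 2"
      using prob_spins_stacks(2)[OF z, of a b \<nu> \<eta>] ab by simp
    also have "(\<Prod>i\<in>{a<..b}. site_weight z (\<eta> (i - 1)) (\<nu> i) (\<eta> i))
      = (if \<forall>i\<in>{a<..b}. even (\<nu> i) \<and> (\<nu> i = 0 \<longrightarrow> \<eta> (i - 1) \<and> \<not> \<eta> i) then w * (spin_weight z (\<eta> a) / spin_weight z (\<eta> b)) else 0)"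
      unfolding w_def using ab by (intro prod_site_weight z(1)) simp
    \<comment> \<open>The conditions at empty stacks separate: those on interior bonds concern
      \<open>\<phi>\<close> only, those on the bonds \<open>a\<close> and \<open>b\<close> concern
      \<open>\<psi>\<close> only.\<close>
    also have "(\<forall>i\<in>{a<..b}. even (\<nu> i) \<and> (\<nu> i = 0 \<longrightarrow> \<eta> (i - 1) \<and> \<not> \<eta> i))
      \<longleftrightarrow> compatible a b \<nu> \<phi> \<and> ?ok \<psi>" (is "?l \<longleftrightarrow> ?r")
    proof
      assume l: ?l
      have "(\<nu> k = 0 \<longrightarrow> \<not> \<phi> k) \<and> (\<nu> (k + 1) = 0 \<longrightarrow> \<phi> k)" if "k \<in> {a<..<b}" for k
        using that bspec[OF l, of k] bspec[OF l, of "k + 1"] by (auto simp: \<eta>_def)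
      then show ?r
        using bspec[OF l, of "a + 1"] bspec[OF l, of b] ab by (auto simp: compatible_def \<eta>_def)
    next
      assume r: ?r
      have "\<nu> i = 0 \<longrightarrow> \<eta> (i - 1) \<and> \<not> \<eta> i" if i: "i \<in> {a<..b}" for i
      proof (intro impI conjI)
        assume 0: "\<nu> i = 0"
        show "\<eta> (i - 1)"
        proof (cases "i = a + 1")
          case False
          then have "\<phi> (i - 1)"
            using r 0 i unfolding compatible_def by (auto dest!: bspec[of _ _ "i - 1"])
          then show ?thesis using False i by (auto simp: \<eta>_def)
        qed (use r 0 in \<open>auto simp: \<eta>_def\<close>)
        show "\<not> \<eta> i"
        proof (cases "i = b")
          case False
          then have "\<not> \<phi> i"
            using r 0 i unfolding compatible_def by auto
          then show ?thesis using False i by (auto simp: \<eta>_def)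
        qed (use r 0 ab in \<open>auto simp: \<eta>_def\<close>)
      qed
      then show ?l using ev by auto
    qed
    also have "(if compatible a b \<nu> \<phi> \<and> ?ok \<psi>
        then w * (spin_weight z (\<eta> a) / spin_weight z (\<eta> b)) else 0) / 2
      = (if compatible a b \<nu> \<phi> \<and> ?ok \<psi>
        then w * (spin_weight z (\<psi> a) / spin_weight z (\<psi> b)) / 2 else 0)"
      by (subst if_distrib[of "\<lambda>t. t / 2"]) (simp only: \<eta>_def simp_thms if_True div_0)
    finally show "prob {p \<in> ?S. \<forall>k\<in>{a, b}. (case p of (c, x) \<Rightarrow> spin c x k) = \<psi> k}
      = (if compatible a b \<nu> \<phi> \<and> ?ok \<psi>
      then w * (spin_weight z (\<psi> a) / spin_weight z (\<psi> b)) / 2 else 0)" .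
  qed
  also have "\<dots> = (if compatible a b \<nu> \<phi> then C else 0)"
    by (simp add: C_def)
  finally show "prob ?S = (if compatible a b \<nu> \<phi> then C else 0)" .
qed

section \<open>The law of the fluxes\<close>

lemma prob_space_fair_coins: "prob_space fair_coins"
  unfolding fair_coins_def by (intro prob_space_PiM prob_space_measure_pmf)

lemma sets_fair_coins: "sets fair_coins = sets (PiM UNIV (\<lambda>_. count_space UNIV))"
  unfolding fair_coins_def by (intro sets_PiM_cong) auto

lemma space_fair_coins [simp]: "space fair_coins = UNIV"
  by (simp add: fair_coins_def space_PiM)

lemma measure_fair_coins_box:
  assumes "finite J"
  shows "measure fair_coins {\<omega>. \<forall>k\<in>J. \<omega> k = \<phi> k} = (1 / 2) ^ card J"
proof -
  interpret product_prob_space "\<lambda>_. measure_pmf (bernoulli_pmf (1/2))" "UNIV :: int set"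
    by unfold_locales
  have half: "measure_pmf.prob (bernoulli_pmf (1/2)) {c} = 1 / 2" for c
    by (cases c) (simp_all add: measure_pmf_single)
  have "{\<omega>. \<forall>k\<in>J. \<omega> k \<in> X k} = prod_emb UNIV (\<lambda>_. measure_pmf (bernoulli_pmf (1/2))) J (PiE J X)" for X
    by (auto simp: prod_emb_def PiE_iff)
  from this[of "\<lambda>k. {\<phi> k}"] have "measure fair_coins {\<omega>. \<forall>k\<in>J. \<omega> k = \<phi> k} = (\<Prod>k\<in>J. measure_pmf.prob (bernoulli_pmf (1/2)) {\<phi> k})"
    unfolding fair_coins_def using measure_PiM_emb[of J "\<lambda>k. {\<phi> k}"] assms by simp
  then show ?thesis by (simp add: half)
qed

lemma sets_fair_coins_flux: "finite J \<Longrightarrow> {\<omega>. \<forall>k\<in>J. (flux \<nu> \<omega> k = 1) = \<phi> k} \<in> sets fair_coins"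
proof -
  assume J: "finite J"
  have "(\<lambda>\<omega>. \<forall>k\<in>J. (flux \<nu> \<omega> k = 1) = \<phi> k) \<in> fair_coins \<rightarrow>\<^sub>M count_space UNIV"
    unfolding measurable_cong_sets[OF sets_fair_coins refl]
    by (rule measurable_finitely_determined[OF J]) (auto simp: flux_def)
  from measurable_sets[OF this, of "{True}"] show ?thesis
    by (simp add: vimage_def)
qed

text \<open>A bond next to an empty stack has a forced flux, and a bond between two tall stacks
  copies its coin. The constant is therefore 1/2 to the number of bonds between tall stacks.\<close>

lemma prob_fluxes:
  assumes ev: "\<And>i. i \<in> {a<..b} \<Longrightarrow> even (\<nu> i)" and nz: "\<And>k. k \<in> {a<..<b} \<Longrightarrow> \<not> (\<nu> k = 0 \<and> \<nu> (k + 1) = 0)"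
  obtains D where "\<And>\<phi>. measure fair_coins (coin_window a b \<nu> \<phi>) = (if compatible a b \<nu> \<phi> then D else 0)"
proof
  fix \<phi>
  let ?T = "{k \<in> {a<..<b}. \<nu> k \<noteq> 0 \<and> \<nu> (k + 1) \<noteq> 0}"
  have key: "(flux \<nu> \<omega> k = 1) = \<phi> k \<longleftrightarrow> (\<nu> k \<noteq> 0 \<and> \<nu> (k + 1) \<noteq> 0 \<longrightarrow> \<omega> k = \<phi> k) \<and> (\<nu> k = 0 \<longrightarrow> \<not> \<phi> k) \<and> (\<nu> (k + 1) = 0 \<longrightarrow> \<phi> k)"
    if k: "k \<in> {a<..<b}" for \<omega> k
  proof -
    have s: "short (\<nu> i) \<longleftrightarrow> \<nu> i = 0" if "i \<in> {a<..b}" for i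
      using ev[OF that] by (auto simp: short_def le_Suc_eq)
    have "short (\<nu> k) \<longleftrightarrow> \<nu> k = 0" "short (\<nu> (k + 1)) \<longleftrightarrow> \<nu> (k + 1) = 0"
      using k by (auto intro!: s)
    then show ?thesis
      using nz[OF k] by (auto simp: flux_def)
  qed
  have "(\<forall>k\<in>{a<..<b}. (flux \<nu> \<omega> k = 1) = \<phi> k) \<longleftrightarrow> compatible a b \<nu> \<phi> \<and> (\<forall>k\<in>?T. \<omega> k = \<phi> k)" for \<omega>
  proof
    assume l: "\<forall>k\<in>{a<..<b}. (flux \<nu> \<omega> k = 1) = \<phi> k"
    have "(\<nu> k \<noteq> 0 \<and> \<nu> (k + 1) \<noteq> 0 \<longrightarrow> \<omega> k = \<phi> k) \<and> (\<nu> k = 0 \<longrightarrow> \<not> \<phi> k) \<and> (\<nu> (k + 1) = 0 \<longrightarrow> \<phi> k)"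
      if "k \<in> {a<..<b}" for k
      using bspec[OF l that] unfolding key[OF that] .
    then show "compatible a b \<nu> \<phi> \<and> (\<forall>k\<in>?T. \<omega> k = \<phi> k)"
      unfolding compatible_def by blast
  next
    assume r: "compatible a b \<nu> \<phi> \<and> (\<forall>k\<in>?T. \<omega> k = \<phi> k)"
    show "\<forall>k\<in>{a<..<b}. (flux \<nu> \<omega> k = 1) = \<phi> k"
    proof
      fix k assume "k \<in> {a<..<b}"
      then show "(flux \<nu> \<omega> k = 1) = \<phi> k"
        using r unfolding key[OF \<open>k \<in> {a<..<b}\<close>] compatible_def by blast
    qed
  qed
  then have eq: "(coin_window a b \<nu> \<phi>) = (if compatible a b \<nu> \<phi> then {\<omega>. \<forall>k\<in>?T. \<omega> k = \<phi> k} else {})"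
    by auto
  show "measure fair_coins (coin_window a b \<nu> \<phi>) = (if compatible a b \<nu> \<phi> then (1 / 2) ^ card ?T else 0)"
    unfolding eq
  proof -
    have "finite ?T"
      by (rule finite_subset[of _ "{a<..<b}"]) auto
    from measure_fair_coins_box[OF this, of \<phi>]
    show "measure fair_coins (if compatible a b \<nu> \<phi> then {\<omega>. \<forall>k\<in>?T. \<omega> k = \<phi> k} else {})
        = (if compatible a b \<nu> \<phi> then (1 / 2) ^ card ?T else 0)"
      by (simp only: measure_empty split: if_split) simp
  qed
qed

text \<open>Both sides are constant on the compatible patterns of spins, and both sum to the same total.\<close>

lemma spins_given_stacks:
  assumes z: "0 < z" "z < 1" and ab: "a < b"
  shows "measure (spin_sites z) (window a b \<nu> \<phi>)
    = measure (gibbs_chain z) {n. \<forall>i\<in>{a<..b}. n i = \<nu> i} * measure fair_coins (coin_window a b \<nu> \<phi>)"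
proof -
  interpret S: prob_space "spin_sites z" by (rule prob_space_spin_sites)
  interpret F: prob_space fair_coins by (rule prob_space_fair_coins)
  let ?S = "{(c, x). \<forall>i\<in>{a<..b}. stacks c x i = \<nu> i}"
  have sp: "space (spin_sites z) = UNIV"
    by (simp add: spin_sites_def space_pair_measure)
  have \<mu>: "measure (gibbs_chain z) {n. \<forall>i\<in>{a<..b}. n i = \<nu> i} = S.prob ?S"
    by (subst measure_gibbs_chain(1)) (auto intro!: sets_depends_on[of "{a<..b}"] simp: depends_on_def)
  show ?thesis
  proof (cases "(\<forall>i\<in>{a<..b}. even (\<nu> i)) \<and> (\<forall>k\<in>{a<..<b}. \<not> (\<nu> k = 0 \<and> \<nu> (k + 1) = 0))")
    case True
    obtain C where C: "\<And>\<phi>. S.prob (window a b \<nu> \<phi>) = (if compatible a b \<nu> \<phi> then C else 0)"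
      using prob_interior_spins[OF z ab, of \<nu>] True by blast
    obtain D where D: "\<And>\<phi>. F.prob (coin_window a b \<nu> \<phi>) = (if compatible a b \<nu> \<phi> then D else 0)"
      using prob_fluxes[of a b \<nu>] True by blast
    \<comment> \<open>\<open>N\<close> counts compatible patterns. The stacks have probability
      \<open>C * N\<close>, while \<open>D * N = 1\<close>; hence \<open>C\<close> is the
      probability of the stacks times \<open>D\<close>.\<close>
    define N where "N = real (card {\<psi> \<in> {a<..<b} \<rightarrow>\<^sub>E UNIV. compatible a b \<nu> \<psi>})"
    have fin: "finite ({a<..<b} \<rightarrow>\<^sub>E (UNIV :: bool set))"
      by (intro finite_PiE) auto
    have "S.prob ?S = (\<Sum>\<psi>\<in>{a<..<b} \<rightarrow>\<^sub>E UNIV. S.prob {p \<in> ?S. \<forall>k\<in>{a<..<b}. (case p of (c, x) \<Rightarrow> spin c x k) = \<psi> k})"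
      by (rule S.prob_sum_patterns[where g = "\<lambda>p k. case p of (c, x) \<Rightarrow> spin c x k"])
        (use sets_spin_sites_stacks[of "{a<..b}" \<nu> z] sets_spin_sites_spin[of _ z] in \<open>auto simp: sp split_beta'\<close>)
    also have "\<dots> = (\<Sum>\<psi>\<in>{a<..<b} \<rightarrow>\<^sub>E UNIV. if compatible a b \<nu> \<psi> then C else 0)"
      unfolding C[symmetric] by (intro sum.cong refl arg_cong[of _ _ S.prob]) auto
    also have "\<dots> = C * N"
      by (simp add: N_def sum.inter_filter[OF fin, symmetric])
    finally have 1: "S.prob ?S = C * N" .
    have "F.prob UNIV = (\<Sum>\<psi>\<in>{a<..<b} \<rightarrow>\<^sub>E UNIV. F.prob {\<omega> \<in> UNIV. \<forall>k\<in>{a<..<b}. (flux \<nu> \<omega> k = 1) = \<psi> k})"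
    proof (rule F.prob_sum_patterns)
      show "{\<omega> \<in> space fair_coins. flux \<nu> \<omega> k = 1} \<in> F.events" for k
        using sets_fair_coins_flux[of "{k}" \<nu> "\<lambda>_. True"] by simp
      show "UNIV \<in> F.events"
        using sets.top[of fair_coins] by simp
    qed simp
    also have "\<dots> = (\<Sum>\<psi>\<in>{a<..<b} \<rightarrow>\<^sub>E UNIV. if compatible a b \<nu> \<psi> then D else 0)"
      by (simp add: D)
    also have "\<dots> = D * N"
      by (simp add: N_def sum.inter_filter[OF fin, symmetric])
    finally have 2: "D * N = 1"
      using F.prob_space by simp
    show ?thesis
      unfolding \<mu> C D 1 using 2 by (simp add: mult.assoc mult.commute[of N])
  next
    case False
    \<comment> \<open>The prescribed heights cannot occur in \<open>Xe\<close>, so both sides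
      vanish.\<close>
    have "?S = {}"
    proof (rule ccontr)
      assume "?S \<noteq> {}"
      then obtain c x where eq: "\<forall>i\<in>{a<..b}. stacks c x i = \<nu> i" by auto
      have ex: "even (stacks c x i)" "\<not> (stacks c x i = 0 \<and> stacks c x (i + 1) = 0)" for i
        using stacks_Xe[of c x] unfolding Xe_def by auto
      have "even (\<nu> i)" if "i \<in> {a<..b}" for i
        using eq ex(1)[of i] that by auto
      moreover have "\<not> (\<nu> k = 0 \<and> \<nu> (k + 1) = 0)" if "k \<in> {a<..<b}" for k
        using bspec[OF eq, of k] bspec[OF eq, of "k + 1"] ex(2)[of k] that by auto
      ultimately show False using False by blast
    qed
    moreover from this have "(window a b \<nu> \<phi>) = {}"
      by auto
    ultimately show ?thesis
      unfolding \<mu> by (simp only: measure_empty mult_zero_left)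
  qed
qed

section \<open>One time step as a reversal of the spins\<close>

definition flow :: "config \<Rightarrow> (int \<Rightarrow> bool) \<Rightarrow> config"
  where "flow n \<phi> i = nat (int (n i) + (if \<phi> (i - 1) then 1 else - 1) - (if \<phi> i then 1 else - 1))"

text \<open>On \<open>Xe\<close> every bond has at least one tall end, so a flux is never 0 and its
  sign can be stored as a Boolean.\<close>

lemma ssm_step_flow:
  assumes "n \<in> Xe"
  shows "ssm_step n \<omega> = flow n (\<lambda>k. flux n \<omega> k = 1)"
proof -
  have "flux n \<omega> k = (if flux n \<omega> k = 1 then 1 else - 1)" for k
  proof -
    have "\<not> (n k = 0 \<and> n (k + 1) = 0)" "even (n k)" "even (n (k + 1))"
      using assms by (auto simp: Xe_def)
    then show ?thesis
      by (auto simp: flux_def short_def le_Suc_eq)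
  qed
  then show ?thesis
    by (auto simp: fun_eq_iff ssm_step_def flow_def)
qed

text \<open>If the particles follow the spins, one time step amounts to reversing all spins.\<close>

lemma flow_stacks: "flow (stacks b x) (spin b x) = stacks (\<not> b) x"
  by (auto simp: fun_eq_iff flow_def stacks_def height_def spin_not)

lemma flow_cong:
  assumes "n i = m i" "\<phi> (i - 1) = \<psi> (i - 1)" "\<phi> i = \<psi> i"
  shows "flow n \<phi> i = flow m \<psi> i"
  using assms by (simp add: flow_def)

text \<open>On a finite window the stacks with their fluxes have the same joint law as the stacks
  with their spins. Applying \<open>flow\<close> to the first pair is a time step, to the second a
  reversal of the initial coin, which is fair.\<close>

lemma stationary_gibbs_chain:
  assumes z: "0 < z" "z < 1"
  shows "stationary (gibbs_chain z)"
  unfolding stationary_def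
proof (rule config_measure_eqI)
  let ?P = "gibbs_chain z \<Otimes>\<^sub>M fair_coins"
  let ?m = "measure (sites z)"
  interpret G: prob_space "gibbs_chain z" by (rule prob_space_gibbs_chain)
  interpret F: prob_space fair_coins by (rule prob_space_fair_coins)
  interpret S: prob_space "spin_sites z" by (rule prob_space_spin_sites)
  interpret GF: pair_prob_space "gibbs_chain z" fair_coins ..
  have K: "ssm_kernel \<in> gibbs_chain z \<rightarrow>\<^sub>M prob_algebra borel"
    using measurable_ssm_kernel by (simp cong: measurable_cong_sets)
  have K': "ssm_kernel \<in> gibbs_chain z \<rightarrow>\<^sub>M subprob_algebra borel"
    by (rule measurable_prob_algebraD[OF K])
  show "prob_space (gibbs_chain z \<bind> ssm_kernel)"
    by (rule prob_space_bind'[OF _ K]) (simp add: space_prob_algebra prob_space_gibbs_chain)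
  show sets: "sets (gibbs_chain z \<bind> ssm_kernel) = sets borel"
    by (rule sets_bind[OF sets_kernel[OF K']]) simp_all
  fix A assume "A \<in> cylinders"
  then obtain M :: nat where A: "depends_on {- int M..int M} A"
    by (auto simp: cylinders_def)
  have Ab: "A \<in> sets borel"
    by (rule sets_depends_on[OF _ A]) simp
  \<comment> \<open>A new height at site \<open>i\<close> needs the spins on bonds
    \<open>i - 1\<close> and \<open>i\<close>. For \<open>i\<close> between \<open>- int M\<close>
    and \<open>int M\<close> these are exactly the bonds in \<open>{a<..<b}\<close>.\<close>
  define a b where "a = - int M - 2" and "b = int M + 1"
  have ab: "a < b" by (simp add: a_def b_def)
  let ?D = "{a<..b}" and ?B = "{a<..<b}"
  let ?\<Omega> = "(?D \<rightarrow>\<^sub>E (UNIV :: nat set)) \<times> (?B \<rightarrow>\<^sub>E (UNIV :: bool set))"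
  \<comment> \<open>Window patterns form a countable set, so the two joint laws may be compared
    point by point.\<close>
  have cnt: "countable ?\<Omega>"
    by (intro countable_SIGMA countable_PiE) auto
  define X where "X = (\<lambda>(n :: config, \<omega>). (restrict n ?D, restrict (\<lambda>k. flux n \<omega> k = 1) ?B))"
  define Y where "Y = (\<lambda>(c, x). (restrict (stacks c x) ?D, restrict (spin c x) ?B))"
  have spG: "space ?P = UNIV" and spS: "space (spin_sites z) = UNIV"
    by (simp_all add: space_pair_measure spin_sites_def)
  have preX: "X -` {(\<nu>, \<phi>)} = {n. \<forall>i\<in>?D. n i = \<nu> i} \<times> (coin_window a b \<nu> \<phi>)"
    and preY: "Y -` {(\<nu>, \<phi>)} = (window a b \<nu> \<phi>)"
    if "(\<nu>, \<phi>) \<in> ?\<Omega>" for \<nu> \<phi>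
  proof -
    have res: "restrict f J = g \<longleftrightarrow> (\<forall>i\<in>J. f i = g i)" if "g \<in> J \<rightarrow>\<^sub>E UNIV" for f g :: "int \<Rightarrow> 'c" and J
      using that by (fastforce simp: fun_eq_iff PiE_iff extensional_def)
    have fl: "flux n \<omega> k = flux \<nu> \<omega> k" if "\<forall>i\<in>?D. n i = \<nu> i" "k \<in> ?B" for n \<omega> k
      using that by (auto simp: flux_def)
    have "X (n, \<omega>) = (\<nu>, \<phi>) \<longleftrightarrow> (\<forall>i\<in>?D. n i = \<nu> i) \<and> (\<forall>k\<in>?B. (flux n \<omega> k = 1) = \<phi> k)" for n \<omega>
      using that by (simp add: X_def res)
    moreover have "(\<forall>i\<in>?D. n i = \<nu> i) \<and> (\<forall>k\<in>?B. (flux n \<omega> k = 1) = \<phi> k) \<longleftrightarrow> (\<forall>i\<in>?D. n i = \<nu> i) \<and> (\<forall>k\<in>?B. (flux \<nu> \<omega> k = 1) = \<phi> k)" for n \<omega>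
    proof (rule conj_cong[OF refl], rule ball_cong[OF refl])
      fix k assume "\<forall>i\<in>?D. n i = \<nu> i" "k \<in> ?B"
      then show "((flux n \<omega> k = 1) = \<phi> k) = ((flux \<nu> \<omega> k = 1) = \<phi> k)"
        by (simp only: fl)
    qed
    ultimately have "p \<in> X -` {(\<nu>, \<phi>)} \<longleftrightarrow> p \<in> {n. \<forall>i\<in>?D. n i = \<nu> i} \<times> (coin_window a b \<nu> \<phi>)" for p
      by (cases p) (simp only: vimage_eq singleton_iff mem_Times_iff mem_Collect_eq fst_conv snd_conv)
    then show "X -` {(\<nu>, \<phi>)} = {n. \<forall>i\<in>?D. n i = \<nu> i} \<times> (coin_window a b \<nu> \<phi>)"
      by (rule set_eqI)
    show "Y -` {(\<nu>, \<phi>)} = (window a b \<nu> \<phi>)"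
      using that by (auto simp: Y_def res)
  qed
  have cyl: "{n. \<forall>i\<in>?D. n i = \<nu> i} \<in> sets borel" for \<nu> :: config
    by (rule sets_depends_on[of ?D]) (auto simp: depends_on_def)
  have flx: "(coin_window a b \<nu> \<phi>) \<in> sets fair_coins" for \<nu> \<phi>
    by (rule sets_fair_coins_flux) simp
  have mX: "X \<in> ?P \<rightarrow>\<^sub>M count_space ?\<Omega>"
    unfolding measurable_count_space_eq_countable[OF cnt]
  proof (intro conjI ballI)
    show "X -` {p} \<inter> space ?P \<in> sets ?P" if "p \<in> ?\<Omega>" for p
      using that cyl flx by (cases p) (auto simp only: preX spG Int_UNIV_right sets_gibbs_chain intro!: pair_measureI)
  qed (auto simp: X_def)
  have mY: "Y \<in> spin_sites z \<rightarrow>\<^sub>M count_space ?\<Omega>"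
    unfolding measurable_count_space_eq_countable[OF cnt]
  proof (intro conjI ballI)
    show "Y -` {p} \<inter> space (spin_sites z) \<in> sets (spin_sites z)" if "p \<in> ?\<Omega>" for p
      using that sets_interior_spins[of a b] by (cases p) (auto simp only: preY spS Int_UNIV_right)
  qed (auto simp: Y_def)
  have law: "distr ?P (count_space ?\<Omega>) X = distr (spin_sites z) (count_space ?\<Omega>) Y"
  proof (rule measure_eqI_countable[OF _ _ cnt])
    fix p assume p: "p \<in> ?\<Omega>"
    then obtain \<nu> \<phi> where p': "p = (\<nu>, \<phi>)" by (cases p)
    have "emeasure (distr ?P (count_space ?\<Omega>) X) {p}
      = emeasure ?P ({n. \<forall>i\<in>?D. n i = \<nu> i} \<times> (coin_window a b \<nu> \<phi>))"
      using p preX[of \<nu> \<phi>] by (subst emeasure_distr[OF mX]) (auto simp only: p' spG Int_UNIV_right sets_count_space Pow_iff)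
    also have "\<dots> = emeasure (gibbs_chain z) {n. \<forall>i\<in>?D. n i = \<nu> i} * emeasure fair_coins (coin_window a b \<nu> \<phi>)"
      by (rule F.emeasure_pair_measure_Times) (use cyl flx in auto)
    also have "\<dots> = emeasure (spin_sites z) (window a b \<nu> \<phi>)"
      unfolding G.emeasure_eq_measure F.emeasure_eq_measure S.emeasure_eq_measure spins_given_stacks[OF z ab]
      by (simp add: ennreal_mult)
    also have "\<dots> = emeasure (distr (spin_sites z) (count_space ?\<Omega>) Y) {p}"
      using p preY[of \<nu> \<phi>] by (subst emeasure_distr[OF mY]) (auto simp only: p' spS Int_UNIV_right sets_count_space Pow_iff)
    finally show "emeasure (distr ?P (count_space ?\<Omega>) X) {p} = emeasure (distr (spin_sites z) (count_space ?\<Omega>) Y) {p}" .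
  qed auto
  define T where "T = {p \<in> ?\<Omega>. flow (fst p) (snd p) \<in> A}"
  have flow_res: "flow (restrict n ?D) (restrict \<phi> ?B) \<in> A \<longleftrightarrow> flow n \<phi> \<in> A" for n \<phi>
  proof -
    have "flow (restrict n ?D) (restrict \<phi> ?B) i = flow n \<phi> i" if "i \<in> {- int M..int M}" for i
      using that by (intro flow_cong) (auto simp: a_def b_def)
    then show ?thesis
      using A unfolding depends_on_def by blast
  qed
  have preXT: "X -` T = {(n, \<omega>). flow n (\<lambda>k. flux n \<omega> k = 1) \<in> A}"
    by (auto simp: X_def T_def flow_res)
  have preYT: "Y -` T = {(c, x). stacks (\<not> c) x \<in> A}"
    by (auto simp: Y_def T_def flow_res flow_stacks)
  have "emeasure (gibbs_chain z \<bind> ssm_kernel) A = (\<integral>\<^sup>+n. emeasure (ssm_kernel n) A \<partial>gibbs_chain z)"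
    by (rule emeasure_bind[OF _ K' Ab]) simp
  also have "\<dots> = (\<integral>\<^sup>+n. emeasure fair_coins (Pair n -` (X -` T)) \<partial>gibbs_chain z)"
  proof (rule nn_integral_cong_AE)
    have "AE n in gibbs_chain z. n \<in> Xe"
      by (rule AE_gibbs_chain_Xe)
    then show "AE n in gibbs_chain z. emeasure (ssm_kernel n) A = emeasure fair_coins (Pair n -` (X -` T))"
    proof eventually_elim
      case (elim n)
      have "ssm_step n \<in> fair_coins \<rightarrow>\<^sub>M borel"
        using measurable_compose[OF measurable_Pair1'[of n borel] measurable_ssm_step] by simp
      then have "emeasure (ssm_kernel n) A = emeasure fair_coins (ssm_step n -` A)"
        unfolding ssm_kernel_def using Ab by (subst emeasure_distr) auto
      then show ?case
        unfolding preXT by (simp add: vimage_def ssm_step_flow[OF elim])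
    qed
  qed
  also have "\<dots> = emeasure ?P (X -` T)"
    using measurable_sets[OF mX, of T] by (subst F.emeasure_pair_measure_alt) (auto simp: spG T_def)
  also have "\<dots> = emeasure (distr ?P (count_space ?\<Omega>) X) T"
    by (subst emeasure_distr[OF mX]) (auto simp: spG T_def)
  also have "\<dots> = emeasure (spin_sites z) (Y -` T)"
    unfolding law by (subst emeasure_distr[OF mY]) (auto simp: spS T_def)
  finally have "emeasure (gibbs_chain z \<bind> ssm_kernel) A = emeasure (spin_sites z) (Y -` T)" .
  then have "measure (gibbs_chain z \<bind> ssm_kernel) A = measure (spin_sites z) {(c, x). stacks (\<not> c) x \<in> A}"
    unfolding preYT by (simp add: measure_def)
  \<comment> \<open>Negating the coin merely exchanges the two terms of its average.\<close>
  also have "\<dots> = (?m {x. stacks False x \<in> A} + ?m {x. stacks True x \<in> A}) / 2"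
    by (subst measure_spin_sites) (auto intro!: sets_spin_sitesI sets_stacks[OF Ab])
  also have "\<dots> = measure (gibbs_chain z) A"
    by (simp add: measure_gibbs_chain(2)[OF Ab])
  finally show "measure (gibbs_chain z \<bind> ssm_kernel) A = measure (gibbs_chain z) A" .
qed (simp_all add: prob_space_gibbs_chain)

subsection \<open>The Gibbs limit for positive fugacity\<close>

abbreviation (input) zero_cost :: "nat \<Rightarrow> real"
  where "zero_cost \<equiv> \<lambda>n. if n = 0 then 2 * ln 2 else 0"

lemma card_ring_sites [simp]: "card (ring_sites L) = 2 * L + 1"
  by simp

lemma ring_next_bij: "bij_betw (ring_next L) (ring_sites L) (ring_sites L)"
  by (rule bij_betw_byWitness[where f' = "\<lambda>i. if i = - int L then int L else i - 1"]) (auto simp: ring_next_def)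

lemma ring_next_in: "i \<in> ring_sites L \<Longrightarrow> ring_next L i \<in> ring_sites L"
  by (auto simp: ring_next_def)

lemma ring_pair_ge:
  assumes "n \<in> ring_configs L" "i \<in> ring_sites L"
  shows "even (n i + n (ring_next L i)) \<and> 2 \<le> n i + n (ring_next L i)"
proof -
  have "even (n i)" "even (n (ring_next L i))" "\<not> (n i = 0 \<and> n (ring_next L i) = 0)"
    using assms ring_next_in[OF assms(2)] by (auto simp: ring_configs_def)
  then show ?thesis by (cases "n i = 0"; cases "n (ring_next L i) = 0") (auto elim!: evenE)
qed

lemma sum_ring_pairs: "(\<Sum>i\<in>ring_sites L. n i + n (ring_next L i)) = 2 * (\<Sum>i\<in>ring_sites L. n i :: nat)"
  using sum.reindex_bij_betw[OF ring_next_bij, of n L] by (simp add: sum.distrib)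

text \<open>Each of the \<open>2 * L + 1\<close> neighbouring pairs carries at least 2 particles and
  each site is in two pairs, so the total is at least \<open>2 * L + 1\<close>; being even, it is at
  least one more.\<close>

lemma ring_sum_ge:
  assumes "n \<in> ring_configs L"
  shows "2 * L + 2 \<le> (\<Sum>i\<in>ring_sites L. n i)"
proof -
  have "(\<Sum>i\<in>ring_sites L. 2) \<le> (\<Sum>i\<in>ring_sites L. n i + n (ring_next L i))"
    using ring_pair_ge[OF assms] by (intro sum_mono) auto
  then have "2 * L + 1 \<le> (\<Sum>i\<in>ring_sites L. n i)"
    by (simp add: sum_ring_pairs)
  moreover have "even (\<Sum>i\<in>ring_sites L. n i)"
    using assms by (intro dvd_sum) (auto simp: ring_configs_def)
  ultimately show ?thesis
    by (metis Suc_eq_plus1 add_2_eq_Suc' even_Suc even_mult_iff even_numeral le_antisym not_less_eq_eq)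
qed

lemma exp_zero_cost: "exp (- (\<Sum>i\<in>I. zero_cost (n i))) = (\<Prod>i\<in>I. if n i = 0 then 1 / 4 else 1)"
proof -
  have q: "exp (- (2 * ln 2)) = (1 / 4 :: real)"
  proof -
    have "- (2 * ln 2) = ln (1 / 4 :: real)"
      using ln_realpow[of 2 2] by (simp add: ln_div)
    then show ?thesis by simp
  qed
  show ?thesis
  proof (cases "finite I")
    case True
    have "exp (- (\<Sum>i\<in>I. zero_cost (n i))) = (\<Prod>i\<in>I. exp (- zero_cost (n i)))"
      using True by (simp add: exp_sum[symmetric] sum_negf)
    also have "\<dots> = (\<Prod>i\<in>I. if n i = 0 then 1 / 4 else 1)"
      by (intro prod.cong) (auto simp: q)
    finally show ?thesis .
  qed simp
qed

text \<open>The bonds left of \<open>- int L\<close> and right of \<open>int L\<close> become one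
  bond on the ring. Their spins must agree for the line to close up.\<close>

definition closed_spins :: "nat \<Rightarrow> (bool \<times> (int \<Rightarrow> bool \<times> nat)) set"
  where "closed_spins L = {(c, x). spin c x (- int L - 1) = spin c x (int L)}"

abbreviation (input) closed_stacks :: "config set \<Rightarrow> nat \<Rightarrow> (bool \<times> (int \<Rightarrow> bool \<times> nat)) set"
  where "closed_stacks A L \<equiv> {(c, x). stacks c x \<in> A \<and> (c, x) \<in> closed_spins L}"

lemma sets_closed_spins: "closed_spins L \<in> sets (spin_sites z)"
  unfolding closed_spins_def
proof (rule sets_spin_sitesI)
  fix b
  have "{x. spin b x (- int L - 1)} \<in> sets (sites z)" "{x. spin b x (int L)} \<in> sets (sites z)"
    using measurable_sets[OF measurable_spin_sites_spin, of "{True}" b "- int L - 1" z]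
      measurable_sets[OF measurable_spin_sites_spin, of "{True}" b "int L" z] by (simp_all add: vimage_def)
  then have "{x \<in> space (sites z). spin b x (- int L - 1) = spin b x (int L)} \<in> sets (sites z)"
    by measurable
  then show "{x. spin b x (- int L - 1) = spin b x (int L)} \<in> sets (sites z)" by simp
qed

text \<open>Only the seam is new: empty stacks at both of its ends would require opposite spins on
  the two identified bonds.\<close>

lemma stacks_closed_ring_configs:
  assumes "(c, x) \<in> closed_spins L"
  shows "restrict (stacks c x) (ring_sites L) \<in> ring_configs L"
proof -
  have ev: "even (stacks c x i)" and nz: "\<not> (stacks c x i = 0 \<and> stacks c x (i + 1) = 0)" for i
    using stacks_Xe[of c x] by (auto simp: Xe_def)
  have z: "stacks c x i = 0 \<Longrightarrow> spin c x (i - 1) \<and> \<not> spin c x i" for i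
    by (auto simp: stacks_def height_def split: if_splits)
  have "\<not> (stacks c x i = 0 \<and> stacks c x (ring_next L i) = 0)" if "i \<in> ring_sites L" for i
    using nz[of i] z[of "int L"] z[of "- int L"] assms by (auto simp: ring_next_def closed_spins_def)
  then show ?thesis
    using ev ring_next_in unfolding ring_configs_def by auto
qed

text \<open>Closing the ring cancels the boundary ratio, so every compatible spin pattern has the
  same weight and it remains to count them. An empty stack fixes the spins of its two bonds, and no
  bond touches two empty stacks; this gives \<open>2 ^ (2 * L + 1)\<close> patterns times 1/4 for
  each empty stack.\<close>

lemma prob_closed_ring:
  assumes z: "0 < z" "z < 1" and \<nu>: "\<nu> \<in> ring_configs L"
  shows "{p \<in> closed_spins L. (case p of (c, x) \<Rightarrow> restrict (stacks c x) (ring_sites L)) = \<nu>} \<in> sets (spin_sites z)"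
    and "measure (spin_sites z) {p \<in> closed_spins L. (case p of (c, x) \<Rightarrow> restrict (stacks c x) (ring_sites L)) = \<nu>}
      = (2 * (1 - z)) ^ (2 * L + 1) * z / 2 * gibbs_weight zero_cost z L \<nu>"
proof -
  let ?C = "\<lambda>k. {c. (\<nu> k = 0 \<longrightarrow> \<not> c) \<and> (\<nu> (ring_next L k) = 0 \<longrightarrow> c)}"
  interpret prob_space "spin_sites z" by (rule prob_space_spin_sites)
  let ?R = "ring_sites L"
  let ?S = "{(c, x). (c, x) \<in> closed_spins L \<and> (\<forall>i\<in>?R. stacks c x i = \<nu> i)}"
  have sp: "space (spin_sites z) = UNIV"
    by (simp add: spin_sites_def space_pair_measure)
  have ext: "\<nu> \<in> ?R \<rightarrow>\<^sub>E UNIV" and ev: "\<And>i. i \<in> ?R \<Longrightarrow> even (\<nu> i)"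
    and nz: "\<And>i. i \<in> ?R \<Longrightarrow> \<not> (\<nu> i = 0 \<and> \<nu> (ring_next L i) = 0)"
    using \<nu> by (auto simp: ring_configs_def)
  have "restrict f ?R = \<nu> \<longleftrightarrow> (\<forall>i\<in>?R. f i = \<nu> i)" for f
    using ext by (fastforce simp: fun_eq_iff PiE_iff extensional_def)
  then have S: "{p \<in> closed_spins L. (case p of (c, x) \<Rightarrow> restrict (stacks c x) ?R) = \<nu>} = ?S"
    by auto
  have mS: "?S \<in> events"
    using sets.Int[OF sets_closed_spins[of L z] sets_spin_sites_stacks[of ?R \<nu> z]]
    by (auto simp: Int_def split_beta' elim: back_subst[of "\<lambda>A. A \<in> events"])
  then show "{p \<in> closed_spins L. (case p of (c, x) \<Rightarrow> restrict (stacks c x) ?R) = \<nu>} \<in> events"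
    unfolding S .
  let ?K = "2 * L + 1"
  define s where "s = (\<Sum>i\<in>?R. \<nu> i)"
  define w where "w = (1 - z) ^ ?K * z ^ s / z ^ ?K / 2"
  define Q where "Q \<phi> \<longleftrightarrow> (\<forall>k\<in>?R. (\<nu> k = 0 \<longrightarrow> \<not> \<phi> k) \<and> (\<nu> (ring_next L k) = 0 \<longrightarrow> \<phi> k))" for \<phi> :: "int \<Rightarrow> bool"
  have fin: "finite (?R \<rightarrow>\<^sub>E (UNIV :: bool set))"
    by (intro finite_PiE) auto
  have "prob ?S = (\<Sum>\<phi>\<in>?R \<rightarrow>\<^sub>E UNIV. prob {p \<in> ?S. \<forall>k\<in>?R. (case p of (c, x) \<Rightarrow> spin c x k) = \<phi> k})"
    by (rule prob_sum_patterns[where g = "\<lambda>p k. case p of (c, x) \<Rightarrow> spin c x k"])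
      (use mS sets_spin_sites_spin[of _ z] in \<open>auto simp: sp split_beta'\<close>)
  also have "\<dots> = (\<Sum>\<phi>\<in>?R \<rightarrow>\<^sub>E UNIV. if Q \<phi> then w else 0)"
  proof (rule sum.cong[OF refl])
    fix \<phi> :: "int \<Rightarrow> bool"
    \<comment> \<open>\<open>\<eta>\<close> extends the ring spins to the extra bond
      \<open>- int L - 1\<close> by the value at the bond identified with it.\<close>
    define \<eta> where "\<eta> k = (if k = - int L - 1 then \<phi> (int L) else \<phi> k)" for k
    have dom: "{- int L - 1<..int L} = ?R" "{- int L - 1..int L} = insert (- int L - 1) ?R"
      by auto
    have "(\<forall>k\<in>{- int L - 1..int L}. spin c x k = \<eta> k) \<longleftrightarrow> (c, x) \<in> closed_spins L \<and> (\<forall>k\<in>?R. spin c x k = \<phi> k)" for c x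
    proof -
      have "(\<forall>k\<in>?R. spin c x k = \<eta> k) \<longleftrightarrow> (\<forall>k\<in>?R. spin c x k = \<phi> k)"
        by (auto simp: \<eta>_def)
      moreover have "int L \<in> ?R" by simp
      ultimately show ?thesis
        unfolding dom by (auto simp: closed_spins_def \<eta>_def)
    qed
    then have "{p \<in> ?S. \<forall>k\<in>?R. (case p of (c, x) \<Rightarrow> spin c x k) = \<phi> k}
        = {(c, x). (\<forall>i\<in>{- int L - 1<..int L}. stacks c x i = \<nu> i) \<and> (\<forall>k\<in>{- int L - 1..int L}. spin c x k = \<eta> k)}"
      unfolding dom(1) by auto
    then have "prob {p \<in> ?S. \<forall>k\<in>?R. (case p of (c, x) \<Rightarrow> spin c x k) = \<phi> k}
        = (\<Prod>i\<in>{- int L - 1<..int L}. site_weight z (\<eta> (i - 1)) (\<nu> i) (\<eta> i)) / 2"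
      using prob_spins_stacks(2)[OF z, of "- int L - 1" "int L" \<nu> \<eta>] by simp
    also have "(\<Prod>i\<in>{- int L - 1<..int L}. site_weight z (\<eta> (i - 1)) (\<nu> i) (\<eta> i))
      = (if \<forall>i\<in>?R. even (\<nu> i) \<and> (\<nu> i = 0 \<longrightarrow> \<eta> (i - 1) \<and> \<not> \<eta> i)
         then (\<Prod>i\<in>?R. (1 - z) * z ^ \<nu> i / z) * (spin_weight z (\<eta> (- int L - 1)) / spin_weight z (\<eta> (int L))) else 0)"
      using prod_site_weight[OF z(1), of "- int L - 1" "int L" \<eta> \<nu>] unfolding dom(1) by simp
    also have "(\<forall>i\<in>?R. even (\<nu> i) \<and> (\<nu> i = 0 \<longrightarrow> \<eta> (i - 1) \<and> \<not> \<eta> i)) \<longleftrightarrow> Q \<phi>"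
    proof -
      have "(\<forall>k\<in>?R. \<nu> (ring_next L k) = 0 \<longrightarrow> \<phi> k) \<longleftrightarrow> (\<forall>k\<in>?R. \<nu> (ring_next L k) = 0 \<longrightarrow> \<eta> (ring_next L k - 1))"
        by (intro ball_cong) (auto simp: ring_next_def \<eta>_def)
      also have "\<dots> \<longleftrightarrow> (\<forall>i\<in>ring_next L ` ?R. \<nu> i = 0 \<longrightarrow> \<eta> (i - 1))"
        by simp
      also have "ring_next L ` ?R = ?R"
        by (rule bij_betw_imp_surj_on[OF ring_next_bij])
      finally have 1: "(\<forall>k\<in>?R. \<nu> (ring_next L k) = 0 \<longrightarrow> \<phi> k) \<longleftrightarrow> (\<forall>i\<in>?R. \<nu> i = 0 \<longrightarrow> \<eta> (i - 1))" .
      have 2: "(\<forall>k\<in>?R. \<nu> k = 0 \<longrightarrow> \<not> \<phi> k) \<longleftrightarrow> (\<forall>k\<in>?R. \<nu> k = 0 \<longrightarrow> \<not> \<eta> k)"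
        by (intro ball_cong) (auto simp: \<eta>_def)
      show ?thesis
        using 1 2 ev unfolding Q_def by blast
    qed
    also have "spin_weight z (\<eta> (- int L - 1)) / spin_weight z (\<eta> (int L)) = 1"
      using z by (auto simp: \<eta>_def spin_weight_def)
    also have "(\<Prod>i\<in>?R. (1 - z) * z ^ \<nu> i / z) = w * 2"
      unfolding prod_dividef prod.distrib prod_constant card_ring_sites power_sum[symmetric] w_def s_def by simp
    also have "(if Q \<phi> then w * 2 * 1 else 0) / 2 = (if Q \<phi> then w else 0)"
      by simp
    finally show "prob {p \<in> ?S. \<forall>k\<in>?R. (case p of (c, x) \<Rightarrow> spin c x k) = \<phi> k} = (if Q \<phi> then w else 0)" .
  qed
  also have "\<dots> = w * real (card {\<phi> \<in> ?R \<rightarrow>\<^sub>E UNIV. Q \<phi>})"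
    by (simp add: sum.inter_filter[OF fin, symmetric])
  also have "{\<phi> \<in> ?R \<rightarrow>\<^sub>E UNIV. Q \<phi>} = PiE ?R ?C"
    unfolding Q_def by (intro set_eqI) (simp only: PiE_iff mem_Collect_eq UNIV_I, blast)
  also have "real (card (PiE ?R ?C))
      = (\<Prod>k\<in>?R. real (card (?C k)))"
    by (simp add: card_PiE)
  \<comment> \<open>Each empty end of a bond halves its two choices. Collected by sites, every empty
    stack is counted once from each side, which turns 1/2 into 1/4.\<close>
  also have "\<dots> = (\<Prod>k\<in>?R. 2 * ((if \<nu> k = 0 then 1 / 2 else 1) * (if \<nu> (ring_next L k) = 0 then 1 / 2 else 1)))"
  proof (rule prod.cong[OF refl])
    fix k assume "k \<in> ?R"
    have "?C k
      = (if \<nu> k = 0 then {False} else if \<nu> (ring_next L k) = 0 then {True} else UNIV)"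
      using nz[OF \<open>k \<in> ?R\<close>] by auto
    then show "real (card (?C k))
      = 2 * ((if \<nu> k = 0 then 1 / 2 else 1) * (if \<nu> (ring_next L k) = 0 then 1 / 2 else 1))"
      using nz[OF \<open>k \<in> ?R\<close>] by (auto simp: UNIV_bool)
  qed
  also have "\<dots> = 2 ^ ?K * ((\<Prod>k\<in>?R. if \<nu> k = 0 then 1 / 2 else 1) * (\<Prod>k\<in>?R. if \<nu> (ring_next L k) = 0 then 1 / 2 else 1))"
    unfolding prod.distrib prod_constant card_ring_sites ..
  also have "(\<Prod>k\<in>?R. if \<nu> (ring_next L k) = 0 then 1 / 2 else (1 :: real)) = (\<Prod>k\<in>?R. if \<nu> k = 0 then 1 / 2 else 1)"
    by (rule prod.reindex_bij_betw[OF ring_next_bij])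
  also have "(\<Prod>k\<in>?R. if \<nu> k = 0 then 1 / 2 else 1) * (\<Prod>k\<in>?R. if \<nu> k = 0 then 1 / 2 else 1) = (\<Prod>k\<in>?R. if \<nu> k = 0 then 1 / 4 else (1 :: real))"
    unfolding prod.distrib[symmetric] by (intro prod.cong) auto
  finally have "prob ?S = w * (2 ^ ?K * (\<Prod>k\<in>?R. if \<nu> k = 0 then 1 / 4 else 1))" .
  also have "\<dots> = (2 * (1 - z)) ^ ?K * z / 2 * gibbs_weight zero_cost z L \<nu>"
  proof -
    define t where "t = z ^ (s - (2 * L + 2))"
    have "2 * L + 2 \<le> s"
      using ring_sum_ge[OF \<nu>] by (simp add: s_def)
    then have "z ^ s = t * z ^ (2 * L + 2)"
      unfolding t_def by (simp only: power_add[symmetric] le_add_diff_inverse2)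
    also have "z ^ (2 * L + 2) = z * z ^ ?K"
      by simp
    finally have "w = (1 - z) ^ ?K * (t * z) / 2"
      using z by (simp add: w_def)
    moreover have "gibbs_weight zero_cost z L \<nu> = t * (\<Prod>k\<in>?R. if \<nu> k = 0 then 1 / 4 else 1)"
      unfolding gibbs_weight_def exp_zero_cost t_def s_def ..
    ultimately show ?thesis
      unfolding power_mult_distrib by simp
  qed
  finally show "prob {p \<in> closed_spins L. (case p of (c, x) \<Rightarrow> restrict (stacks c x) ?R) = \<nu>}
      = (2 * (1 - z)) ^ ?K * z / 2 * gibbs_weight zero_cost z L \<nu>"
    unfolding S .
qed

lemma countable_ring_configs: "countable (ring_configs L)"
proof -
  have "countable (ring_sites L \<rightarrow>\<^sub>E (UNIV :: nat set))"
    by (intro countable_PiE) auto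
  then show ?thesis
    by (rule countable_subset[rotated]) (auto simp: ring_configs_def)
qed

lemma gibbs_weight_nonneg: "0 \<le> z \<Longrightarrow> 0 \<le> gibbs_weight V z L n"
  by (simp add: gibbs_weight_def)

text \<open>Under the closing condition the stacks on the ring have probabilities
  \<open>\<kappa>\<close> times the Gibbs weights. As \<open>\<kappa>\<close> does not depend on the
  configuration, it cancels in the quotient.\<close>

lemma ring_gibbs_eq_conditional:
  assumes z: "0 < z" "z < 1" and W: "W \<subseteq> ring_sites L" "depends_on W A"
  shows "measure (ring_gibbs zero_cost z L) (A \<inter> ring_configs L)
    = measure (spin_sites z) (closed_stacks A L) / measure (spin_sites z) (closed_spins L)"
proof -
  interpret prob_space "spin_sites z" by (rule prob_space_spin_sites)
  let ?r = "\<lambda>p. case p of (c, x) \<Rightarrow> restrict (stacks c x) (ring_sites L)"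
  let ?g = "gibbs_weight zero_cost z L"
  define \<kappa> where "\<kappa> = (2 * (1 - z)) ^ (2 * L + 1) * z / 2"
  have \<kappa>: "0 < \<kappa>" using z by (simp add: \<kappa>_def)
  have g0: "0 \<le> ?g n" for n
    using z by (intro gibbs_weight_nonneg) simp
  have disc: "emeasure (spin_sites z) {p \<in> closed_spins L. ?r p \<in> B} = (\<integral>\<^sup>+\<nu>. ennreal (\<kappa> * ?g \<nu>) \<partial>count_space B)"
    if B: "B \<subseteq> ring_configs L" for B
  proof -
    have "{p \<in> closed_spins L. ?r p \<in> B} = (\<Union>\<nu>\<in>B. {p \<in> closed_spins L. ?r p = \<nu>})"
      by auto
    also have "emeasure (spin_sites z) \<dots> = (\<integral>\<^sup>+\<nu>. emeasure (spin_sites z) {p \<in> closed_spins L. ?r p = \<nu>} \<partial>count_space B)"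
      using B prob_closed_ring(1)[OF z] countable_subset[OF B countable_ring_configs]
      by (intro emeasure_UN_countable) (auto simp: disjoint_family_on_def)
    also have "\<dots> = (\<integral>\<^sup>+\<nu>. ennreal (\<kappa> * ?g \<nu>) \<partial>count_space B)"
      using B by (intro nn_integral_cong) (auto simp: emeasure_eq_measure prob_closed_ring(2)[OF z] \<kappa>_def)
    finally show ?thesis .
  qed
  have rA: "?r p \<in> A \<longleftrightarrow> (case p of (c, x) \<Rightarrow> stacks c x \<in> A)" for p
  proof (cases p)
    case (Pair c x)
    have "\<forall>i\<in>W. restrict (stacks c x) (ring_sites L) i = stacks c x i"
      using W(1) by auto
    then show ?thesis
      using W(2) unfolding depends_on_def Pair by simp
  qed
  have all: "{p \<in> closed_spins L. ?r p \<in> ring_configs L} = closed_spins L"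
    using stacks_closed_ring_configs by auto
  have onA: "{p \<in> closed_spins L. ?r p \<in> A \<inter> ring_configs L} = (closed_stacks A L)"
    using stacks_closed_ring_configs rA by auto
  define Z where "Z = partition_function zero_cost z L"
  have nn: "(\<integral>\<^sup>+\<nu>. ennreal (?g \<nu>) \<partial>count_space B) = ennreal (prob {p \<in> closed_spins L. ?r p \<in> B} / \<kappa>)"
    if "B \<subseteq> ring_configs L" for B
  proof -
    have "ennreal \<kappa> * (\<integral>\<^sup>+\<nu>. ennreal (?g \<nu>) \<partial>count_space B) = (\<integral>\<^sup>+\<nu>. ennreal (\<kappa> * ?g \<nu>) \<partial>count_space B)"
      using \<kappa> by (subst nn_integral_cmult[symmetric]) (auto simp: ennreal_mult' intro!: nn_integral_cong)
    also have "\<dots> = ennreal \<kappa> * ennreal (prob {p \<in> closed_spins L. ?r p \<in> B} / \<kappa>)"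
      unfolding disc[OF that, symmetric] emeasure_eq_measure using \<kappa> by (subst ennreal_mult[symmetric]) auto
    finally show ?thesis
      using \<kappa> by (simp add: ennreal_mult_cancel_left)
  qed
  \<comment> \<open>The weights sum to a finite total because it is a probability divided by
    \<open>\<kappa>\<close>. Absolute summability then lets the infinite sum be evaluated as an
    integral over counting measure.\<close>
  have Z: "Z = prob (closed_spins L) / \<kappa>"
  proof -
    have int: "integrable (count_space (ring_configs L)) ?g"
      using nn[OF subset_refl] g0 by (intro integrableI_nonneg) auto
    then have "Infinite_Set_Sum.abs_summable_on ?g (ring_configs L)"
      by (simp add: Infinite_Set_Sum.abs_summable_on_def)
    then have "Z = infsetsum ?g (ring_configs L)"
      unfolding Z_def partition_function_def by (rule infsetsum_infsum[symmetric])
    also have "\<dots> = enn2real (\<integral>\<^sup>+\<nu>. ennreal (?g \<nu>) \<partial>count_space (ring_configs L))"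
      unfolding infsetsum_def using g0 by (intro integral_eq_nn_integral) auto
    finally show ?thesis
      using \<kappa> unfolding nn[OF subset_refl] all by simp
  qed
  have "emeasure (ring_gibbs zero_cost z L) (A \<inter> ring_configs L)
      = (\<integral>\<^sup>+\<nu>. ennreal (?g \<nu> / Z) * indicator (A \<inter> ring_configs L) \<nu> \<partial>count_space (ring_configs L))"
    unfolding ring_gibbs_def point_measure_def Z_def by (subst emeasure_density) auto
  also have "\<dots> = (\<integral>\<^sup>+\<nu>. ennreal (1 / Z) * ennreal (?g \<nu>) \<partial>count_space (A \<inter> ring_configs L))"
  proof -
    have "0 \<le> Z" unfolding Z using \<kappa> by simp
    then show ?thesis
      by (subst nn_integral_count_space_indicator[of "A \<inter> ring_configs L"], simp, subst nn_integral_count_space_indicator[of "ring_configs L"], simp)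
        (auto intro!: nn_integral_cong simp: ennreal_mult'[symmetric] indicator_def g0)
  qed
  also have "\<dots> = ennreal (1 / Z) * (\<integral>\<^sup>+\<nu>. ennreal (?g \<nu>) \<partial>count_space (A \<inter> ring_configs L))"
    by (rule nn_integral_cmult) simp
  also have "\<dots> = ennreal (1 / Z * (prob {p \<in> closed_spins L. ?r p \<in> A \<inter> ring_configs L} / \<kappa>))"
    unfolding nn[OF Int_lower2] using \<kappa> by (intro ennreal_mult[symmetric]) (auto simp: Z)
  finally have "measure (ring_gibbs zero_cost z L) (A \<inter> ring_configs L) = 1 / Z * (prob {p \<in> closed_spins L. ?r p \<in> A \<inter> ring_configs L} / \<kappa>)"
    using \<kappa> by (simp add: measure_def Z)
  then show ?thesis
    unfolding onA Z using \<kappa> by simp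
qed

text \<open>The ring closes exactly when the parities of the flips inside and outside the window
  agree. The outer parity is independent of the window and tends to a fair coin, so the closing
  condition decouples and costs a factor 1/2.\<close>

lemma tendsto_prob_closed:
  assumes z: "0 < z" and A: "depends_on {a<..int M} A" and a: "a = - int M - 1"
  shows "(\<lambda>L. measure (spin_sites z) (closed_stacks A L)) \<longlonglongrightarrow> measure (gibbs_chain z) A / 2"
proof -
  let ?m = "measure (sites z)"
  let ?W = "{a<..int M}"
  define out where "out L = {- int L - 1<..a} \<union> {int M<..int L}" for L :: nat
  define \<beta> where "\<beta> c d = ?m {x. stacks_from a c x \<in> A \<and> parity ?W x = d}" for c d
  define \<pi> where "\<pi> L d = ?m {x. parity (out L) x = d}" for L d
  note det = determined_stacks_from[OF A]
  have mA: "{x. stacks_from a c x \<in> A} \<in> sets (sites z)" for c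
    by (rule sets_sites_finite[OF _ det]) simp
  have mP: "{x. parity J x} \<in> sets (sites z)" if "finite J" for J
    by (rule sets_sites_finite[OF that determined_parity])
  have fo: "finite (out L)" for L by (simp add: out_def)
  have val: "measure (spin_sites z) (closed_stacks A L) = (\<Sum>c\<in>UNIV. \<Sum>d\<in>UNIV. \<beta> c d * \<pi> L d) / 2"
    if L: "M \<le> L" for L
  proof -
    let ?R = "\<lambda>c x. stacks_from a c x \<in> A \<and> parity ?W x = parity (out L) x"
    have "(c, x) \<in> closed_spins L \<longleftrightarrow> parity ?W x = parity (out L) x" for c x
    proof -
      have "{- int L - 1<..int L} = ?W \<union> out L" "?W \<inter> out L = {}"
        using L by (auto simp: out_def a)
      then have "parity {- int L - 1<..int L} x \<longleftrightarrow> parity ?W x \<noteq> parity (out L) x"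
        using parity_Un[of ?W "out L" x] fo by simp
      then show ?thesis
        using spin_diff[of "- int L - 1" "int L" c x] by (auto simp: closed_spins_def)
    qed
    then have at: "measure (spin_sites z) (closed_stacks A L)
        = measure (spin_sites z) {(c, x). ?R (spin c x a) x}"
      by (simp add: stacks_eq_from[symmetric])
    have detR: "determined (?W \<union> out L) (?R c)" for c
      using determined_mono[OF det, of "?W \<union> out L" c] determined_mono[OF determined_parity, of ?W "?W \<union> out L"]
        determined_mono[OF determined_parity, of "out L" "?W \<union> out L"] unfolding determined_def by (simp, metis)
    then have mR: "{x. ?R c x} \<in> sets (sites z)" for c
      by (rule sets_sites_finite[rotated]) (use fo in simp)
    note at
    also have "measure (spin_sites z) {(c, x). ?R (spin c x a) x} = (?m {x. ?R True x} + ?m {x. ?R False x}) / 2"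
      by (rule measure_spin_at[OF mR])
    finally have sum: "measure (spin_sites z) (closed_stacks A L)
      = (?m {x. ?R True x} + ?m {x. ?R False x}) / 2" .
    have "?m {x. ?R c x} = (\<Sum>d\<in>UNIV. \<beta> c d * \<pi> L d)" for c
    proof -
      have "?m {x. ?R c x} = (\<Sum>d\<in>UNIV. ?m {x. ?R c x \<and> parity ?W x = d})"
        by (rule prob_sites_split[OF mR mP]) simp
      also have "\<dots> = (\<Sum>d\<in>UNIV. \<beta> c d * \<pi> L d)"
      proof (rule sum.cong[OF refl])
        fix d
        have "{x. ?R c x \<and> parity ?W x = d} = {x. (stacks_from a c x \<in> A \<and> parity ?W x = d) \<and> parity (out L) x = d}"
          by auto
        also have "?m \<dots> = \<beta> c d * \<pi> L d"
          unfolding \<beta>_def \<pi>_def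
          by (intro prob_indep_blocks[of ?W _ "out L"] determined_conj determined_eq det determined_parity)
            (use L in \<open>auto simp: out_def a\<close>)
        finally show "?m {x. ?R c x \<and> parity ?W x = d} = \<beta> c d * \<pi> L d" .
      qed
      finally show ?thesis .
    qed
    then show ?thesis unfolding sum by (simp add: UNIV_bool add.commute)
  qed
  have \<beta>: "(\<Sum>d\<in>UNIV. \<beta> c d) = ?m {x. stacks_from a c x \<in> A}" for c
    unfolding \<beta>_def by (rule prob_sites_split[symmetric, OF mA mP]) simp
  have "(\<lambda>L. \<pi> L d) \<longlonglongrightarrow> 1 / 2" for d
    unfolding \<pi>_def
  proof (rule tendsto_prob_parity[OF z fo])
    show "filterlim (\<lambda>L. card (out L)) at_top sequentially"
    proof (rule filterlim_at_top_mono)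
      have "L - M \<le> card (out L)" for L
      proof -
        have "card {int M<..int L} \<le> card (out L)"
          using fo by (intro card_mono) (auto simp: out_def)
        then show ?thesis by simp
      qed
      then show "\<forall>\<^sub>F L in sequentially. L - M \<le> card (out L)"
        by simp
    qed (rule filterlim_minus_const_nat_at_top)
  qed
  then have "(\<lambda>L. (\<Sum>c\<in>UNIV. \<Sum>d\<in>UNIV. \<beta> c d * \<pi> L d) / 2) \<longlonglongrightarrow> (\<Sum>c\<in>UNIV. \<Sum>d\<in>UNIV. \<beta> c d * (1 / 2)) / 2"
    by (intro tendsto_intros) auto
  also have "(\<Sum>c\<in>UNIV. \<Sum>d\<in>UNIV. \<beta> c d * (1 / 2)) / 2 = measure (gibbs_chain z) A / 2"
    unfolding measure_gibbs_chain_from[OF A] sum_distrib_right[symmetric] \<beta> by (simp add: UNIV_bool)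
  finally show ?thesis
  proof (rule Lim_transform_eventually)
    show "\<forall>\<^sub>F L in sequentially. (\<Sum>c\<in>UNIV. \<Sum>d\<in>UNIV. \<beta> c d * \<pi> L d) / 2
        = measure (spin_sites z) (closed_stacks A L)"
      using eventually_ge_at_top[of M] by eventually_elim (rule val[symmetric])
  qed
qed

lemma gibbs_state_gibbs_chain:
  assumes z: "0 < z" "z < 1"
  shows "gibbs_state zero_cost z (gibbs_chain z)"
  unfolding gibbs_state_def
proof (intro conjI allI impI)
  show "state_on Xe (gibbs_chain z)"
    unfolding state_on_def by (simp add: prob_space_gibbs_chain AE_gibbs_chain_Xe)
  fix W :: "int set" and A assume W: "finite W" and A: "depends_on W A"
  obtain M :: nat where M: "W \<subseteq> {- int M..int M}"
    using finite_subset_symmetric_interval[OF W] .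
  define a where "a = - int M - 1"
  have A': "depends_on {a<..int M} A"
    by (rule depends_on_mono[OF A]) (use M in \<open>auto simp: a_def\<close>)
  have U: "depends_on {a<..int M} UNIV"
    by (simp add: depends_on_def)
  interpret G: prob_space "gibbs_chain z" by (rule prob_space_gibbs_chain)
  \<comment> \<open>The case of the whole space supplies the normalisation, whose factor 1/2 cancels
    the one in the numerator.\<close>
  have "(\<lambda>L. measure (spin_sites z) (closed_spins L)) \<longlonglongrightarrow> 1 / 2"
    using tendsto_prob_closed[OF z(1) U a_def] G.prob_space by simp
  from tendsto_divide[OF tendsto_prob_closed[OF z(1) A' a_def] this]
  have "(\<lambda>L. measure (spin_sites z) (closed_stacks A L) / measure (spin_sites z) (closed_spins L))
      \<longlonglongrightarrow> measure (gibbs_chain z) A"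
    by simp
  moreover have "\<forall>\<^sub>F L in sequentially. measure (spin_sites z) (closed_stacks A L) / measure (spin_sites z) (closed_spins L)
      = measure (ring_gibbs zero_cost z L) (A \<inter> ring_configs L)"
    using eventually_ge_at_top[of M]
  proof eventually_elim
    case (elim L)
    have "W \<subseteq> ring_sites L"
      using M elim by auto
    then show ?case
      by (rule ring_gibbs_eq_conditional[OF z _ A, symmetric])
  qed
  ultimately show "(\<lambda>L. measure (ring_gibbs zero_cost z L) (A \<inter> ring_configs L)) \<longlonglongrightarrow> measure (gibbs_chain z) A"
    by (rule Lim_transform_eventually)
qed

subsection \<open>Density one\<close>

definition checkerboard :: "bool \<Rightarrow> config"
  where "checkerboard c = (\<lambda>i. if even i = c then 2 else 0)"

lemma checkerboard_neq: "checkerboard True \<noteq> checkerboard False"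
  by (auto simp: checkerboard_def fun_eq_iff intro!: exI[of _ 0])

lemma mu_hat2_checkerboard: "mu_hat2 = distr (measure_pmf (pmf_of_set {checkerboard False, checkerboard True})) borel (\<lambda>n. n)"
proof -
  have "checkerboard False = (\<lambda>i. if even i then 0 else 2)" "checkerboard True = (\<lambda>i. if even i then 2 else 0)"
    by (auto simp: checkerboard_def)
  then show ?thesis by (simp only: mu_hat2_def)
qed

lemma measure_mu_hat2:
  assumes "A \<in> sets borel"
  shows "measure mu_hat2 A = (of_bool (checkerboard False \<in> A) + of_bool (checkerboard True \<in> A)) / 2"
proof -
  have "measure mu_hat2 A = measure_pmf.prob (pmf_of_set {checkerboard False, checkerboard True}) A"
    unfolding mu_hat2_checkerboard using assms by (subst measure_distr) auto
  also have "\<dots> = real (card ({checkerboard False, checkerboard True} \<inter> A)) / 2"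
    using checkerboard_neq by (subst measure_pmf_of_set) auto
  also have "card ({checkerboard False, checkerboard True} \<inter> A) = of_bool (checkerboard False \<in> A) + of_bool (checkerboard True \<in> A)"
    using checkerboard_neq by (auto simp: Int_insert_left)
  finally show ?thesis by simp
qed

lemma sets_mu_hat2 [simp, measurable_cong]: "sets mu_hat2 = sets borel"
  by (simp add: mu_hat2_def)

lemma space_mu_hat2 [simp]: "space mu_hat2 = UNIV"
  by (simp add: mu_hat2_def)

lemma prob_space_mu_hat2: "prob_space mu_hat2"
  unfolding mu_hat2_def by (rule prob_space.prob_space_distr[OF prob_space_measure_pmf]) simp

lemma singleton_config_borel: "{n :: config} \<in> sets borel"
proof -
  have "{n} = (\<Inter>i. {m. m i = n i})"
    by (auto simp: fun_eq_iff)
  also have "\<dots> \<in> sets borel"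
    by (intro sets.countable_INT' sets_depends_on[where W = "{_}"]) (auto simp: depends_on_def)
  finally show ?thesis .
qed

lemma AE_mu_hat2:
  assumes "\<And>c. P (checkerboard c)"
  shows "AE n in mu_hat2. P n"
proof -
  interpret prob_space mu_hat2 by (rule prob_space_mu_hat2)
  let ?C = "{checkerboard False, checkerboard True}"
  have C: "?C \<in> sets borel"
    using sets.Un[OF singleton_config_borel[of "checkerboard False"] singleton_config_borel[of "checkerboard True"]] by (simp add: insert_commute)
  have "prob ?C = 1"
    using C by (simp add: measure_mu_hat2)
  then have "AE n in mu_hat2. n \<in> ?C"
    using C by (subst prob_eq_1[symmetric]) simp_all
  then show ?thesis
    by eventually_elim (use assms in auto)
qed

lemma shift_checkerboard: "shift (checkerboard c) = checkerboard (\<not> c)"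
  by (auto simp: shift_def checkerboard_def)

text \<open>Every bond joins a short and a tall stack, so the step is deterministic and exchanges
  the two sublattices.\<close>

lemma ssm_step_checkerboard: "ssm_step (checkerboard c) \<omega> = shift (checkerboard c)"
proof
  fix i
  show "ssm_step (checkerboard c) \<omega> i = shift (checkerboard c) i"
    unfolding ssm_step_def flux_def shift_def checkerboard_def short_def by (cases "even i"; cases c) simp_all
qed

lemma translation_invariant_mu_hat2: "translation_invariant mu_hat2"
  unfolding translation_invariant_def
proof (rule config_measure_eqI)
  interpret prob_space mu_hat2 by (rule prob_space_mu_hat2)
  show "prob_space (distr mu_hat2 borel shift)"
    by (rule prob_space_distr) measurable
  fix A assume "A \<in> cylinders"
  then have A: "A \<in> sets borel" by (rule cylinders_sets)
  have "shift -` A \<in> sets borel"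
    using measurable_sets[OF measurable_shift A] by simp
  then show "measure (distr mu_hat2 borel shift) A = measure mu_hat2 A"
    using A by (subst measure_distr) (auto simp: measure_mu_hat2 shift_checkerboard)
qed (simp_all add: prob_space_mu_hat2)

text \<open>On the support a time step acts as the shift, so stationarity is reduced to translation
  invariance.\<close>

lemma stationary_mu_hat2: "stationary mu_hat2"
  unfolding stationary_def
proof (rule config_measure_eqI)
  interpret F: prob_space fair_coins by (rule prob_space_fair_coins)
  have K: "ssm_kernel \<in> mu_hat2 \<rightarrow>\<^sub>M prob_algebra borel"
    using measurable_ssm_kernel by (simp cong: measurable_cong_sets)
  have K': "ssm_kernel \<in> mu_hat2 \<rightarrow>\<^sub>M subprob_algebra borel"
    by (rule measurable_prob_algebraD[OF K])
  show "prob_space (mu_hat2 \<bind> ssm_kernel)"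
    by (rule prob_space_bind'[OF _ K]) (simp add: space_prob_algebra prob_space_mu_hat2)
  show "sets (mu_hat2 \<bind> ssm_kernel) = sets borel"
    by (rule sets_bind[OF sets_kernel[OF K']]) simp_all
  fix A assume "A \<in> cylinders"
  then have A: "A \<in> sets borel" by (rule cylinders_sets)
  have sA: "shift -` A \<in> sets borel"
    using measurable_sets[OF measurable_shift A] by simp
  have "emeasure (mu_hat2 \<bind> ssm_kernel) A = (\<integral>\<^sup>+n. emeasure (ssm_kernel n) A \<partial>mu_hat2)"
    by (rule emeasure_bind[OF _ K' A]) simp
  also have "\<dots> = (\<integral>\<^sup>+n. indicator (shift -` A) n \<partial>mu_hat2)"
  proof (rule nn_integral_cong_AE, rule AE_mu_hat2)
    fix c
    have "ssm_kernel (checkerboard c) = return borel (shift (checkerboard c))"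
      unfolding ssm_kernel_def ssm_step_checkerboard[abs_def] by (rule F.distr_const) simp
    then show "emeasure (ssm_kernel (checkerboard c)) A = indicator (shift -` A) (checkerboard c)"
      using A by (simp add: indicator_def)
  qed
  also have "\<dots> = emeasure mu_hat2 (shift -` A)"
    using sA by simp
  finally show "measure (mu_hat2 \<bind> ssm_kernel) A = measure mu_hat2 A"
    using measure_shift_power[OF translation_invariant_mu_hat2 _ A, of 1] by (simp add: measure_def)
qed (simp_all add: prob_space_mu_hat2)

lemma state_on_mu_hat2: "state_on Xe mu_hat2"
proof -
  have "checkerboard c \<in> Xe" for c
    by (cases c) (auto simp: Xe_def checkerboard_def)
  then show ?thesis
    unfolding state_on_def by (simp add: prob_space_mu_hat2 AE_mu_hat2)
qed

text \<open>A dominated state lives on the same two configurations. The shift exchanges them, so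
  invariance forces equal weights.\<close>

lemma ETIS_mu_hat2: "ETIS Xe mu_hat2"
proof (rule ETISI)
  show "TIS Xe mu_hat2"
    unfolding TIS_def using state_on_mu_hat2 translation_invariant_mu_hat2 stationary_mu_hat2 by simp
  fix \<nu> assume "TIS Xe \<nu>" and ac: "absolutely_continuous mu_hat2 \<nu>"
  then have "prob_space \<nu>" and sets: "sets \<nu> = sets borel" and ti: "translation_invariant \<nu>"
    by (auto simp: TIS_def state_on_def)
  interpret prob_space \<nu> by fact
  let ?p = "checkerboard False" and ?q = "checkerboard True"
  have sp: "space \<nu> = UNIV"
    using sets_eq_imp_space_eq[OF sets] by simp
  have "shift n = ?p \<longleftrightarrow> n = ?q" for n
  proof
    assume "shift n = ?p"
    then have "n (i - 1 + 1) = ?p (i - 1)" for i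
      by (metis shift_def)
    then show "n = ?q" by (auto simp: fun_eq_iff checkerboard_def)
  qed (simp add: shift_checkerboard)
  then have "(shift ^^ 1) -` {?p} = {?q}" by auto
  then have eq: "prob {?p} = prob {?q}"
    using measure_shift_power[OF ti sets singleton_config_borel, of 1 ?p] by simp
  have C: "{?p, ?q} \<in> events"
    using sets.Un[OF singleton_config_borel[of ?p] singleton_config_borel[of ?q]] sets by (simp add: insert_commute)
  have "AE n in mu_hat2. n \<in> {?p, ?q}"
    by (rule AE_mu_hat2) (metis (full_types) insertI1 insertI2)
  then have ae: "AE n in \<nu>. n \<in> {?p, ?q}"
    using absolutely_continuous_AE[of \<nu> mu_hat2] ac sets by simp
  then have "prob {?p, ?q} = 1"
    using C by (subst prob_eq_1) simp_all
  moreover have "prob {?p, ?q} = prob {?p} + prob {?q}"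
    using finite_measure_Union[of "{?p}" "{?q}"] singleton_config_borel sets checkerboard_neq by (auto simp: insert_commute)
  ultimately have half: "prob {?p} = 1 / 2" "prob {?q} = 1 / 2"
    using eq by auto
  show "\<nu> = mu_hat2"
  proof (rule config_measure_eqI)
    fix A assume "A \<in> cylinders"
    then have A: "A \<in> sets borel" by (rule cylinders_sets)
    have "prob A = prob (A \<inter> {?p, ?q})"
      by (rule finite_measure_eq_AE) (use ae A C sets in auto)
    also have "\<dots> = (of_bool (?p \<in> A) + of_bool (?q \<in> A)) / 2"
      using half \<open>prob {?p, ?q} = 1\<close> by (cases "?p \<in> A"; cases "?q \<in> A") (simp_all add: Int_insert_right)
    finally show "prob A = measure mu_hat2 A"
      by (simp add: measure_mu_hat2[OF A])
  qed (simp_all add: \<open>prob_space \<nu>\<close> prob_space_mu_hat2 sets)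
qed

lemma ergodic_mu_hat2: "ergodic mu_hat2"
  unfolding ergodic_def
proof (intro ballI impI)
  fix A :: "config set" assume A: "A \<in> sets borel" "shift -` A = A"
  then have "checkerboard False \<in> A \<longleftrightarrow> checkerboard True \<in> A"
    using shift_checkerboard[of False] by (metis (full_types) vimageE vimageI2)
  then show "measure mu_hat2 A = 0 \<or> measure mu_hat2 A = 1"
    by (auto simp: measure_mu_hat2[OF A(1)])
qed

text \<open>For one of the two configurations the joint probability alternates between 1/2 and 0
  while the product is 1/4, so the absolute deviation is always 1/4.\<close>

lemma not_weakly_mixing_mu_hat2: "\<not> weakly_mixing mu_hat2"
proof
  assume wm: "weakly_mixing mu_hat2"
  let ?p = "checkerboard False"
  have P: "{?p} \<in> sets borel" by (rule singleton_config_borel)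
  have c: "\<bar>measure mu_hat2 ((shift ^^ k) -` {?p} \<inter> {?p}) - measure mu_hat2 {?p} * measure mu_hat2 {?p}\<bar> = 1 / 4" for k
  proof -
    have "(shift ^^ k) ?p = checkerboard (odd k)"
      by (induction k) (simp_all add: shift_checkerboard)
    then have "(shift ^^ k) -` {?p} \<inter> {?p} = (if even k then {?p} else {})"
      using checkerboard_neq by auto
    then show ?thesis
      using P checkerboard_neq by (auto simp: measure_mu_hat2)
  qed
  have "(\<lambda>N. (\<Sum>k<N. \<bar>measure mu_hat2 ((shift ^^ k) -` {?p} \<inter> {?p}) - measure mu_hat2 {?p} * measure mu_hat2 {?p}\<bar>) / real N) \<longlonglongrightarrow> 0"
    using wm P unfolding weakly_mixing_def by blast
  then have "(\<lambda>N. (\<Sum>k<N. 1 / 4) / real N) \<longlonglongrightarrow> (0 :: real)"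
    unfolding c .
  moreover have "\<forall>\<^sub>F N in sequentially. (\<Sum>k<N. 1 / 4) / real N = (1 / 4 :: real)"
    using eventually_gt_at_top[of 0] by eventually_elim simp
  ultimately have "(\<lambda>N::nat. 1 / 4 :: real) \<longlonglongrightarrow> 0"
    by (rule Lim_transform_eventually)
  then show False
    by (simp add: LIMSEQ_const_iff)
qed

lemma checkerboard_pair: "real (checkerboard c i) + real (checkerboard c (i + 1)) = 2"
  by (cases "even i"; cases c; simp add: checkerboard_def)

lemma has_density_mu_hat2: "has_density mu_hat2 1"
  unfolding has_density_def
proof (rule AE_mu_hat2)
  fix c
  \<comment> \<open>Neighbouring heights add up to 2, so the sum deviates from \<open>N\<close> only
    by half a difference of boundary heights, at most 1.\<close>
  have "(\<Sum>i = a + 1..a + int N. real (checkerboard c i)) = real N + (real (checkerboard c (a + 1)) - real (checkerboard c (a + int N + 1))) / 2" for a N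
  proof (induction N)
    case (Suc N)
    have "{a + 1..a + int (Suc N)} = insert (a + int (Suc N)) {a + 1..a + int N}" by auto
    then have "(\<Sum>i = a + 1..a + int (Suc N). real (checkerboard c i))
        = real (checkerboard c (a + int N + 1)) + (\<Sum>i = a + 1..a + int N. real (checkerboard c i))"
      by (simp add: algebra_simps)
    moreover have "real (checkerboard c (a + int N + 1)) + real (checkerboard c (a + int N + 1 + 1)) = 2"
      by (rule checkerboard_pair)
    moreover have "a + int (Suc N) + 1 = a + int N + 1 + 1"
      by simp
    ultimately show ?case
      using Suc unfolding of_nat_Suc by (simp only:) (simp add: field_simps)
  qed simp
  then have bd: "\<bar>(\<Sum>i = a + 1..a + int N. real (checkerboard c i)) - real N\<bar> \<le> 1" for a N
    by (simp add: checkerboard_def)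
  have N: "(\<lambda>N. real N / real N) \<longlonglongrightarrow> 1"
    by (rule tendsto_eventually) (use eventually_gt_at_top[of 0] in \<open>eventually_elim, simp\<close>)
  show "(\<lambda>N. (\<Sum>i = 1..int N. real (checkerboard c i)) / real N) \<longlonglongrightarrow> 1 \<and>
    (\<lambda>N. (\<Sum>i = - int N..- 1. real (checkerboard c i)) / real N) \<longlonglongrightarrow> 1"
  proof
    show "(\<lambda>N. (\<Sum>i = 1..int N. real (checkerboard c i)) / real N) \<longlonglongrightarrow> 1"
      by (rule tendsto_average_bounded_perturbation[OF N]) (use bd[of 0] in simp)
    show "(\<lambda>N. (\<Sum>i = - int N..- 1. real (checkerboard c i)) / real N) \<longlonglongrightarrow> 1"
    proof (rule tendsto_average_bounded_perturbation[OF N])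
      show "\<bar>(\<Sum>i = - int N..- 1. real (checkerboard c i)) - real N\<bar> \<le> 1" for N
        using bd[of "- 1 - int N" N] by simp
    qed
  qed
qed

text \<open>At zero fugacity the ring measure is uniform on the configurations of least mass. Such a
  configuration alternates between \<open>0\<close> and \<open>2\<close> except for one pair of neighbours \<open>j\<close> and
  \<open>ring_next L j\<close> that both have height \<open>2\<close>.\<close>

definition ground_state :: "nat \<Rightarrow> int \<Rightarrow> config"
  where "ground_state L j = restrict (\<lambda>i. if even (j - i) = (i \<le> j) then 2 else 0) (ring_sites L)"

lemma ground_state_pair:
  assumes "j \<in> ring_sites L" "i \<in> ring_sites L"
  shows "ground_state L j i + ground_state L j (ring_next L i) = (if i = j then 4 else 2)"
proof (cases "i = int L")
  case True
  then show ?thesis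
    using assms by (auto simp: ground_state_def ring_next_def)
next
  case False
  then have "i + 1 \<in> ring_sites L" "ring_next L i = i + 1"
    using assms by (auto simp: ring_next_def)
  then show ?thesis
    using assms(2) by (auto simp: ground_state_def)
qed

text \<open>At least mass the pair sums exceed 2 by a total of just 2. As excesses are even, a
  single pair \<open>j\<close> carries it all. The pair sums then determine the configuration,
  because the ring has odd length.\<close>

lemma ground_states:
  "{n \<in> ring_configs L. (\<Sum>i\<in>ring_sites L. n i) = 2 * L + 2} = ground_state L ` ring_sites L"
proof (intro set_eqI iffI)
  fix n assume "n \<in> ground_state L ` ring_sites L"
  then obtain j where j: "j \<in> ring_sites L" and n: "n = ground_state L j" by auto
  have "n \<in> ring_configs L"
    unfolding ring_configs_def
  proof (intro CollectI conjI ballI)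
    show "n \<in> ring_sites L \<rightarrow>\<^sub>E UNIV" by (simp add: n ground_state_def)
    fix i assume i: "i \<in> ring_sites L"
    show "even (n i)" using i by (simp add: n ground_state_def)
    show "\<not> (n i = 0 \<and> n (ring_next L i) = 0)"
      using ground_state_pair[OF j i] by (auto simp: n split: if_splits)
  qed
  moreover have "2 * (\<Sum>i\<in>ring_sites L. n i) = (\<Sum>i\<in>ring_sites L. 2 + (if i = j then 2 else 0))"
    unfolding sum_ring_pairs[symmetric] n using ground_state_pair[OF j] by (intro sum.cong) auto
  then have "2 * (\<Sum>i\<in>ring_sites L. n i) = 2 * (2 * L + 2)"
    unfolding sum.distrib sum_constant card_ring_sites using j by simp
  ultimately show "n \<in> {n \<in> ring_configs L. (\<Sum>i\<in>ring_sites L. n i) = 2 * L + 2}"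
    by simp
next
  fix n assume "n \<in> {n \<in> ring_configs L. (\<Sum>i\<in>ring_sites L. n i) = 2 * L + 2}"
  then have n: "n \<in> ring_configs L" and S: "(\<Sum>i\<in>ring_sites L. n i) = 2 * L + 2" by auto
  \<comment> \<open>The excess of a pair over the minimum 2. The pair sums total
    \<open>2 * (2 * L + 2)\<close>, against a minimum of \<open>2 * (2 * L + 1)\<close>.\<close>
  define e where "e i = n i + n (ring_next L i) - 2" for i
  have e: "n i + n (ring_next L i) = e i + 2" "even (e i)" if "i \<in> ring_sites L" for i
    using ring_pair_ge[OF n that] by (auto simp: e_def)
  have "(\<Sum>i\<in>ring_sites L. e i + 2) = (\<Sum>i\<in>ring_sites L. n i + n (ring_next L i))"
    by (rule sum.cong[OF refl e(1)[symmetric]])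
  also have "\<dots> = 2 * (2 * L + 2)"
    unfolding sum_ring_pairs S ..
  finally have "(\<Sum>i\<in>ring_sites L. e i + 2) = 2 * (2 * L + 2)" .
  then have se: "(\<Sum>i\<in>ring_sites L. e i) = 2"
    unfolding sum.distrib sum_constant card_ring_sites by simp
  have "\<not> (\<forall>j\<in>ring_sites L. e j = 0)"
    using se sum.neutral[of "ring_sites L" e] by linarith
  then obtain j where j: "j \<in> ring_sites L" "e j \<noteq> 0" by blast
  have "e j + (\<Sum>i\<in>ring_sites L - {j}. e i) = 2"
    using se sum.remove[OF _ j(1), of e] by simp
  moreover have "2 \<le> e j"
    using j e(2)[OF j(1)] by (auto elim!: evenE)
  ultimately have ej: "e j = 2" and e0: "(\<Sum>i\<in>ring_sites L - {j}. e i) = 0"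
    by linarith+
  have pair: "n i + n (ring_next L i) = ground_state L j i + ground_state L j (ring_next L i)" if "i \<in> ring_sites L" for i
    using e(1)[OF that] ground_state_pair[OF j(1) that] ej e0 that by auto
  \<comment> \<open>Equal pair sums make the difference change sign from each site to the next.
    Going once around an odd ring gives \<open>d = - d\<close>, hence 0.\<close>
  define d where "d i = int (n i) - int (ground_state L j i)" for i
  have d: "d (ring_next L i) = - d i" if "i \<in> ring_sites L" for i
    using pair[OF that] by (simp add: d_def)
  have dk: "k \<le> 2 * L \<longrightarrow> d (- int L + int k) = (- 1) ^ k * d (- int L)" for k
  proof (induction k)
    case (Suc k)
    show ?case
    proof
      assume k: "Suc k \<le> 2 * L"
      then have "ring_next L (- int L + int k) = - int L + int (Suc k)"
        by (auto simp: ring_next_def)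
      then show "d (- int L + int (Suc k)) = (- 1) ^ Suc k * d (- int L)"
        using d[of "- int L + int k"] Suc k by simp
    qed
  qed simp
  have "d (int L) = d (- int L)"
    using dk[of "2 * L"] by simp
  moreover have "d (- int L) = - d (int L)"
    using d[of "int L"] by (simp add: ring_next_def)
  ultimately have 0: "d (- int L) = 0" by simp
  have "n = ground_state L j"
  proof
    fix i
    show "n i = ground_state L j i"
    proof (cases "i \<in> ring_sites L")
      case True
      then have "d i = 0"
        using dk[of "nat (i + int L)"] 0 by auto
      then show ?thesis by (simp add: d_def)
    next
      case False
      have "n \<in> ring_sites L \<rightarrow>\<^sub>E UNIV"
        using n unfolding ring_configs_def by blast
      from PiE_arb[OF this False] show ?thesis
        unfolding ground_state_def restrict_def by (simp only: False if_False)
    qed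
  qed
  then show "n \<in> ground_state L ` ring_sites L" using j by simp
qed

lemma inj_ground_state: "inj_on (ground_state L) (ring_sites L)"
proof (rule inj_onI)
  fix j k assume jk: "j \<in> ring_sites L" "k \<in> ring_sites L" "ground_state L j = ground_state L k"
  show "j = k"
  proof -
    have "ground_state L j j + ground_state L j (ring_next L j) = 4"
      by (simp only: ground_state_pair[OF jk(1) jk(1)] simp_thms if_True)
    then have "(if j = k then 4 else 2) = (4 :: nat)"
      unfolding jk(3) ground_state_pair[OF jk(2) jk(1)] .
    then show "j = k" by (simp split: if_splits)
  qed
qed

text \<open>All ground states have exactly \<open>L\<close> empty stacks, hence the same weight. Any
  other ring configuration carries a positive power of the fugacity 0 and drops out.\<close>

lemma ring_gibbs_zero:
  "measure (ring_gibbs zero_cost 0 L) (A \<inter> ring_configs L) = real (card {j \<in> ring_sites L. ground_state L j \<in> A}) / real (2 * L + 1)"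
proof -
  let ?g = "gibbs_weight zero_cost 0 L" and ?G = "ground_state L ` ring_sites L"
  define w where "w = (1 / 4 :: real) ^ L"
  have g: "?g n = (if n \<in> ?G then w else 0)" if n: "n \<in> ring_configs L" for n
  proof (cases "n \<in> ?G")
    case True
    then obtain j where j: "j \<in> ring_sites L" "n = ground_state L j" by auto
    have S: "(\<Sum>i\<in>ring_sites L. n i) = 2 * L + 2"
      using True ground_states[of L] by auto
    have v: "n i = 0 \<or> n i = 2" if "i \<in> ring_sites L" for i
      using that by (simp add: j(2) ground_state_def)
    \<comment> \<open>Filling each empty stack with 2 particles makes all heights 2; comparing
      masses yields the number of empty stacks.\<close>
    have "(\<Sum>i\<in>ring_sites L. n i + (if n i = 0 then 2 else 0)) = (\<Sum>i\<in>ring_sites L. 2)"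
    proof (rule sum.cong[OF refl])
      fix i assume "i \<in> ring_sites L"
      from v[OF this] show "n i + (if n i = 0 then 2 else 0) = 2" by auto
    qed
    then have "2 * L + 2 + 2 * card {i \<in> ring_sites L. n i = 0} = (2 * L + 1) * 2"
      unfolding sum.distrib S sum_constant card_ring_sites
      by (simp add: sum.inter_filter[symmetric])
    then have c: "card {i \<in> ring_sites L. n i = 0} = L" by simp
    have "?g n = (\<Prod>i\<in>ring_sites L. if n i = 0 then 1 / 4 else 1)"
      unfolding gibbs_weight_def exp_zero_cost S by simp
    also have "\<dots> = (\<Prod>i\<in>{i \<in> ring_sites L. n i = 0}. 1 / 4)"
      by (rule prod.inter_filter[symmetric]) simp
    also have "\<dots> = w"
      unfolding prod_constant c w_def ..
    finally show ?thesis
      using True by simp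
  next
    case False
    then have "(\<Sum>i\<in>ring_sites L. n i) - (2 * L + 2) \<noteq> 0"
      using ring_sum_ge[OF n] n ground_states[of L] by auto
    then have "?g n = 0"
      unfolding gibbs_weight_def by (simp add: power_0_left)
    then show ?thesis using False by simp
  qed
  have G: "finite ?G" "?G \<subseteq> ring_configs L" "card ?G = 2 * L + 1"
    using ground_states[of L] card_image[OF inj_ground_state[of L]] by auto
  have "partition_function zero_cost 0 L = infsum ?g ?G"
    unfolding partition_function_def using G g by (intro infsum_cong_neutral) auto
  also have "\<dots> = (\<Sum>n\<in>?G. w)"
    unfolding infsum_finite[OF G(1)]
  proof (rule sum.cong[OF refl])
    fix n assume "n \<in> ?G"
    then show "?g n = w"
      using G(2) g[of n] by auto
  qed
  finally have Z: "partition_function zero_cost 0 L = real (2 * L + 1) * w"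
    by (simp add: G(3))
  have w: "0 < w" by (simp add: w_def)
  let ?f = "\<lambda>n. ennreal (?g n / partition_function zero_cost 0 L)"
  have pos: "{n. n \<in> A \<inter> ring_configs L \<and> 0 < ?f n} = A \<inter> ?G"
    using G(2) g w by (auto simp: Z split: if_splits)
  have "emeasure (ring_gibbs zero_cost 0 L) (A \<inter> ring_configs L) = (\<Sum>n | n \<in> A \<inter> ring_configs L \<and> 0 < ?f n. ?f n)"
    unfolding ring_gibbs_def by (rule emeasure_point_measure) (use pos G(1) in auto)
  also have "\<dots> = (\<Sum>n\<in>A \<inter> ?G. ennreal (1 / real (2 * L + 1)))"
    unfolding pos by (intro sum.cong refl arg_cong[of _ _ ennreal]) (use G(2) g w in \<open>auto simp: Z\<close>)
  also have "\<dots> = ennreal (real (card (A \<inter> ?G)) * (1 / real (2 * L + 1)))"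
    by (subst sum_ennreal) simp_all
  finally have "measure (ring_gibbs zero_cost 0 L) (A \<inter> ring_configs L) = real (card (A \<inter> ?G)) / real (2 * L + 1)"
    by (simp add: measure_def)
  moreover have "A \<inter> ?G = ground_state L ` {j \<in> ring_sites L. ground_state L j \<in> A}" by auto
  moreover have "card (ground_state L ` {j \<in> ring_sites L. ground_state L j \<in> A}) = card {j \<in> ring_sites L. ground_state L j \<in> A}"
    by (intro card_image inj_on_subset[OF inj_ground_state]) auto
  ultimately show ?thesis by simp
qed

text \<open>The condition selects the positions of the defect for which the ground state looks like
  \<open>checkerboard True\<close> around the origin. Exactly one of any two opposite nonzero
  positions qualifies, and so does 0.\<close>

lemma card_even_nonneg: "card {j \<in> ring_sites L. even j = (0 \<le> j)} = L + 1"
proof (induction L)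
  case 0
  have "{j \<in> ring_sites 0. even j = (0 \<le> j)} = {0}" by auto
  then show ?case by simp
next
  case (Suc L)
  let ?k = "if even (Suc L) then int (Suc L) else - int (Suc L)"
  have "ring_sites (Suc L) = ring_sites L \<union> {int (Suc L), - int (Suc L)}" by auto
  then have "{j \<in> ring_sites (Suc L). even j = (0 \<le> j)} = insert ?k {j \<in> ring_sites L. even j = (0 \<le> j)}"
    by auto
  moreover have "?k \<notin> {j \<in> ring_sites L. even j = (0 \<le> j)}" by auto
  moreover have "finite {j \<in> ring_sites L. even j = (0 \<le> j)}"
    by (rule finite_subset[of _ "ring_sites L"]) auto
  ultimately show ?case
    using Suc by (simp only: card_insert_disjoint) simp
qed

lemma card_filter_bool:
  assumes "finite R"
  shows "real (card {j \<in> R. f (t j)}) = of_bool (f True) * real (card {j \<in> R. t j}) + of_bool (f False) * real (card {j \<in> R. \<not> t j})"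
proof -
  have "{j \<in> R. f (t j)} = (if f True then {j \<in> R. t j} else {}) \<union> (if f False then {j \<in> R. \<not> t j} else {})"
    by (auto split: if_splits) (metis (full_types))+
  then have "card {j \<in> R. f (t j)} = card (if f True then {j \<in> R. t j} else {}) + card (if f False then {j \<in> R. \<not> t j} else {})"
    using assms by (simp only:) (intro card_Un_disjoint; auto)
  then show ?thesis by simp
qed

text \<open>The pair of adjacent tall stacks sits at a uniformly distributed place, so it is far
  from a fixed window except with vanishing probability. Elsewhere the window sees a checkerboard,
  and the two phases are equally likely in the limit.\<close>

lemma gibbs_state_mu_hat2: "gibbs_state zero_cost 0 mu_hat2"
  unfolding gibbs_state_def
proof (intro conjI allI impI state_on_mu_hat2)
  fix W :: "int set" and A assume W: "finite W" and A: "depends_on W A"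
  obtain M :: nat where M: "W \<subseteq> {- int M..int M}"
    using finite_subset_symmetric_interval[OF W] .
  let ?t = "\<lambda>j::int. even j = (0 \<le> j)"
  let ?N = "\<lambda>L. {j \<in> ring_sites L. ground_state L j \<in> A}"
  let ?T = "\<lambda>L. {j \<in> ring_sites L. checkerboard (?t j) \<in> A}"
  define P Q where "P = (of_bool (checkerboard False \<in> A) :: real)" and "Q = (of_bool (checkerboard True \<in> A) :: real)"
  have T: "real (card (?T L)) = Q * real (L + 1) + P * real L" for L
  proof -
    have "real (card (?T L)) = Q * real (card {j \<in> ring_sites L. ?t j}) + P * real (card {j \<in> ring_sites L. \<not> ?t j})"
      using card_filter_bool[of "ring_sites L" "\<lambda>c. checkerboard c \<in> A" ?t] by (simp only: P_def Q_def finite_atLeastAtMost_int)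
    moreover have "card {j \<in> ring_sites L. \<not> ?t j} = L"
    proof -
      have "real (card (ring_sites L)) = real (card {j \<in> ring_sites L. ?t j}) + real (card {j \<in> ring_sites L. \<not> ?t j})"
        using card_filter_bool[of "ring_sites L" "\<lambda>_. True" ?t]
        by (simp only: of_bool_eq mult_1 simp_thms Collect_mem_eq finite_atLeastAtMost_int)
      then show ?thesis
        unfolding card_ring_sites card_even_nonneg by linarith
    qed
    ultimately show ?thesis
      by (simp only: card_even_nonneg)
  qed
  \<comment> \<open>A defect outside the window lies entirely to one side, so
    \<open>i \<le> j\<close> can be replaced by \<open>0 \<le> j\<close> for all \<open>i\<close> in
    the window.\<close>
  have far: "ground_state L j \<in> A \<longleftrightarrow> checkerboard (?t j) \<in> A" if "M \<le> L" "j \<in> ring_sites L" "j \<notin> {- int M..int M}" for L j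
  proof -
    have "ground_state L j i = checkerboard (?t j) i" if "i \<in> W" for i
    proof -
      have i: "- int M \<le> i" "i \<le> int M" using that M by auto
      then have "i \<in> ring_sites L" using \<open>M \<le> L\<close> by auto
      moreover have "i \<le> j \<longleftrightarrow> 0 \<le> j"
        using i \<open>j \<notin> _\<close> by auto
      ultimately show ?thesis
        by (auto simp: ground_state_def checkerboard_def)
    qed
    then show ?thesis using A unfolding depends_on_def by blast
  qed
  have close: "\<bar>real (card (?N L)) - real (card (?T L))\<bar> \<le> real (2 * M + 1)" if L: "M \<le> L" for L
  proof -
    have sub: "?N L \<subseteq> ?T L \<union> {- int M..int M}" "?T L \<subseteq> ?N L \<union> {- int M..int M}"
      using far[OF L] by blast+
    have fin: "finite {j \<in> ring_sites L. X j}" for X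
      by (rule finite_subset[of _ "ring_sites L"]) auto
    have "card (?N L) \<le> card (?T L \<union> {- int M..int M})"
      by (rule card_mono[OF _ sub(1)]) (intro finite_UnI fin finite_atLeastAtMost_int)
    moreover have "card (?T L) \<le> card (?N L \<union> {- int M..int M})"
      by (rule card_mono[OF _ sub(2)]) (intro finite_UnI fin finite_atLeastAtMost_int)
    ultimately have "card (?N L) \<le> card (?T L) + (2 * M + 1)" "card (?T L) \<le> card (?N L) + (2 * M + 1)"
      using card_Un_le[of "?T L" "{- int M..int M}"] card_Un_le[of "?N L" "{- int M..int M}"] unfolding card_ring_sites by linarith+
    then show ?thesis by linarith
  qed
  have "(\<lambda>L. real (card (?N L)) / real (2 * L + 1) - (P + Q) / 2) \<longlonglongrightarrow> 0"
  proof (rule Lim_null_comparison)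
    \<comment> \<open>Up to \<open>2 * M + 1\<close> positions of the defect meet the window, and
      the imbalance between the two phases contributes at most one more.\<close>
    show "\<forall>\<^sub>F L in sequentially. norm (real (card (?N L)) / real (2 * L + 1) - (P + Q) / 2) \<le> real (2 * M + 2) / real (2 * L + 1)"
      using eventually_ge_at_top[of M]
    proof eventually_elim
      case (elim L)
      have "real (card (?N L)) / real (2 * L + 1) - (P + Q) / 2 = (real (card (?N L)) - (P + Q) / 2 * real (2 * L + 1)) / real (2 * L + 1)"
      proof -
        have "real (2 * L + 1) \<noteq> 0" by simp
        then show ?thesis
          by (simp only: diff_divide_distrib nonzero_mult_div_cancel_right not_False_eq_True)
      qed
      moreover have "real (card (?T L)) - (P + Q) / 2 * real (2 * L + 1) = (Q - P) / 2"
        unfolding T by (simp add: field_simps)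
      moreover have "\<bar>(Q - P) / 2\<bar> \<le> 1"
        by (simp add: P_def Q_def)
      ultimately show ?case
        using close[OF elim] unfolding real_norm_def by (simp only: abs_divide) (intro frac_le; simp)
    qed
    show "(\<lambda>L. real (2 * M + 2) / real (2 * L + 1)) \<longlonglongrightarrow> 0"
      using LIMSEQ_subseq_LIMSEQ[OF lim_const_over_n[of "real (2 * M + 2)"], of "\<lambda>L. 2 * L + 1"]
      by (simp add: strict_mono_def comp_def)
  qed
  then have "(\<lambda>L. real (card (?N L)) / real (2 * L + 1)) \<longlonglongrightarrow> (P + Q) / 2"
    by (rule LIM_zero_cancel)
  then show "(\<lambda>L. measure (ring_gibbs zero_cost 0 L) (A \<inter> ring_configs L)) \<longlonglongrightarrow> measure mu_hat2 A"
    unfolding ring_gibbs_zero measure_mu_hat2[OF sets_depends_on[OF W A]] P_def Q_def .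
qed

theorem theorem5p2:
  "\<exists>\<mu>\<^sub>e :: real \<Rightarrow> config measure.
     (\<forall>\<rho>\<ge>1. ETIS Xe (\<mu>\<^sub>e \<rho>) \<and> has_density (\<mu>\<^sub>e \<rho>) \<rho> \<and>
        (\<exists>\<zeta>. 0 \<le> \<zeta> \<and> \<zeta> < 1 \<and> gibbs_state (\<lambda>n. if n = 0 then 2 * ln 2 else 0) \<zeta> (\<mu>\<^sub>e \<rho>))) \<and>
     \<mu>\<^sub>e 1 = mu_hat2 \<and> ergodic (\<mu>\<^sub>e 1) \<and> \<not> weakly_mixing (\<mu>\<^sub>e 1) \<and>
     (\<forall>\<rho>>1. mixing (\<mu>\<^sub>e \<rho>))"
proof -
  \<comment> \<open>The fugacity solves \<open>1 / (1 - z) = \<rho>\<close>. It would be 0 at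
    density one, which therefore has its own branch.\<close>
  define \<mu>\<^sub>e where "\<mu>\<^sub>e \<rho> = (if \<rho> = 1 then mu_hat2 else gibbs_chain (1 - 1 / \<rho>))" for \<rho> :: real
  have one: "\<mu>\<^sub>e 1 = mu_hat2" by (simp add: \<mu>\<^sub>e_def)
  have gt: "mixing (\<mu>\<^sub>e \<rho>) \<and> ETIS Xe (\<mu>\<^sub>e \<rho>) \<and> has_density (\<mu>\<^sub>e \<rho>) \<rho> \<and>
      (\<exists>\<zeta>. 0 \<le> \<zeta> \<and> \<zeta> < 1 \<and> gibbs_state zero_cost \<zeta> (\<mu>\<^sub>e \<rho>))" if \<rho>: "1 < \<rho>" for \<rho>
  proof -
    define z where "z = 1 - 1 / \<rho>"
    have z: "0 < z" "z < 1" "1 / (1 - z) = \<rho>" using \<rho> by (auto simp: z_def)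
    have \<mu>: "\<mu>\<^sub>e \<rho> = gibbs_chain z" using \<rho> by (simp add: \<mu>\<^sub>e_def z_def)
    have G: "gibbs_state zero_cost z (gibbs_chain z)"
      by (rule gibbs_state_gibbs_chain[OF z(1,2)])
    then have "TIS Xe (gibbs_chain z)"
      unfolding TIS_def gibbs_state_def
      using translation_invariant_gibbs_chain stationary_gibbs_chain[OF z(1,2)] by simp
    then have "ETIS Xe (gibbs_chain z)"
    proof (rule ETISI)
      fix \<nu> assume "TIS Xe \<nu>" "absolutely_continuous (gibbs_chain z) \<nu>"
      then show "\<nu> = gibbs_chain z"
        by (intro mixing_absolutely_continuous_eq mixing_gibbs_chain z prob_space_gibbs_chain sets_gibbs_chain)
          (auto simp: TIS_def state_on_def)
    qed
    then show ?thesis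
      unfolding \<mu> using mixing_gibbs_chain[OF z(1)] has_density_gibbs_chain[OF z(1,2)] z G
      by (auto intro!: exI[of _ z])
  qed
  show ?thesis
  proof (intro exI[of _ \<mu>\<^sub>e] conjI allI impI)
    fix \<rho> :: real assume "1 \<le> \<rho>"
    then consider "\<rho> = 1" | "1 < \<rho>" by linarith
    then show "ETIS Xe (\<mu>\<^sub>e \<rho>)" "has_density (\<mu>\<^sub>e \<rho>) \<rho>" "\<exists>\<zeta>. 0 \<le> \<zeta> \<and> \<zeta> < 1 \<and> gibbs_state zero_cost \<zeta> (\<mu>\<^sub>e \<rho>)"
      using gt[of \<rho>] ETIS_mu_hat2 has_density_mu_hat2 gibbs_state_mu_hat2 by (cases; force simp: one)+
  qed (use gt one ergodic_mu_hat2 not_weakly_mixing_mu_hat2 in auto)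
qed

end
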